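(* Let $M\subset\mathbb{C}^{10}$ (coordinates $(z,w)\in\mathbb{C}^3\times\mathbb{C}^7$) be the real submanifold of codimension $7$ through $0$ given by $$\begin{cases} \operatorname{Re} w_1= z_1\overline{z_1}+z_2\overline{z_2}-z_3\overline{z_3}\\ \operatorname{Re} w_2= z_1\overline{z_1}-z_2\overline{z_2}\\ \operatorname{Re} w_3= z_2\overline{z_3}+z_3\overline{z_2}\\ \operatorname{Re} w_4= z_1\overline{z_2}+z_2\overline{z_1}\\ \operatorname{Re} w_5= iz_1\overline{z_3}-iz_3\overline{z_1}\\ \operatorname{Re} w_6= iz_2\overline{z_3}-iz_3\overline{z_2}\\ \operatorname{Re} w_7= iz_1\overline{z_2}-iz_2\overline{z_1}. \end{cases}$$ Then $M$ is neither strongly pseudoconvex nor $\mathfrak{D}$-nondegenerate at $0$. Moreover there exist $a\in\mathbb{C}^7$, $a\neq 0$, small enough, and $V\in\mathbb{C}^3$ (for a suitable $b\in\mathbb{R}^7$ such that $\sum_j b_jA_j$ is invertible) such that (i) $M$ is $\mathfrak{D}(a)$-nondegenerate at $0$, and (ii) the $1$-jet map at $\zeta=1$ defined on $\mathcal{S}_0(M)$ by $\mathfrak{j}_1:\boldsymbol{f}\mapsto\boldsymbol{f}'(1)$ is a (local) diffeomorphism at the lift parametrized by $(a,V)$; that is, the map $$\mathfrak{j}_1:(a,V)\mapsto\Big(V,\ \big({}^t\overline{V}(I-{}^t\overline{X})K_j(I-X)V\big)_{j=1,\dots,7},\ \operatorname{Im} a\Big)\in\mathbb{C}^3\times\mathbb{R}^7\times\mathbb{R}^7,$$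 defined for $a\in\mathbb{C}^7$ near $0$ and $V\in\mathbb{C}^3$, is a local diffeomorphism at $(a,V)$.
   Context: Here $n=3$, $d=7$, and $A_1,\dots,A_7$ are the Hermitian $3\times 3$ matrices such that the equations of $M$ read $\operatorname{Re} w_j={}^t\bar z A_jz$, $j=1,\dots,d$. The general definitions below are for such quadrics in $\mathbb{C}^{n+d}$. $M$ is strongly Levi nondegenerate (resp. strongly pseudoconvex) at $0$ if there is $b\in\mathbb{R}^d$ such that $\sum_j b_jA_j$ is invertible (resp. positive definite). $M$ is $\mathfrak{D}$-nondegenerate at $0$ if it is strongly Levi nondegenerate at $0$, with $\sum_j b_jA_j$ invertible, and there exists $V\in\mathbb{C}^n$ such that the $d\times d$ matrix $\operatorname{Re}\big({}^t\overline{D}(\sum_j b_jA_j)^{-1}D\big)$ is invertible, where $D$ is the $n\times d$ matrix whose $j$-th column is $A_jV$. Given $b\in\mathbb{R}^d$ with $\sum_j b_jA_j$ invertible and $a\in\mathbb{C}^d$ sufficiently small, put $P:=\sum_j a_jA_j$ and $A:=\sum_j(b_j-a_j-\overline{a_j})A_j$ (invertible), and let $X$ be the unique $n\times n$ matrix with $\|X\|<1$ solving $PX^2+AX+{}^t\overline{P}=0$; it depends real-analytically on $(a,\bar a)$. "Small enough" means small enough for this to hold. Put $K_j:=\sum_{r=0}^\infty {}^t\overline{X}^{\,r}A_jX^r$. $M$ is $\mathfrak{D}(a)$-nondegenerate at $0$ if (for such $b$ and $a$) there exists $V\in\mathbb{C}^n$ such that the $d\times d$ matrix $\Big(\operatorname{Re}\sum_{r=0}^\infty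 {}^t\overline{V}\,{}^t\overline{X}^{\,r}A_jA^{-1}A_sX^rV\Big)_{j,s}$ is nondegenerate. Stationary discs: with $r_j=\operatorname{Re}w_j-{}^t\bar zA_jz$, $\Delta$ the unit disc in $\mathbb{C}$ and $N=n+d$, a holomorphic disc $f:\Delta\to\mathbb{C}^{N}$, continuous up to $\partial\Delta$, with $f(\partial\Delta)\subset M$, is stationary if there are real functions $c_1,\dots,c_d$ on $\partial\Delta$ with $\sum_jc_j(\zeta)\partial r_j(0)\neq0$ for all $\zeta\in\partial\Delta$ such that $\tilde f(\zeta)=\zeta\sum_jc_j(\zeta)\partial r_j(f(\zeta),\overline{f(\zeta)})$ extends holomorphically to $\Delta$; $\boldsymbol{f}=(f,\tilde f)$ is then a lift. $\mathcal{S}_0(M)$ denotes the set of lifts $\boldsymbol{f}$ of nonconstant stationary discs with $\boldsymbol{f}(1)=(0,0,0,b/2)$ for the fixed $b$. Lifts in $\mathcal{S}_0(M)$ are parametrized by $(a,V)\in\mathbb{C}^d\times\mathbb{C}^n$ with $a$ small, and in this parametrization the $1$-jet map $\boldsymbol{f}\mapsto\boldsymbol{f}'(1)$ is identified with the explicit map $\mathfrak{j}_1$ displayed in the claim, in which $b$ is fixed and $X$, $K_j$ depend on $a$. *)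

theory Defs
  imports "HOL-Analysis.Analysis" "HOL-Library.FuncSet"
begin

section \<open>Smooth maps and local diffeomorphisms\<close>

text \<open>
  For maps between finite-dimensional spaces and open \<open>S\<close>, this is the usual class \<open>C^k\<close>:
  all iterated directional derivatives up to order \<open>k\<close> exist and are continuous.
\<close>

primrec Ck_on :: "nat \<Rightarrow> ('a::euclidean_space \<Rightarrow> 'b::euclidean_space) \<Rightarrow> 'a set \<Rightarrow> bool" where
  "Ck_on 0 f S \<longleftrightarrow> continuous_on S f"
| "Ck_on (Suc k) f S \<longleftrightarrow>
     (\<forall>x\<in>S. f differentiable (at x)) \<and> (\<forall>v. Ck_on k (\<lambda>x. frechet_derivative f (at x) v) S)"

definition smooth_on :: "('a::euclidean_space \<Rightarrow> 'b::euclidean_space) \<Rightarrow> 'a set \<Rightarrow> bool" where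
  "smooth_on f S \<longleftrightarrow> (\<forall>k. Ck_on k f S)"

definition local_diffeomorphism_at ::
    "('a::euclidean_space \<Rightarrow> 'b::euclidean_space) \<Rightarrow> 'a \<Rightarrow> bool" where
  "local_diffeomorphism_at f x \<longleftrightarrow>
     (\<exists>U. open U \<and> x \<in> U \<and> inj_on f U \<and> open (f ` U) \<and>
          smooth_on f U \<and> smooth_on (inv_into U f) (f ` U))"


section \<open>Matrices\<close>

definition conj_transpose :: "complex^'n^'m \<Rightarrow> complex^'m^'n" where
  "conj_transpose A = (\<chi> i j. cnj (A $ j $ i))"

definition hermitian :: "complex^'n^'n \<Rightarrow> bool" where
  "hermitian A \<longleftrightarrow> conj_transpose A = A"

text \<open>The sesquilinear form \<open>x\<^sup>* y\<close>, conjugate-linear in the first argument.\<close>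

definition cinner :: "complex^'n \<Rightarrow> complex^'n \<Rightarrow> complex" where
  "cinner x y = (\<Sum>i\<in>UNIV. cnj (x $ i) * y $ i)"

definition positive_definite :: "complex^'n^'n \<Rightarrow> bool" where
  "positive_definite A \<longleftrightarrow> hermitian A \<and> (\<forall>z. z \<noteq> 0 \<longrightarrow> 0 < Re (cinner z (A *v z)))"

text \<open>The class operation \<open>X ^ r\<close> on vectors of vectors is entrywise, hence this separate power.\<close>

primrec matpow :: "complex^'n^'n \<Rightarrow> nat \<Rightarrow> complex^'n^'n" where
  "matpow X 0 = mat 1"
| "matpow X (Suc r) = X ** matpow X r"

definition cvec :: "real^'d \<Rightarrow> complex^'d" where
  "cvec b = (\<chi> j. complex_of_real (b $ j))"

definition pencil :: "('d::finite \<Rightarrow> complex^'n^'n) \<Rightarrow> complex^'d \<Rightarrow> complex^'n^'n" where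
  "pencil A c = (\<chi> i k. \<Sum>j\<in>UNIV. c $ j * A j $ i $ k)"


section \<open>Quadrics and nondegeneracy conditions\<close>

text \<open>
  Throughout, \<open>A\<close> is the family of Hermitian matrices defining the quadric
  \<open>Re w\<^sub>j = z\<^sup>* A\<^sub>j z\<close> in \<open>\<complex>\<^sup>n \<times> \<complex>\<^sup>d\<close>.
\<close>

definition defining_fun ::
    "('d \<Rightarrow> complex^'n^'n) \<Rightarrow> 'd \<Rightarrow> (complex^'n) \<times> (complex^'d) \<Rightarrow> real" where
  "defining_fun A j p = Re (snd p $ j) - Re (cinner (fst p) (A j *v fst p))"

definition quadric :: "('d::finite \<Rightarrow> complex^'n^'n) \<Rightarrow> ((complex^'n) \<times> (complex^'d)) set" where
  "quadric A = {p. \<forall>j. defining_fun A j p = 0}"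

definition strongly_Levi_nondegenerate :: "('d::finite \<Rightarrow> complex^'n^'n) \<Rightarrow> bool" where
  "strongly_Levi_nondegenerate A \<longleftrightarrow> (\<exists>b. invertible (pencil A (cvec b)))"

definition strongly_pseudoconvex :: "('d::finite \<Rightarrow> complex^'n^'n) \<Rightarrow> bool" where
  "strongly_pseudoconvex A \<longleftrightarrow> (\<exists>b. positive_definite (pencil A (cvec b)))"

definition D_matrix :: "('d::finite \<Rightarrow> complex^'n^'n) \<Rightarrow> complex^'n \<Rightarrow> complex^'d^'n" where
  "D_matrix A V = (\<chi> i j. (A j *v V) $ i)"

definition D_nondegenerate :: "('d::finite \<Rightarrow> complex^'n^'n) \<Rightarrow> bool" where
  "D_nondegenerate A \<longleftrightarrow>
     strongly_Levi_nondegenerate A \<and>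
     (\<exists>b. invertible (pencil A (cvec b)) \<and>
       (\<exists>V. invertible ((\<chi> j s. Re ((conj_transpose (D_matrix A V) **
                matrix_inv (pencil A (cvec b)) ** D_matrix A V) $ j $ s)) :: real^'d^'d)))"

definition shifted_pencil ::
    "('d::finite \<Rightarrow> complex^'n^'n) \<Rightarrow> real^'d \<Rightarrow> complex^'d \<Rightarrow> complex^'n^'n" where
  "shifted_pencil A b a = pencil A (\<chi> j. complex_of_real (b $ j) - a $ j - cnj (a $ j))"

definition X_solution ::
    "('d::finite \<Rightarrow> complex^'n^'n) \<Rightarrow> real^'d \<Rightarrow> complex^'d \<Rightarrow> complex^'n^'n \<Rightarrow> bool" where
  "X_solution A b a X \<longleftrightarrow>
     onorm ((*v) X) < 1 \<and>
     pencil A a ** X ** X + shifted_pencil A b a ** X + conj_transpose (pencil A a) = 0"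

definition X_mat ::
    "('d::finite \<Rightarrow> complex^'n^'n) \<Rightarrow> real^'d \<Rightarrow> complex^'d \<Rightarrow> complex^'n^'n" where
  "X_mat A b a = (THE X. X_solution A b a X)"

text \<open>
  Real-analyticity of \<open>X\<close> in \<open>a\<close> near \<open>0\<close> follows from the implicit function theorem and is not
  required here; a statement about arbitrarily small \<open>a\<close> covers any smaller threshold.
\<close>

definition small_enough :: "('d::finite \<Rightarrow> complex^'n^'n) \<Rightarrow> real^'d \<Rightarrow> complex^'d \<Rightarrow> bool" where
  "small_enough A b a \<longleftrightarrow>
     (\<exists>\<delta>. norm a < \<delta> \<and>
       (\<forall>a'. norm a' < \<delta> \<longrightarrow> invertible (shifted_pencil A b a') \<and> (\<exists>!X. X_solution A b a' X)))"

definition K_mat ::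
    "('d::finite \<Rightarrow> complex^'n^'n) \<Rightarrow> real^'d \<Rightarrow> complex^'d \<Rightarrow> 'd \<Rightarrow> complex^'n^'n" where
  "K_mat A b a j =
     (\<Sum>r. matpow (conj_transpose (X_mat A b a)) r ** A j ** matpow (X_mat A b a) r)"

definition Da_nondegenerate ::
    "('d::finite \<Rightarrow> complex^'n^'n) \<Rightarrow> real^'d \<Rightarrow> complex^'d \<Rightarrow> bool" where
  "Da_nondegenerate A b a \<longleftrightarrow>
     (\<exists>V. invertible ((\<chi> j s.
        Re (\<Sum>r. cinner V ((matpow (conj_transpose (X_mat A b a)) r ** A j **
              matrix_inv (shifted_pencil A b a) ** A s ** matpow (X_mat A b a) r) *v V)))
        :: real^'d^'d))"


section \<open>Stationary discs and their lifts\<close>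

definition cscale ::
    "complex \<Rightarrow> (complex^'n) \<times> (complex^'d) \<Rightarrow> (complex^'n) \<times> (complex^'d)" where
  "cscale c p = (c *s fst p, c *s snd p)"

text \<open>
  The coefficients of the (1,0)-form \<open>\<partial>r\<close>, by the Wirtinger formula
  \<open>\<partial>r/\<partial>x\<^sub>k = (D\<^sub>e r - i D\<^sub>i\<^sub>e r) / 2\<close> with \<open>e\<close> the unit vector of the coordinate \<open>x\<^sub>k\<close>.
\<close>

definition del ::
    "((complex^'n) \<times> (complex^'d) \<Rightarrow> real) \<Rightarrow>
     (complex^'n) \<times> (complex^'d) \<Rightarrow> (complex^'n) \<times> (complex^'d)" where
  "del r p =
     ((\<chi> k. (complex_of_real (frechet_derivative r (at p) (axis k 1, 0))
              - \<i> * complex_of_real (frechet_derivative r (at p) (axis k \<i>, 0))) / 2),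
      (\<chi> k. (complex_of_real (frechet_derivative r (at p) (0, axis k 1))
              - \<i> * complex_of_real (frechet_derivative r (at p) (0, axis k \<i>))) / 2))"

definition analytic_disc :: "(complex \<Rightarrow> (complex^'n) \<times> (complex^'d)) \<Rightarrow> bool" where
  "analytic_disc f \<longleftrightarrow>
     continuous_on (cball 0 1) f \<and>
     (\<forall>k. (\<lambda>\<zeta>. fst (f \<zeta>) $ k) holomorphic_on ball 0 1) \<and>
     (\<forall>j. (\<lambda>\<zeta>. snd (f \<zeta>) $ j) holomorphic_on ball 0 1)"

text \<open>\<open>g\<close> is the disc \<open>f~\<close>: the extension to the closed disc of a conormal field along \<open>f\<close>.\<close>

definition stationary_lift ::
    "('d::finite \<Rightarrow> complex^'n^'n) \<Rightarrow> (complex \<Rightarrow> (complex^'n) \<times> (complex^'d)) \<Rightarrow>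
     (complex \<Rightarrow> (complex^'n) \<times> (complex^'d)) \<Rightarrow> bool" where
  "stationary_lift A f g \<longleftrightarrow>
     analytic_disc f \<and> f ` sphere 0 1 \<subseteq> quadric A \<and> analytic_disc g \<and>
     (\<exists>c :: complex \<Rightarrow> real^'d. \<forall>\<zeta>\<in>sphere 0 1.
        (\<Sum>j\<in>UNIV. (c \<zeta> $ j) *\<^sub>R del (defining_fun A j) 0) \<noteq> 0 \<and>
        g \<zeta> = cscale \<zeta> (\<Sum>j\<in>UNIV. (c \<zeta> $ j) *\<^sub>R del (defining_fun A j) (f \<zeta>)))"

text \<open>
  Lifts are functions on the closed unit disc; extensionality makes equality of
  the total HOL functions coincide with equality on that disc.
\<close>

definition S0 ::
    "('d::finite \<Rightarrow> complex^'n^'n) \<Rightarrow> real^'d \<Rightarrow>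
     (complex \<Rightarrow> ((complex^'n) \<times> (complex^'d)) \<times> ((complex^'n) \<times> (complex^'d))) set" where
  "S0 A b =
     {F. F \<in> extensional (cball 0 1) \<and>
         stationary_lift A (\<lambda>\<zeta>. fst (F \<zeta>)) (\<lambda>\<zeta>. snd (F \<zeta>)) \<and>
         \<not> (\<lambda>\<zeta>. fst (F \<zeta>)) constant_on cball 0 1 \<and>
         F 1 = ((0, 0), (0, (1/2) *s cvec b))}"

text \<open>\<open>J\<close> is the derivative \<open>F'(1)\<close>, taken at the boundary point \<open>1\<close> from within the closed disc.\<close>

definition has_jet ::
    "(complex \<Rightarrow> ((complex^'n) \<times> (complex^'d)) \<times> ((complex^'n) \<times> (complex^'d))) \<Rightarrow>
     ((complex^'n) \<times> (complex^'d)) \<times> ((complex^'n) \<times> (complex^'d)) \<Rightarrow> bool" where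
  "has_jet F J \<longleftrightarrow>
     (F has_derivative (\<lambda>h. (cscale h (fst J), cscale h (snd J)))) (at 1 within cball 0 1)"

text \<open>
  The parameters of a lift \<open>((h, w), (h~, w~))\<close>. Since \<open>w~\<^sub>j = \<zeta> c\<^sub>j / 2\<close> is holomorphic, \<open>c\<^sub>j\<close> is real and
  \<open>c(1) = b\<close>, one has \<open>c\<^sub>j = a\<^sub>j \<zeta>\<^sup>-\<^sup>1 + (b\<^sub>j - a\<^sub>j - cnj a\<^sub>j) + cnj a\<^sub>j \<zeta>\<close> on the circle, with \<open>a = 2 w~(0)\<close>;
  this is the \<open>a\<close> for which the \<open>h\<close>-component involves the solution \<open>X\<close> of
  \<open>P X\<^sup>2 + A X + P\<^sup>* = 0\<close>. The second parameter is \<open>V = h'(1)\<close>.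
\<close>

definition parametrized_by ::
    "(complex \<Rightarrow> ((complex^'n) \<times> (complex^'d)) \<times> ((complex^'n) \<times> (complex^'d))) \<Rightarrow>
     (complex^'d) \<times> (complex^'n) \<Rightarrow> bool" where
  "parametrized_by F p \<longleftrightarrow>
     fst p = 2 *s snd (snd (F 0)) \<and>
     ((\<lambda>\<zeta>. fst (fst (F \<zeta>))) has_derivative (\<lambda>h. h *s snd p)) (at 1 within cball 0 1)"

text \<open>
  The explicit 1-jet map. The middle entries are real (the \<open>K\<^sub>j\<close> are Hermitian), so \<open>Re\<close> only changes the type.
\<close>

definition jet1 ::
    "('d::finite \<Rightarrow> complex^'n^'n) \<Rightarrow> real^'d \<Rightarrow>
     (complex^'d) \<times> (complex^'n) \<Rightarrow> (complex^'n) \<times> (real^'d) \<times> (real^'d)" where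
  "jet1 A b = (\<lambda>(a, V).
     (V,
      (\<chi> j. Re (cinner V (((mat 1 - conj_transpose (X_mat A b a)) ** K_mat A b a j **
                              (mat 1 - X_mat A b a)) *v V))),
      (\<chi> j. Im (a $ j))))"

text \<open>
  The injective real-affine map that identifies \<open>\<complex>\<^sup>n \<times> \<real>\<^sup>d \<times> \<real>\<^sup>d\<close> with the set of possible jets \<open>F'(1)\<close>:
  the derivatives at \<open>1\<close> of \<open>h\<close>, \<open>w\<close>, \<open>h~\<close> and \<open>w~\<close> are
  \<open>V\<close>, \<open>-2 V\<^sup>*(I - X\<^sup>*) K\<^sub>j (I - X) V\<close>, \<open>V\<^sup>* (\<Sum> b\<^sub>j A\<^sub>j)\<close> and \<open>b/2 - i Im a\<close>.
\<close>

definition jet_embedding ::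
    "('d::finite \<Rightarrow> complex^'n^'n) \<Rightarrow> real^'d \<Rightarrow> (complex^'n) \<times> (real^'d) \<times> (real^'d) \<Rightarrow>
     ((complex^'n) \<times> (complex^'d)) \<times> ((complex^'n) \<times> (complex^'d))" where
  "jet_embedding A b = (\<lambda>(V, q, y).
     ((V, (- 2) *s cvec q),
      ((\<chi> k. \<Sum>i\<in>UNIV. cnj (V $ i) * pencil A (cvec b) $ i $ k),
       (1/2) *s cvec b - \<i> *s cvec y)))"

text \<open>
  The map \<open>F \<mapsto> F'(1)\<close> on \<open>S0 A b\<close> is a local diffeomorphism at the lift with parameters \<open>p\<close>:
  near \<open>p\<close> the parameters are a chart of \<open>S0 A b\<close>, in which the jet map is given, via \<open>jet_embedding\<close>,
  by the local diffeomorphism \<open>jet1\<close>.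
\<close>

definition jet_map_local_diffeomorphism_at ::
    "('d::finite \<Rightarrow> complex^'n^'n) \<Rightarrow> real^'d \<Rightarrow> (complex^'d) \<times> (complex^'n) \<Rightarrow> bool" where
  "jet_map_local_diffeomorphism_at A b p \<longleftrightarrow>
     (\<exists>U. open U \<and> p \<in> U \<and>
        (\<forall>q\<in>U. \<exists>!F. F \<in> S0 A b \<and> parametrized_by F q) \<and>
        (\<forall>q\<in>U. \<forall>F\<in>S0 A b. parametrized_by F q \<longrightarrow> has_jet F (jet_embedding A b (jet1 A b q)))) \<and>
     local_diffeomorphism_at (jet1 A b) p"


section \<open>The quadric of codimension 7\<close>

definition M7 :: "((complex^3) \<times> (complex^7)) set" where
  "M7 = {(z, w).
     complex_of_real (Re (w $ 1)) = z$1 * cnj (z$1) + z$2 * cnj (z$2) - z$3 * cnj (z$3) \<and>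
     complex_of_real (Re (w $ 2)) = z$1 * cnj (z$1) - z$2 * cnj (z$2) \<and>
     complex_of_real (Re (w $ 3)) = z$2 * cnj (z$3) + z$3 * cnj (z$2) \<and>
     complex_of_real (Re (w $ 4)) = z$1 * cnj (z$2) + z$2 * cnj (z$1) \<and>
     complex_of_real (Re (w $ 5)) = \<i> * z$1 * cnj (z$3) - \<i> * z$3 * cnj (z$1) \<and>
     complex_of_real (Re (w $ 6)) = \<i> * z$2 * cnj (z$3) - \<i> * z$3 * cnj (z$2) \<and>
     complex_of_real (Re (w $ 7)) = \<i> * z$1 * cnj (z$2) - \<i> * z$2 * cnj (z$1)}"

definition A7 :: "7 \<Rightarrow> complex^3^3" where
  "A7 j =
    (if j = 1 then vector [vector [1, 0, 0], vector [0, 1, 0], vector [0, 0, -1]]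
     else if j = 2 then vector [vector [1, 0, 0], vector [0, -1, 0], vector [0, 0, 0]]
     else if j = 3 then vector [vector [0, 0, 0], vector [0, 0, 1], vector [0, 1, 0]]
     else if j = 4 then vector [vector [0, 1, 0], vector [1, 0, 0], vector [0, 0, 0]]
     else if j = 5 then vector [vector [0, 0, -\<i>], vector [0, 0, 0], vector [\<i>, 0, 0]]
     else if j = 6 then vector [vector [0, 0, 0], vector [0, 0, -\<i>], vector [0, \<i>, 0]]
     else vector [vector [0, -\<i>, 0], vector [\<i>, 0, 0], vector [0, 0, 0]])"

lemma exhaust_7: "j = 1 \<or> j = 2 \<or> j = 3 \<or> j = 4 \<or> j = 5 \<or> j = 6 \<or> j = 7" for j :: 7
proof (induct j)
  case (of_int z)
  then have "0 \<le> z" and "z < 7" by simp_all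
  then have "z = 0 \<or> z = 1 \<or> z = 2 \<or> z = 3 \<or> z = 4 \<or> z = 5 \<or> z = 6" by arith
  then show ?case by auto
qed

lemma forall_7: "(\<forall>j::7. P j) \<longleftrightarrow> P 1 \<and> P 2 \<and> P 3 \<and> P 4 \<and> P 5 \<and> P 6 \<and> P 7"
  by (metis exhaust_7)

lemma hermitian_A7: "hermitian (A7 j)"
  unfolding hermitian_def conj_transpose_def A7_def
  by (simp add: vec_eq_iff forall_3)

text \<open>\<open>A7\<close> is indeed the family of matrices of the equations defining \<open>M7\<close>.\<close>

lemma quadric_A7: "quadric A7 = M7"
proof -
  have "p \<in> quadric A7 \<longleftrightarrow> p \<in> M7" for p
    unfolding quadric_def M7_def defining_fun_def cinner_def matrix_vector_mult_def
      mem_Collect_eq forall_7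
    by (cases p) (simp add: A7_def sum_3 complex_eq_iff algebra_simps)
  then show ?thesis by blast
qed

end

theory Submission
  imports Defs "HOL-Complex_Analysis.Conformal_Mappings"
begin

text \<open>
  The two negative statements are elementary. The diagonal entries of the pencil at \<open>b\<close> are
  \<open>b\<^sub>1 + b\<^sub>2\<close>, \<open>b\<^sub>1 - b\<^sub>2\<close>, \<open>- b\<^sub>1\<close>, and these are never all positive. The matrix \<open>Re (D\<^sup>* B\<inverse> D)\<close> is always
  singular because the real-linear map \<open>t \<mapsto> D t\<close> goes from seven to six real dimensions.

  For the positive statement three facts about an arbitrary family of Hermitian matrices are needed. In the
  comments, \<open>P\<close>, \<open>S\<close> and \<open>B\<close> stand for the pencil at \<open>a\<close>, the shifted pencil and the pencil at \<open>b\<close>, so that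
  \<open>S = B - P - P\<^sup>*\<close> and \<open>P X\<^sup>2 + S X + P\<^sup>* = 0\<close>.

  First, \<open>X\<close> and the \<open>K\<^sub>j\<close> depend smoothly on small \<open>a\<close> (\<open>X_mat_K_mat_smooth\<close>). The pair solves a
  polynomial system, the Riccati equation for \<open>X\<close> and the Stein equations \<open>K\<^sub>j - X\<^sup>* K\<^sub>j X = A\<^sub>j\<close>, whose
  linearization at \<open>a = 0\<close> is invertible. A smooth inverse function theorem
  (\<open>smooth_inverse_function_theorem\<close>) yields a smooth solution, and a norm estimate shows that \<open>X\<close> is unique.

  Second, the lifts are explicit (\<open>explicit_lift_in_S0\<close>, \<open>lift_is_explicit\<close>). On the unit circle the pencil
  at the multipliers factors as \<open>(I - X\<^sup>* / \<zeta>) Q (I - \<zeta> X)\<close> with \<open>Q\<close> Hermitian. A function of the disc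
  algebra that is real on the circle is constant; together with the factorization this
  forces \<open>(I - \<zeta> X) h\<close> to be affine in \<open>\<zeta>\<close>, and all components of the lift follow. Their derivatives at
  \<open>\<zeta> = 1\<close> are those predicted by the jet map.

  Third, the jet map is a local diffeomorphism where its derivative is injective
  (\<open>jet_map_local_diffeomorphism_criterion\<close>). As it contains \<open>V\<close> and \<open>Im a\<close> as components, only real variations of
  \<open>a\<close> have to be tested, and their effect on \<open>X\<close> and \<open>K\<^sub>j\<close> is found by differentiating the defining equations.

  It remains to choose \<open>b\<close>, \<open>a\<close> and \<open>V\<close>. For \<open>a = 0\<close> both conditions fail, by the dimension count above, so \<open>X\<close>
  must be nonzero; it is convenient to have it nilpotent, so that all series stop. With
  \<open>b = (0, 1, 1, 0, 0, 0, 0)\<close> and \<open>a = (0, 0, 0, e/2, 0, 0, i e/2)\<close> one gets \<open>P = e E\<^sub>1\<^sub>2\<close> and \<open>X = - e E\<^sub>3\<^sub>1\<close>. For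
  \<open>V = (1, 1, 0)\<close> and small \<open>e > 0\<close> the two resulting systems of seven real linear equations in seven
  unknowns have only the zero solution (\<open>Da_nondegenerate_a7\<close>, \<open>jacobian_system\<close>).
\<close>

section \<open>Smooth maps and their inverses\<close>


lemma has_derivative_cong_on_open:
  assumes "open S" "\<And>x. x \<in> S \<Longrightarrow> f x = g x" "x \<in> S"
  shows "(f has_derivative D) (at x) \<longleftrightarrow> (g has_derivative D) (at x)"
  using has_derivative_transform_within_open[OF _ assms(1,3)] assms(2) by metis

lemma Ck_on_cong:
  assumes "open S" "\<And>x. x \<in> S \<Longrightarrow> f x = g x"
  shows "Ck_on k f S \<longleftrightarrow> Ck_on k g S"
  using assms(2)
proof (induction k arbitrary: f g)
  case 0
  then show ?case using continuous_on_cong[of S S f g] by simp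
next
  case (Suc k)
  have eq: "(f has_derivative D) (at x) \<longleftrightarrow> (g has_derivative D) (at x)" if "x \<in> S" for x D
    using has_derivative_cong_on_open[OF assms(1) Suc.prems that] .
  then have "f differentiable (at x) \<longleftrightarrow> g differentiable (at x)" if "x \<in> S" for x
    using that by (simp add: differentiable_def)
  moreover have "frechet_derivative f (at x) = frechet_derivative g (at x)" if "x \<in> S" for x
    using eq[OF that] by (simp add: frechet_derivative_def)
  moreover from this have "Ck_on k (\<lambda>x. frechet_derivative f (at x) v) S \<longleftrightarrow>
      Ck_on k (\<lambda>x. frechet_derivative g (at x) v) S" for v
    by (intro Suc.IH) simp
  ultimately show ?case by simp
qed

lemma Ck_on_transform:
  assumes "open S" "Ck_on k f S" "\<And>x. x \<in> S \<Longrightarrow> g x = f x"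
  shows "Ck_on k g S"
  using Ck_on_cong[OF assms(1), of g f k] assms(2,3) by simp

lemma Ck_on_Suc_D: "Ck_on (Suc k) f S \<Longrightarrow> Ck_on k f S"
proof (induction k arbitrary: f)
  case 0
  then show ?case
    by (auto intro!: continuous_at_imp_continuous_on differentiable_imp_continuous_within)
next
  case (Suc k)
  then show ?case by (metis Ck_on.simps(2))
qed

lemma Ck_on_subset: "Ck_on k f S \<Longrightarrow> T \<subseteq> S \<Longrightarrow> Ck_on k f T"
  by (induction k arbitrary: f) (auto intro: continuous_on_subset)

lemma Ck_on_SucI:
  assumes "open S" "\<And>x. x \<in> S \<Longrightarrow> (f has_derivative D x) (at x)"
    "\<And>v. Ck_on k (\<lambda>x. D x v) S"
  shows "Ck_on (Suc k) f S"
proof -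
  have "frechet_derivative f (at x) = D x" if "x \<in> S" for x
    using assms(2)[OF that] by (simp add: frechet_derivative_at[symmetric])
  then have "Ck_on k (\<lambda>x. frechet_derivative f (at x) v) S" for v
    by (intro Ck_on_transform[OF assms(1) assms(3)]) simp
  then show ?thesis
    using assms(2) by (auto simp: differentiable_def)
qed

lemma Ck_on_SucD:
  assumes "Ck_on (Suc k) f S" "x \<in> S"
  shows "(f has_derivative frechet_derivative f (at x)) (at x)"
  using assms frechet_derivative_works by auto

lemma Ck_on_const: "Ck_on k (\<lambda>x. c) S"
proof (induction k arbitrary: c)
  case (Suc k)
  then show ?case by (auto simp: frechet_derivative_const)
qed simp

lemma Ck_on_bounded_linear:
  assumes "bounded_linear L"
  shows "Ck_on k L S"
proof (cases k)
  case 0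
  then show ?thesis using assms by (simp add: linear_continuous_on)
next
  case (Suc m)
  have L: "(L has_derivative L) (at x)" for x
    using assms by (rule bounded_linear_imp_has_derivative)
  then have "frechet_derivative L (at x) = L" for x
    by (metis frechet_derivative_at)
  with L show ?thesis
    by (auto simp: Suc differentiable_def Ck_on_const)
qed

lemma Ck_on_add:
  assumes "open S" "Ck_on k f S" "Ck_on k g S"
  shows "Ck_on k (\<lambda>x. f x + g x) S"
  using assms(2,3)
proof (induction k arbitrary: f g)
  case 0
  then show ?case by (auto intro: continuous_intros)
next
  case (Suc k)
  show ?case
  proof (rule Ck_on_SucI[OF assms(1)])
    fix x assume "x \<in> S"
    then show "((\<lambda>x. f x + g x) has_derivative
        (\<lambda>v. frechet_derivative f (at x) v + frechet_derivative g (at x) v)) (at x)"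
      using Suc.prems by (intro has_derivative_add Ck_on_SucD)
  qed (use Suc in auto)
qed

lemma Ck_on_bilinear:
  assumes "open S" "bounded_bilinear B" "Ck_on k f S" "Ck_on k g S"
  shows "Ck_on k (\<lambda>x. B (f x) (g x)) S"
  using assms(3,4)
proof (induction k arbitrary: f g)
  case 0
  then show ?case using bounded_bilinear.continuous_on[OF assms(2)] by auto
next
  case (Suc k)
  show ?case
  proof (rule Ck_on_SucI[OF assms(1)])
    fix x assume "x \<in> S"
    then show "((\<lambda>x. B (f x) (g x)) has_derivative
        (\<lambda>v. B (f x) (frechet_derivative g (at x) v) + B (frechet_derivative f (at x) v) (g x))) (at x)"
      using Suc.prems by (intro bounded_bilinear.FDERIV[OF assms(2)] Ck_on_SucD)
  next
    fix v
    show "Ck_on k (\<lambda>x. B (f x) (frechet_derivative g (at x) v) + B (frechet_derivative f (at x) v) (g x)) S"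
      using Suc.prems by (intro Ck_on_add[OF assms(1)] Suc.IH Ck_on_Suc_D[OF Suc.prems(1)]
          Ck_on_Suc_D[OF Suc.prems(2)]) auto
  qed
qed

lemma Ck_on_sum:
  assumes "open S" "\<And>i. i \<in> I \<Longrightarrow> Ck_on k (f i) S"
  shows "Ck_on k (\<lambda>x. \<Sum>i\<in>I. f i x) S"
  using assms(2) by (induction I rule: infinite_finite_induct) (auto intro: Ck_on_add assms Ck_on_const)

text \<open>
  The chain rule expresses a directional derivative of the composite through the coordinates of
  \<open>Dg(x) v\<close> and the partial derivatives of \<open>f\<close>; both are covered by the induction hypothesis or by the
  product rule.
\<close>

lemma Ck_on_compose:
  fixes f :: "'b::euclidean_space \<Rightarrow> 'c::euclidean_space" and g :: "'a::euclidean_space \<Rightarrow> 'b"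
  assumes "open S" "open T" "Ck_on k f T" "Ck_on k g S" "g ` S \<subseteq> T"
  shows "Ck_on k (\<lambda>x. f (g x)) S"
  using assms(3,4)
proof (induction k arbitrary: f)
  case 0
  then show ?case
    using assms(5) continuous_on_compose2[of T f S g] by auto
next
  case (Suc k)
  have f: "(f has_derivative frechet_derivative f (at y)) (at y)" if "y \<in> T" for y
    using Ck_on_SucD[OF Suc.prems(1) that] .
  show ?case
  proof (rule Ck_on_SucI[OF assms(1)])
    fix x assume x: "x \<in> S"
    then have gx: "g x \<in> T" using assms(5) by auto
    show "((\<lambda>x. f (g x)) has_derivative
        (\<lambda>v. frechet_derivative f (at (g x)) (frechet_derivative g (at x) v))) (at x)"
      using has_derivative_compose[OF Ck_on_SucD[OF Suc.prems(2) x] f[OF gx]] .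
  next
    fix v
    have "Ck_on k (\<lambda>x. \<Sum>e\<in>Basis. (frechet_derivative g (at x) v \<bullet> e) *\<^sub>R
             frechet_derivative f (at (g x)) e) S"
    proof (intro Ck_on_sum assms(1) Ck_on_bilinear[OF assms(1) bounded_bilinear_scaleR])
      fix e :: 'b
      show "Ck_on k (\<lambda>x. frechet_derivative g (at x) v \<bullet> e) S"
        using Suc.prems(2) by (intro Ck_on_bilinear[OF assms(1) bounded_bilinear_inner] Ck_on_const) simp
      show "Ck_on k (\<lambda>x. frechet_derivative f (at (g x)) e) S"
        using Suc.prems by (intro Suc.IH Ck_on_Suc_D[OF Suc.prems(2)]) auto
    qed
    moreover have "frechet_derivative f (at (g x)) (frechet_derivative g (at x) v)
        = (\<Sum>e\<in>Basis. (frechet_derivative g (at x) v \<bullet> e) *\<^sub>R frechet_derivative f (at (g x)) e)" if "x \<in> S" for x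
    proof -
      have "linear (frechet_derivative f (at (g x)))"
        using f assms(5) that has_derivative_linear by blast
      from linear_sum[OF this, of "\<lambda>e. (frechet_derivative g (at x) v \<bullet> e) *\<^sub>R e" Basis]
        linear_scale[OF this] show ?thesis
        by (simp add: euclidean_representation)
    qed
    ultimately show "Ck_on k (\<lambda>x. frechet_derivative f (at (g x)) (frechet_derivative g (at x) v)) S"
      by (rule Ck_on_transform[OF assms(1)])
  qed
qed

lemma smooth_on_SucD:
  assumes "smooth_on f S"
  shows "smooth_on (\<lambda>x. frechet_derivative f (at x) v) S"
  using assms unfolding smooth_on_def by (metis Ck_on.simps(2))

lemma smooth_on_has_derivative:
  assumes "smooth_on f S" "x \<in> S"
  shows "(f has_derivative frechet_derivative f (at x)) (at x)"
  using assms Ck_on_SucD unfolding smooth_on_def by blast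

lemma smooth_on_const: "smooth_on (\<lambda>x. c) S"
  and smooth_on_bounded_linear: "bounded_linear L \<Longrightarrow> smooth_on L S"
  and smooth_on_subset: "smooth_on f S \<Longrightarrow> T \<subseteq> S \<Longrightarrow> smooth_on f T"
  by (auto simp: smooth_on_def Ck_on_const Ck_on_bounded_linear intro: Ck_on_subset)

lemma smooth_on_cong:
  "open S \<Longrightarrow> (\<And>x. x \<in> S \<Longrightarrow> f x = g x) \<Longrightarrow> smooth_on f S \<longleftrightarrow> smooth_on g S"
  using Ck_on_cong unfolding smooth_on_def by blast

lemma smooth_on_add: "open S \<Longrightarrow> smooth_on f S \<Longrightarrow> smooth_on g S \<Longrightarrow> smooth_on (\<lambda>x. f x + g x) S"
  by (auto simp: smooth_on_def intro: Ck_on_add)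

lemma smooth_on_bilinear:
  assumes "open S" "bounded_bilinear B" "smooth_on f S" "smooth_on g S"
  shows "smooth_on (\<lambda>x. B (f x) (g x)) S"
  using assms by (auto simp: smooth_on_def intro: Ck_on_bilinear)

lemma smooth_on_compose: "open S \<Longrightarrow> open T \<Longrightarrow> smooth_on h T \<Longrightarrow> smooth_on p S \<Longrightarrow> p ` S \<subseteq> T
    \<Longrightarrow> smooth_on (\<lambda>x. h (p x)) S"
  by (auto simp: smooth_on_def intro: Ck_on_compose)

lemma smooth_on_sum:
  "open S \<Longrightarrow> (\<And>i. i \<in> I \<Longrightarrow> smooth_on (f i) S) \<Longrightarrow> smooth_on (\<lambda>x. \<Sum>i\<in>I. f i x) S"
  by (auto simp: smooth_on_def intro: Ck_on_sum)

lemma smooth_on_linear_compose: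
  assumes "open S" "bounded_linear L" "smooth_on f S"
  shows "smooth_on (\<lambda>x. L (f x)) S"
  using smooth_on_compose[OF assms(1) open_UNIV smooth_on_bounded_linear[OF assms(2)] assms(3)] by simp

lemma smooth_on_diff:
  assumes "open S" "smooth_on f S" "smooth_on g S"
  shows "smooth_on (\<lambda>x. f x - g x) S"
  using smooth_on_add[OF assms(1,2) smooth_on_linear_compose[OF assms(1) _ assms(3), of uminus]]
  by (simp add: bounded_linear_minus[OF bounded_linear_ident])

lemma smooth_on_Pair:
  assumes "open S" "smooth_on f S" "smooth_on g S"
  shows "smooth_on (\<lambda>x. (f x, g x)) S"
proof -
  have "bounded_linear (\<lambda>x::'b. (x, 0::'c))" "bounded_linear (\<lambda>y::'c. (0::'b, y))"
    by (auto intro: bounded_linear_Pair bounded_linear_ident bounded_linear_zero)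
  from smooth_on_add[OF assms(1) smooth_on_linear_compose[OF assms(1) this(1) assms(2)]
      smooth_on_linear_compose[OF assms(1) this(2) assms(3)]]
  show ?thesis by simp
qed

lemma bounded_linear_axis:
  "bounded_linear (axis i :: 'b::euclidean_space \<Rightarrow> 'b ^ 'n::finite)"
proof -
  have "linear (axis i :: 'b \<Rightarrow> 'b ^ 'n)"
    by (rule linearI) (auto simp: axis_def vec_eq_iff)
  then show ?thesis by (simp add: linear_conv_bounded_linear)
qed

lemma sum_axis_components: "(\<Sum>i\<in>UNIV. axis i (v $ i)) = v" for v :: "'b::euclidean_space ^ 'n::finite"
  by (simp add: vec_eq_iff axis_def if_distrib[of "\<lambda>v. v $ _"] cong: if_cong)

lemma smooth_on_componentwise:
  fixes f :: "'a::euclidean_space \<Rightarrow> 'b::euclidean_space ^ 'n::finite"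
  assumes "open S" "\<And>i. smooth_on (\<lambda>x. f x $ i) S"
  shows "smooth_on f S"
proof -
  have "smooth_on (\<lambda>x. \<Sum>i\<in>UNIV. axis i (f x $ i)) S"
    by (intro smooth_on_sum assms(1) smooth_on_linear_compose[OF assms(1) bounded_linear_axis assms(2)])
  then show ?thesis by (simp only: sum_axis_components)
qed


text \<open>
  Differentiating \<open>T S = I\<close> gives \<open>S' = - S T' S\<close>. Continuity of \<open>S\<close> is part of the claim: near \<open>x\<close> the operator
  \<open>T\<close> stays bounded below, so \<open>S\<close> is bounded there, and the error
  \<open>S y - S x + S x (T y - T x) S x = S y (T y - T x) S x (T y - T x) S x\<close> is quadratic in \<open>T y - T x\<close>.
\<close>

lemma inverse_operator_has_derivative:
  fixes T :: "'a::euclidean_space \<Rightarrow> 'b::euclidean_space \<Rightarrow> 'b"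
  assumes U: "open U" and x: "x \<in> U"
    and T: "\<And>v. ((\<lambda>y. T y v) has_derivative T' v) (at x)" "\<And>y. y \<in> U \<Longrightarrow> linear (T y)"
    and S: "\<And>y. y \<in> U \<Longrightarrow> linear (S y)" "\<And>y v. y \<in> U \<Longrightarrow> S y (T y v) = v"
      "\<And>y v. y \<in> U \<Longrightarrow> T y (S y v) = v"
  shows "((\<lambda>y. S y v) has_derivative (\<lambda>u. - S x (\<Sum>e\<in>Basis. (S x v \<bullet> e) *\<^sub>R T' e u))) (at x)"
proof -
  define \<rho> where "\<rho> = (\<lambda>e y. T y e - T x e)"
  define \<eta> where "\<eta> = (\<lambda>y. \<Sum>e\<in>Basis. norm (\<rho> e y))"
  \<comment> \<open>A differentiable substitute for \<open>\<eta>\<^sup>2\<close>: it vanishes to second order at \<open>x\<close> and dominates the error \<open>E\<close> below.\<close>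
  define N where "N = (\<lambda>y. \<Sum>e\<in>Basis. \<rho> e y \<bullet> \<rho> e y)"
  define r where "r = (\<lambda>y. \<Sum>e\<in>Basis. (S x v \<bullet> e) *\<^sub>R \<rho> e y)"
  have \<rho>d: "(\<rho> e has_derivative T' e) (at x)" for e
    unfolding \<rho>_def by (rule derivative_eq_intros T(1) refl | simp)+
  have \<rho>x: "\<rho> e x = 0" for e by (simp add: \<rho>_def)
  have diff: "T y u - T x u = (\<Sum>e\<in>Basis. (u \<bullet> e) *\<^sub>R \<rho> e y)" if "y \<in> U" for y u
  proof -
    have *: "T z u = (\<Sum>e\<in>Basis. (u \<bullet> e) *\<^sub>R T z e)" if "z \<in> U" for z
      using linear_sum[OF T(2)[OF that], of "\<lambda>e. (u \<bullet> e) *\<^sub>R e" Basis] linear_scale[OF T(2)[OF that]]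
      by (simp add: euclidean_representation)
    show ?thesis
      unfolding *[OF that] *[OF x] by (simp add: \<rho>_def scaleR_diff_right sum_subtractf)
  qed
  have diff_le: "norm (T y u - T x u) \<le> \<eta> y * norm u" if "y \<in> U" for y u
    unfolding diff[OF that] \<eta>_def sum_distrib_right
    by (intro order.trans[OF norm_sum] sum_mono)
      (simp add: Basis_le_norm mult_right_mono mult.commute[of "norm (\<rho> _ _)"])
  have \<eta>0: "(\<eta> \<longlongrightarrow> 0) (at x)"
  proof -
    have "(\<rho> e \<longlongrightarrow> 0) (at x)" for e
      using has_derivative_continuous[OF \<rho>d] \<rho>x[of e] by (metis isContD)
    then have "(\<eta> \<longlongrightarrow> (\<Sum>e\<in>(Basis::'b set). norm (0::'b))) (at x)"
      unfolding \<eta>_def by (intro tendsto_sum tendsto_norm)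
    then show ?thesis by simp
  qed
  obtain M where M: "M > 0" "\<And>u. norm (S x u) \<le> M * norm u"
    using linear_bounded_pos[OF S(1)[OF x]] by blast
  have "\<forall>\<^sub>F y in at x. \<eta> y < 1 / (2 * M)"
    using order_tendstoD(2)[OF \<eta>0] M(1) by simp
  moreover have "\<forall>\<^sub>F y in at x. y \<in> U"
    using U x by (rule eventually_at_in_open')
  ultimately have "\<forall>\<^sub>F y in at x. \<eta> y < 1 / (2 * M) \<and> y \<in> U" by eventually_elim simp
  then obtain d where d: "d > 0" "\<And>y. y \<noteq> x \<Longrightarrow> dist y x < d \<Longrightarrow> \<eta> y < 1 / (2 * M) \<and> y \<in> U"
    unfolding eventually_at by auto
  have Sb: "norm (S y u) \<le> 2 * M * norm u" if "y \<in> U" "\<eta> y < 1 / (2 * M)" for y u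
  proof -
    let ?w = "S y u"
    have "norm ?w = norm (S x (T x ?w))" using S(2)[OF x] by simp
    also have "\<dots> \<le> M * norm (T x ?w)" by (rule M)
    also have "norm (T x ?w) \<le> norm (T y ?w) + norm (T y ?w - T x ?w)"
      by (metis add.commute norm_minus_commute norm_triangle_sub)
    also have "\<dots> \<le> norm u + \<eta> y * norm ?w"
      using diff_le[OF that(1), of ?w] S(3)[OF that(1)] by simp
    finally have 1: "norm ?w \<le> M * norm u + (M * \<eta> y) * norm ?w"
      using M(1) by (simp add: algebra_simps)
    have "M * \<eta> y \<le> 1/2" using that(2) M(1) by (simp add: field_simps)
    then have "(M * \<eta> y) * norm ?w \<le> 1/2 * norm ?w" by (rule mult_right_mono) simp
    then show ?thesis using 1 by simp
  qed
  have rdiff: "r y = T y (S x v) - T x (S x v)" if "y \<in> U" for y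
    using diff[OF that] by (simp add: r_def)
  have rd: "(r has_derivative (\<lambda>u. \<Sum>e\<in>Basis. (S x v \<bullet> e) *\<^sub>R T' e u)) (at x)"
    unfolding r_def by (intro has_derivative_sum has_derivative_scaleR_right \<rho>d)
  have Sxd: "((\<lambda>y. S x v - S x (r y)) has_derivative
      (\<lambda>u. 0 - S x (\<Sum>e\<in>Basis. (S x v \<bullet> e) *\<^sub>R T' e u))) (at x)"
    using S(1)[OF x]
    by (intro has_derivative_diff has_derivative_const bounded_linear.has_derivative[OF _ rd])
      (simp add: linear_conv_bounded_linear)
  define E where "E = (\<lambda>y. S y v - (S x v - S x (r y)))"
  have Nd: "(N has_derivative (\<lambda>u. 0)) (at x)"
  proof -
    have "(N has_derivative (\<lambda>u. \<Sum>e\<in>Basis. \<rho> e x \<bullet> T' e u + T' e u \<bullet> \<rho> e x)) (at x)"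
      unfolding N_def by (intro has_derivative_sum has_derivative_inner \<rho>d)
    then show ?thesis by (simp add: \<rho>x)
  qed
  have Nx: "N x = 0" by (simp add: N_def \<rho>x)
  define C where "C = 2 * M * M * norm (S x v) * real DIM('b)"
  have El: "norm (E y) \<le> C * N y" if "y \<in> U" "\<eta> y < 1 / (2 * M)" for y
  proof -
    let ?z = "S x (r y)"
    have "T y (E y) = T y (S y v) - T y (S x v) + T y ?z"
      unfolding E_def using linear_diff[OF T(2)[OF that(1)]] linear_add[OF T(2)[OF that(1)]]
      by (simp add: algebra_simps)
    also have "\<dots> = v - T y (S x v) + T y ?z" using S(3)[OF that(1)] by simp
    also have "T y (S x v) = r y + v" using rdiff[OF that(1)] S(3)[OF x] by simp
    finally have "T y (E y) = T y ?z - r y" by simp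
    moreover have "r y = T x ?z" using S(3)[OF x] by simp
    ultimately have "T y (E y) = T y ?z - T x ?z" by simp
    then have "E y = S y (T y ?z - T x ?z)" using S(2)[OF that(1)] by metis
    then have "norm (E y) \<le> 2 * M * norm (T y ?z - T x ?z)" using Sb[OF that] by simp
    also have "\<dots> \<le> 2 * M * (\<eta> y * norm ?z)"
      using diff_le[OF that(1)] M(1) by (intro mult_left_mono) auto
    also have "\<dots> \<le> 2 * M * (\<eta> y * (M * (\<eta> y * norm (S x v))))"
    proof -
      have "0 \<le> \<eta> y" by (simp add: \<eta>_def sum_nonneg)
      moreover have "norm ?z \<le> M * (\<eta> y * norm (S x v))"
        using order.trans[OF M(2)[of "r y"]]
          mult_left_mono[OF diff_le[OF that(1), of "S x v", folded rdiff[OF that(1)]], of M] M(1)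
        by simp
      ultimately show ?thesis using M(1) by (intro mult_left_mono) auto
    qed
    also have "\<dots> = 2 * M * M * norm (S x v) * (\<eta> y)\<^sup>2" by (simp add: power2_eq_square)
    also have "\<dots> \<le> 2 * M * M * norm (S x v) * (real DIM('b) * N y)"
    proof -
      have "(\<eta> y)\<^sup>2 \<le> real DIM('b) * (\<Sum>e\<in>Basis. (norm (\<rho> e y))\<^sup>2)"
        unfolding \<eta>_def using sum_squared_le_sum_of_squares[of "\<lambda>e. norm (\<rho> e y)" Basis]
        by (simp add: mult.commute)
      then show ?thesis
        using M(1) by (intro mult_left_mono) (auto simp: N_def power2_norm_eq_inner)
    qed
    finally show ?thesis by (simp add: C_def mult.assoc)
  qed
  have "(E has_derivative (\<lambda>u. 0)) (at x)"
  proof (rule has_derivativeI_sandwich[OF d(1)])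
    show "norm (E y - E x - 0) / norm (y - x) \<le> C * (norm (N y - N x - 0) / norm (y - x))"
      if "y \<in> UNIV" "y \<noteq> x" "dist y x < d" for y
    proof -
      have "E x = 0" using linear_0[OF S(1)[OF x]] by (simp add: E_def r_def \<rho>x)
      moreover have "0 \<le> N y" by (simp add: N_def sum_nonneg)
      ultimately show ?thesis
        using El[of y] d(2)[OF that(2,3)] Nx by (simp add: divide_right_mono)
    qed
    have "((\<lambda>y. norm (N y - N x - 0) / norm (y - x)) \<longlongrightarrow> 0) (at x)"
      using Nd by (simp add: has_derivative_iff_norm)
    then show "((\<lambda>y. C * (norm (N y - N x - 0) / norm (y - x))) \<longlongrightarrow> 0) (at x)"
      by (rule tendsto_mult_right_zero)
  qed simp
  from has_derivative_add[OF Sxd this] show ?thesis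
    by (simp add: E_def)
qed

text \<open>
  The derivative formula is polynomial in the entries of \<open>S\<close> and in derivatives of \<open>T\<close>, so each order of
  differentiability of \<open>S\<close> yields the next.
\<close>

lemma Ck_on_inverse_operator:
  fixes T :: "'a::euclidean_space \<Rightarrow> 'b::euclidean_space \<Rightarrow> 'b"
  assumes U: "open U" and T: "\<And>v. smooth_on (\<lambda>x. T x v) U" "\<And>x. x \<in> U \<Longrightarrow> linear (T x)"
    and S: "\<And>x. x \<in> U \<Longrightarrow> linear (S x)" "\<And>x v. x \<in> U \<Longrightarrow> S x (T x v) = v"
      "\<And>x v. x \<in> U \<Longrightarrow> T x (S x v) = v"
    and Sd: "\<And>x v. x \<in> U \<Longrightarrow> ((\<lambda>x. S x v) has_derivative
         (\<lambda>u. - S x (\<Sum>e\<in>Basis. (S x v \<bullet> e) *\<^sub>R frechet_derivative (\<lambda>x. T x e) (at x) u))) (at x)"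
  shows "Ck_on k (\<lambda>x. S x v) U"
proof (induction k arbitrary: v)
  case 0
  have "isCont (\<lambda>x. S x v) x" if "x \<in> U" for x
    using Sd[OF that] has_derivative_continuous by blast
  then show ?case by (simp add: continuous_at_imp_continuous_on)
next
  case (Suc k)
  show ?case
  proof (rule Ck_on_SucI[OF U Sd])
    fix u
    let ?w = "\<lambda>x. \<Sum>e\<in>Basis. (S x v \<bullet> e) *\<^sub>R frechet_derivative (\<lambda>x. T x e) (at x) u"
    have w: "Ck_on k ?w U"
      using smooth_on_SucD[OF T(1)]
      by (intro Ck_on_sum U Ck_on_bilinear[OF U bounded_bilinear_scaleR]
            Ck_on_bilinear[OF U bounded_bilinear_inner] Suc.IH Ck_on_const) (auto simp: smooth_on_def)
    have "Ck_on k (\<lambda>x. \<Sum>e\<in>Basis. (- (?w x \<bullet> e)) *\<^sub>R S x e) U"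
      using smooth_on_linear_compose[OF U]
      by (intro Ck_on_sum U Ck_on_bilinear[OF U bounded_bilinear_scaleR] Suc.IH
           Ck_on_compose[OF U open_UNIV Ck_on_bounded_linear[of "\<lambda>x. - (x \<bullet> e)" for e] w])
        (auto intro!: bounded_linear_minus bounded_linear_inner_left)
    moreover have "- S x (?w x) = (\<Sum>e\<in>Basis. (- (?w x \<bullet> e)) *\<^sub>R S x e)" if "x \<in> U" for x
    proof -
      have "S x (?w x) = S x (\<Sum>e\<in>Basis. (?w x \<bullet> e) *\<^sub>R e)"
        by (simp add: euclidean_representation)
      also have "\<dots> = (\<Sum>e\<in>Basis. (?w x \<bullet> e) *\<^sub>R S x e)"
        using S(1)[OF that] by (simp add: linear_sum linear_scale)
      finally show ?thesis by (simp add: sum_negf)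
    qed
    ultimately show "Ck_on k (\<lambda>x. - S x (?w x)) U"
      by (rule Ck_on_transform[OF U])
  qed
qed

text \<open>
  The derivative of the inverse is \<open>g'(y) = S(g y)\<close>, where \<open>S(x)\<close> is the inverse operator of \<open>f'(x)\<close> and is
  smooth in \<open>x\<close>; hence \<open>g\<close> of class \<open>C^k\<close> implies \<open>g\<close> of class \<open>C^(k+1)\<close>.
\<close>

lemma local_inverse_smooth:
  fixes f :: "'a::euclidean_space \<Rightarrow> 'a"
  assumes U: "open U" and V: "open V" and f: "smooth_on f U"
    and hom: "homeomorphism U V f g"
    and g: "\<And>y. y \<in> V \<Longrightarrow> (g has_derivative g' y) (at y)"
    and g': "\<And>y v. y \<in> V \<Longrightarrow> g' y (frechet_derivative f (at (g y)) v) = v"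
      "\<And>y v. y \<in> V \<Longrightarrow> frechet_derivative f (at (g y)) (g' y v) = v"
  shows "smooth_on g V"
proof -
  define T where "T = (\<lambda>x v. frechet_derivative f (at x) v)"
  define S where "S = (\<lambda>x. g' (f x))"
  have fx: "f x \<in> V" "g (f x) = x" if "x \<in> U" for x
    using that hom by (auto simp: homeomorphism_def)
  have gy: "g y \<in> U" "f (g y) = y" if "y \<in> V" for y
    using that hom by (auto simp: homeomorphism_def)
  have Tsm: "smooth_on (\<lambda>x. T x v) U" for v
    unfolding T_def using f by (rule smooth_on_SucD)
  have Tl: "linear (T x)" if "x \<in> U" for x
    using smooth_on_has_derivative[OF f that] has_derivative_linear by (auto simp: T_def)
  have Sl: "linear (S x)" if "x \<in> U" for x
    using g[OF fx(1)[OF that]] has_derivative_linear by (auto simp: S_def)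
  have ST: "S x (T x v) = v" "T x (S x v) = v" if "x \<in> U" for x v
    using g'(1,2)[OF fx(1)[OF that]] fx[OF that] by (auto simp: S_def T_def)
  have Sd: "((\<lambda>x. S x v) has_derivative
         (\<lambda>u. - S x (\<Sum>e\<in>Basis. (S x v \<bullet> e) *\<^sub>R frechet_derivative (\<lambda>x. T x e) (at x) u))) (at x)"
    if "x \<in> U" for x v
    by (rule inverse_operator_has_derivative[OF U that smooth_on_has_derivative[OF Tsm that] Tl Sl ST])
  have S: "Ck_on k (\<lambda>x. S x v) U" for k v
    by (rule Ck_on_inverse_operator[OF U Tsm Tl Sl ST Sd])
  have "Ck_on k g V" for k
  proof (induction k)
    case 0
    then show ?case using hom by (simp add: homeomorphism_def)
  next
    case (Suc k)
    have "Ck_on k (\<lambda>y. S (g y) v) V" for v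
      using Ck_on_compose[OF V U S Suc.IH] gy by auto
    then have "Ck_on k (\<lambda>y. g' y v) V" for v
      using Ck_on_cong[OF V, of "\<lambda>y. S (g y) v" "\<lambda>y. g' y v" k] gy by (simp add: S_def)
    then show ?case using Ck_on_SucI[OF V g] by blast
  qed
  then show ?thesis by (simp add: smooth_on_def)
qed

lemma smooth_on_continuous: "smooth_on f S \<Longrightarrow> continuous_on S f"
  unfolding smooth_on_def by (metis Ck_on.simps(1))

text \<open>
  Composing with the inverse of the derivative at the given point reduces to a map of the space into itself
  with derivative the identity, to which the \<open>C^1\<close> inverse function theorem applies.
\<close>

theorem smooth_inverse_function_theorem:
  fixes f :: "'a::euclidean_space \<Rightarrow> 'b::euclidean_space"
  assumes U: "open U" "x \<in> U" and f: "smooth_on f U"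
    and inj: "\<And>v. frechet_derivative f (at x) v = 0 \<Longrightarrow> v = 0"
    and dim: "DIM('a) = DIM('b)"
  shows "local_diffeomorphism_at f x"
proof -
  define D where "D = frechet_derivative f (at x)"
  have D: "linear D"
    using smooth_on_has_derivative[OF f U(2)] has_derivative_linear unfolding D_def by blast
  have "inj D"
    using inj D unfolding D_def by (simp add: linear_injective_0)
  have "dim (range D) = DIM('b)"
    using eucl.dim_image_eq[of D UNIV] D \<open>inj D\<close> dim by (simp add: inj_on_subset)
  then have "surj D"
    using D by (metis dim_eq_full span_eq_iff linear_subspace_image subspace_UNIV)
  obtain L where L: "linear L" "\<And>v. L (D v) = v"
    using linear_injective_left_inverse[OF D \<open>inj D\<close>] by (metis comp_apply id_apply)
  have L': "D (L w) = w" for w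
    using \<open>surj D\<close> L(2) by (metis surjD)
  have bL: "bounded_linear L" "bounded_linear D"
    using L(1) D by (simp_all add: linear_conv_bounded_linear)
  define F where "F = (\<lambda>y. L (f y))"
  have F: "smooth_on F U"
    unfolding F_def by (rule smooth_on_linear_compose[OF U(1) bL(1) f])
  define F' where "F' = (\<lambda>y. Blinfun (frechet_derivative F (at y)))"
  have F'_apply: "blinfun_apply (F' y) = frechet_derivative F (at y)" if "y \<in> U" for y
    using has_derivative_bounded_linear[OF smooth_on_has_derivative[OF F that]]
    by (simp add: F'_def bounded_linear_Blinfun_apply)
  have Fd: "(F has_derivative blinfun_apply (F' y)) (at y)" if "y \<in> U" for y
    using smooth_on_has_derivative[OF F that] F'_apply[OF that] by simp
  have contF': "continuous_on U F'"
  proof (rule continuous_on_blinfun_componentwise)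
    fix i :: 'a
    have "continuous_on U (\<lambda>y. frechet_derivative F (at y) i)"
      by (intro smooth_on_continuous smooth_on_SucD F)
    then show "continuous_on U (\<lambda>y. blinfun_apply (F' y) i)"
      using F'_apply by (simp cong: continuous_on_cong)
  qed
  have "(F has_derivative (\<lambda>v. L (D v))) (at x)"
    unfolding F_def D_def
    by (rule bounded_linear.has_derivative[OF bL(1) smooth_on_has_derivative[OF f U(2)]])
  then have "frechet_derivative F (at x) = (\<lambda>v. v)"
    using L(2) frechet_derivative_at by fastforce
  then have inv: "id_blinfun o\<^sub>L F' x = id_blinfun"
    by (intro blinfun_eqI) (simp add: F'_apply[OF U(2)])
  obtain U' V g g' where *: "open U'" "U' \<subseteq> U" "x \<in> U'" "open V" "F x \<in> V" "homeomorphism U' V F g"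
    "\<And>y. y \<in> V \<Longrightarrow> (g has_derivative (g' y)) (at y)"
    "\<And>y. y \<in> V \<Longrightarrow> g' y = inv (blinfun_apply (F' (g y)))"
    "\<And>y. y \<in> V \<Longrightarrow> bij (blinfun_apply (F' (g y)))"
    by (rule inverse_function_theorem[OF U(1) Fd contF' U(2) inv]) (assumption, (rule that; assumption))
  have FU': "F y \<in> V" "g (F y) = y" if "y \<in> U'" for y
    using *(6) that by (auto simp: homeomorphism_def)
  have gV: "g y \<in> U'" "F (g y) = y" if "y \<in> V" for y
    using *(6) that by (auto simp: homeomorphism_def)
  have "smooth_on g V"
  proof (rule local_inverse_smooth[OF *(1,4) smooth_on_subset[OF F *(2)] *(6,7)])
    fix y v assume y: "y \<in> V"
    then have e: "blinfun_apply (F' (g y)) = frechet_derivative F (at (g y))"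
      using gV *(2) by (intro F'_apply) auto
    show "g' y (frechet_derivative F (at (g y)) v) = v" "frechet_derivative F (at (g y)) (g' y v) = v"
      using *(8,9)[OF y] e by (simp_all add: inv_f_f bij_is_inj surj_f_inv_f bij_is_surj)
  qed simp_all
  have fF: "f y = D (F y)" for y by (simp add: F_def L')
  have im: "f ` U' = L -` V"
  proof -
    have "f y \<in> L -` V" if "y \<in> U'" for y using FU'[OF that] by (simp add: F_def)
    moreover have "z \<in> f ` U'" if "L z \<in> V" for z
      using gV[OF that] fF L' by (metis imageI)
    ultimately show ?thesis by auto
  qed
  have op: "open (f ` U')"
    unfolding im using bL(1) *(4) by (intro open_vimage) (auto intro: linear_continuous_on)
  have injf: "inj_on f U'"
    using FU'(2) unfolding inj_on_def F_def by metis
  have "smooth_on (\<lambda>z. g (L z)) (f ` U')"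
    using smooth_on_compose[OF op *(4) \<open>smooth_on g V\<close> smooth_on_bounded_linear[OF bL(1)]] im by auto
  moreover have "inv_into U' f z = g (L z)" if "z \<in> f ` U'" for z
    using that injf FU'(2) by (auto simp: F_def)
  ultimately have "smooth_on (inv_into U' f) (f ` U')"
    using smooth_on_cong[OF op, of "inv_into U' f" "\<lambda>z. g (L z)"] by simp
  with *(1,3) op injf smooth_on_subset[OF f *(2)] show ?thesis
    unfolding local_diffeomorphism_at_def by auto
qed


section \<open>Complex matrices\<close>

lemma matrix_mult_component: "(A ** B) $ i $ j = (\<Sum>k\<in>UNIV. A $ i $ k * B $ k $ j)"
  by (simp add: matrix_matrix_mult_def)

lemma matrix_vector_component: "(A *v x) $ i = (\<Sum>k\<in>UNIV. A $ i $ k * x $ k)"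
  by (simp add: matrix_vector_mult_def)

lemma matrix_add_rdist: "(B + C) ** A = B ** A + C ** A"
  for A :: "complex^'n^'n" and B C :: "complex^'n^'n"
  by (simp add: vec_eq_iff matrix_mult_component sum.distrib algebra_simps)

lemma matrix_diff_ldist: "A ** (B - C) = A ** B - A ** C"
  for A :: "complex^'n^'n" and B C :: "complex^'n^'n"
  by (simp add: vec_eq_iff matrix_mult_component sum_subtractf algebra_simps)

lemma matrix_diff_rdist: "(B - C) ** A = B ** A - C ** A"
  for A :: "complex^'n^'n" and B C :: "complex^'n^'n"
  by (simp add: vec_eq_iff matrix_mult_component sum_subtractf algebra_simps)

lemma matrix_mult_uminus: "A ** (- B) = - (A ** B)" "(- A) ** B = - (A ** B)"
  for A :: "complex^'n^'n" and B :: "complex^'n^'n"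
  by (simp_all add: vec_eq_iff matrix_mult_component sum_negf)

lemma matrix_mult_zero: "A ** 0 = 0" "0 ** A = 0"
  for A :: "complex^'n^'n"
  by (simp_all add: vec_eq_iff matrix_mult_component)

lemmas matrix_ring = matrix_add_rdist matrix_add_ldistrib matrix_diff_ldist matrix_diff_rdist
  matrix_mult_uminus matrix_mult_zero matrix_mul_lid matrix_mul_rid matrix_mul_assoc

lemma conj_transpose_component: "conj_transpose A $ i $ j = cnj (A $ j $ i)"
  by (simp add: conj_transpose_def)

lemma conj_transpose_mult: "conj_transpose (A ** B) = conj_transpose B ** conj_transpose A"
  by (simp add: vec_eq_iff conj_transpose_component matrix_mult_component mult.commute)

lemma cnj_scaleR: "cnj (r *\<^sub>R z) = r *\<^sub>R cnj z"
  by (simp add: complex_eq_iff)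

lemma conj_transpose_simps [simp]:
  "conj_transpose (conj_transpose A) = A"
  "conj_transpose (A + B) = conj_transpose A + conj_transpose B"
  "conj_transpose (A - B) = conj_transpose A - conj_transpose B"
  "conj_transpose (- A) = - conj_transpose A"
  "conj_transpose (r *\<^sub>R A) = r *\<^sub>R conj_transpose A"
  "conj_transpose 0 = 0"
  by (simp_all add: vec_eq_iff conj_transpose_component cnj_scaleR)

lemma conj_transpose_one [simp]: "conj_transpose (mat 1) = mat 1"
  by (auto simp add: vec_eq_iff conj_transpose_component mat_def)

lemma cinner_adjoint: "cinner x (A *v y) = cinner (conj_transpose A *v x) y"
proof -
  have "cinner x (A *v y) = (\<Sum>i\<in>UNIV. \<Sum>k\<in>UNIV. cnj (x $ i) * A $ i $ k * y $ k)"
    by (simp add: cinner_def matrix_vector_component sum_distrib_left mult.assoc)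
  also have "\<dots> = (\<Sum>k\<in>UNIV. \<Sum>i\<in>UNIV. cnj (x $ i) * A $ i $ k * y $ k)"
    by (rule sum.swap)
  also have "\<dots> = cinner (conj_transpose A *v x) y"
    by (simp add: cinner_def matrix_vector_component sum_distrib_right conj_transpose_component
        mult.commute mult.left_commute sum_distrib_left)
  finally show ?thesis .
qed

lemma cinner_commute: "cnj (cinner x y) = cinner y x"
  by (simp add: cinner_def mult.commute)

lemma cinner_add: "cinner x (y + z) = cinner x y + cinner x z" "cinner (x + y) z = cinner x z + cinner y z"
  and cinner_diff: "cinner x (y - z) = cinner x y - cinner x z" "cinner (x - y) z = cinner x z - cinner y z"
  and cinner_scale: "cinner x (c *s y) = c * cinner x y" "cinner (c *s x) y = cnj c * cinner x y"
  and cinner_scaleR: "cinner x (r *\<^sub>R y) = r *\<^sub>R cinner x y" "cinner (r *\<^sub>R x) y = r *\<^sub>R cinner x y"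
  by (simp_all add: cinner_def algebra_simps sum.distrib sum_subtractf sum_distrib_left cnj_scaleR scaleR_sum_right)

lemma bounded_bilinear_matrix_mult:
  "bounded_bilinear (\<lambda>A B :: complex^'n^'n. A ** B)"
proof -
  have "bilinear (\<lambda>A B :: complex^'n^'n. A ** B)"
    unfolding bilinear_def
    by (auto intro!: linearI simp: vec_eq_iff matrix_mult_component scaleR_sum_right
        algebra_simps sum.distrib)
  then show ?thesis by (simp add: bilinear_conv_bounded_bilinear)
qed

lemma bounded_bilinear_matrix_vector:
  "bounded_bilinear (\<lambda>(A :: complex^'n^'n) x. A *v x)"
proof -
  have "bilinear (\<lambda>(A :: complex^'n^'n) x. A *v x)"
    unfolding bilinear_def
    by (auto intro!: linearI simp: algebra_simps vec_eq_iff matrix_vector_component scaleR_sum_right sum.distrib)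
  then show ?thesis by (simp add: bilinear_conv_bounded_bilinear)
qed

lemma bounded_bilinear_cinner: "bounded_bilinear (\<lambda>x y :: complex^'n. cinner x y)"
proof -
  have "bilinear (\<lambda>x y :: complex^'n. cinner x y)"
    unfolding bilinear_def
    by (auto intro!: linearI simp: cinner_add cinner_scaleR)
  then show ?thesis by (simp add: bilinear_conv_bounded_bilinear)
qed

lemma bounded_linear_conj_transpose: "bounded_linear (conj_transpose :: complex^'n^'n \<Rightarrow> complex^'n^'n)"
proof -
  have "linear (conj_transpose :: complex^'n^'n \<Rightarrow> complex^'n^'n)"
    by (rule linearI) auto
  then show ?thesis by (simp add: linear_conv_bounded_linear)
qed

definition cnj_vec :: "complex^'d \<Rightarrow> complex^'d" where
  "cnj_vec a = (\<chi> j. cnj (a $ j))"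

lemma bounded_linear_cnj_vec: "bounded_linear (cnj_vec :: complex^'d \<Rightarrow> complex^'d)"
proof -
  have "linear (cnj_vec :: complex^'d \<Rightarrow> complex^'d)"
    by (rule linearI) (auto simp: cnj_vec_def vec_eq_iff cnj_scaleR)
  then show ?thesis by (simp add: linear_conv_bounded_linear)
qed

lemma pencil_add: "pencil A (a + c) = pencil A a + pencil A c"
  and pencil_diff: "pencil A (a - c) = pencil A a - pencil A c"
  and pencil_zero [simp]: "pencil A 0 = 0"
  by (simp_all add: pencil_def vec_eq_iff algebra_simps sum.distrib sum_subtractf)

lemma pencil_scale: "pencil A (z *s c) $ i $ k = z * pencil A c $ i $ k"
  by (simp add: pencil_def sum_distrib_left mult.assoc)

lemma bounded_linear_pencil:
  "bounded_linear (pencil A)" for A :: "'d::finite \<Rightarrow> complex^'n^'n"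
proof -
  have "linear (pencil A)"
    by (rule linearI) (auto simp: pencil_add, simp add: pencil_def vec_eq_iff scaleR_sum_right)
  then show ?thesis by (simp add: linear_conv_bounded_linear)
qed

lemma conj_transpose_pencil:
  assumes "\<And>j. hermitian (A j)"
  shows "conj_transpose (pencil A a) = pencil A (cnj_vec a)"
proof -
  have "cnj (A j $ k $ i) = A j $ i $ k" for i j k
    using assms[of j] by (simp add: hermitian_def conj_transpose_def vec_eq_iff)
  then show ?thesis
    by (simp add: vec_eq_iff conj_transpose_component pencil_def cnj_vec_def)
qed

lemma shifted_pencil_eq:
  "shifted_pencil A b a = pencil A (cvec b) - pencil A a - pencil A (cnj_vec a)"
proof -
  have "(\<chi> j. complex_of_real (b $ j) - a $ j - cnj (a $ j)) = cvec b - a - cnj_vec a"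
    by (simp add: vec_eq_iff cvec_def cnj_vec_def)
  then show ?thesis by (simp add: shifted_pencil_def pencil_diff)
qed

lemma matrix_component_le_onorm_complex: "norm (X $ i $ j) \<le> onorm ((*v) X)"
  for X :: "complex^'n^'n"
proof -
  have "norm (X $ i $ j) = norm ((X *v axis j 1) $ i)"
    by (simp add: matrix_vector_component axis_def if_distrib cong: if_cong)
  also have "\<dots> \<le> norm (X *v axis j 1)" by (rule Finite_Cartesian_Product.norm_nth_le)
  also have "\<dots> \<le> onorm ((*v) X) * norm (axis j 1 :: complex^'n)"
    by (rule onorm) simp
  finally show ?thesis by simp
qed

lemma onorm_matrix_mult: "onorm ((*v) (X ** Y)) \<le> onorm ((*v) X) * onorm ((*v) Y)"
  for X Y :: "complex^'n^'n"
  using onorm_compose[of "(*v) X" "(*v) Y"] by (simp add: comp_def matrix_vector_mul_assoc)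

lemma onorm_matrix_add: "onorm ((*v) (X + Y)) \<le> onorm ((*v) X) + onorm ((*v) Y)"
  for X Y :: "complex^'n^'n"
  using onorm_triangle[of "(*v) X" "(*v) Y"] by (simp add: matrix_vector_mult_add_rdistrib[abs_def])

lemma onorm_matrix_uminus: "onorm ((*v) (- X)) = onorm ((*v) X)"
  for X :: "complex^'n^'n"
proof -
  have "(*v) (- X) = (\<lambda>x. - (X *v x))"
    by (simp add: fun_eq_iff vec_eq_iff matrix_vector_component sum_negf)
  then show ?thesis using onorm_neg[of "(*v) X"] by simp
qed

lemma onorm_matrix_nonneg: "0 \<le> onorm ((*v) X)" for X :: "complex^'n^'n"
  by (rule onorm_pos_le) simp

lemma onorm_matrix_eq_0: "onorm ((*v) X) = 0 \<Longrightarrow> X = 0" for X :: "complex^'n^'n"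
  using matrix_component_le_onorm_complex[of X] by (simp add: vec_eq_iff)

lemma onorm_matrix_bounded:
  obtains C where "C > 0" "\<And>X :: complex^'n^'n. onorm ((*v) X) \<le> C * norm X"
proof -
  obtain C where C: "C > 0" "\<And>(X :: complex^'n^'n) x. norm (X *v x) \<le> norm X * norm x * C"
    using bounded_bilinear.pos_bounded[OF bounded_bilinear_matrix_vector] by blast
  have "onorm ((*v) X) \<le> C * norm X" for X :: "complex^'n^'n"
    using C(2)[of X] by (intro onorm_le) (simp add: mult_ac)
  with C(1) that show thesis by blast
qed

lemma norm_matrix_le_onorm:
  fixes X :: "complex^'n^'n"
  shows "norm X \<le> real CARD('n) * real CARD('n) * onorm ((*v) X)"
proof -
  have "norm X \<le> (\<Sum>i\<in>UNIV. norm (X $ i))"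
    by (simp add: norm_vec_def L2_set_le_sum)
  also have "\<dots> \<le> (\<Sum>i\<in>(UNIV::'n set). \<Sum>j\<in>(UNIV::'n set). onorm ((*v) X))"
  proof (rule sum_mono)
    fix i
    have "norm (X $ i) \<le> (\<Sum>j\<in>UNIV. norm (X $ i $ j))"
      by (simp add: norm_vec_def L2_set_le_sum)
    also have "\<dots> \<le> (\<Sum>j\<in>(UNIV::'n set). onorm ((*v) X))"
      by (rule sum_mono) (rule matrix_component_le_onorm_complex)
    finally show "norm (X $ i) \<le> \<dots>" .
  qed
  finally show ?thesis by simp
qed

lemma matpow_onorm: "onorm ((*v) (matpow X r)) \<le> onorm ((*v) X) ^ r" for X :: "complex^'n^'n"
proof (induction r)
  case 0
  then show ?case by (simp add: onorm_id_le)
next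
  case (Suc r)
  have "onorm ((*v) (matpow X (Suc r))) \<le> onorm ((*v) X) * onorm ((*v) (matpow X r))"
    by (simp add: onorm_matrix_mult)
  also have "\<dots> \<le> onorm ((*v) X) * onorm ((*v) X) ^ r"
    using Suc onorm_matrix_nonneg by (intro mult_left_mono)
  finally show ?case by simp
qed

lemma matpow_tendsto_0:
  fixes X :: "complex^'n^'n"
  assumes "onorm ((*v) X) < 1"
  shows "(\<lambda>r. matpow X r) \<longlonglongrightarrow> 0"
proof (rule Lim_null_comparison)
  show "\<forall>\<^sub>F r in sequentially. norm (matpow X r) \<le> real CARD('n) * real CARD('n) * onorm ((*v) X) ^ r"
    using norm_matrix_le_onorm[of "matpow X r" for r] matpow_onorm[of X]
    by (intro always_eventually allI order.trans[OF norm_matrix_le_onorm] mult_left_mono) auto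
  show "(\<lambda>r. real CARD('n) * real CARD('n) * onorm ((*v) X) ^ r) \<longlonglongrightarrow> 0"
    using assms onorm_matrix_nonneg[of X] by (intro tendsto_mult_right_zero LIMSEQ_power_zero) auto
qed

lemma matpow_Suc_right: "matpow X (Suc r) = matpow X r ** X" for X :: "complex^'n^'n"
proof (induction r)
  case (Suc r)
  have "matpow X (Suc (Suc r)) = X ** (matpow X r ** X)" using Suc by simp
  then show ?case by (simp add: matrix_mul_assoc)
qed simp

lemma conj_transpose_matpow: "conj_transpose (matpow X r) = matpow (conj_transpose X) r"
  for X :: "complex^'n^'n"
proof (induction r)
  case (Suc r)
  have "conj_transpose (matpow X (Suc r)) = conj_transpose X ** matpow (conj_transpose X) r"
    unfolding matpow_Suc_right conj_transpose_mult Suc ..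
  then show ?case by simp
qed simp

text \<open>
  Unrolling \<open>K = S + X\<^sup>* K X\<close> telescopes, and the remainder \<open>X\<^sup>*\<^sup>n K X\<^sup>n\<close> tends to zero. This identifies the
  series defining \<open>K_mat\<close> with a solution of a linear equation, which the inverse function theorem can
  handle.
\<close>

lemma stein_equation_sums:
  fixes X K S :: "complex^'n^'n"
  assumes "onorm ((*v) X) < 1" "K = S + conj_transpose X ** K ** X"
  shows "(\<lambda>r. matpow (conj_transpose X) r ** S ** matpow X r) sums K"
proof -
  let ?R = "\<lambda>r. matpow (conj_transpose X) r ** K ** matpow X r"
  have "(\<Sum>r<n. matpow (conj_transpose X) r ** S ** matpow X r) = K - ?R n" for n
  proof (induction n)
    case 0
    then show ?case by simp
  next
    case (Suc n)
    have "?R n = matpow (conj_transpose X) n ** (S + conj_transpose X ** K ** X) ** matpow X n"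
      by (rule arg_cong[OF assms(2)])
    also have "\<dots> = matpow (conj_transpose X) n ** S ** matpow X n + ?R (Suc n)"
      unfolding matpow_Suc_right[of "conj_transpose X"] matpow.simps(2)[of X]
      by (simp only: matrix_ring)
    finally show ?case using Suc by (simp only: sum.lessThan_Suc diff_diff_eq2 algebra_simps)
  qed
  moreover have "(\<lambda>n. K - ?R n) \<longlonglongrightarrow> K - 0"
  proof (rule tendsto_diff[OF tendsto_const])
    note z = matpow_tendsto_0[OF assms(1)]
    have "(\<lambda>n. conj_transpose (matpow X n)) \<longlonglongrightarrow> conj_transpose 0"
      by (rule bounded_linear.tendsto[OF bounded_linear_conj_transpose z])
    then have "(\<lambda>n. matpow (conj_transpose X) n) \<longlonglongrightarrow> 0"
      by (simp add: conj_transpose_matpow)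
    from bounded_bilinear.tendsto[OF bounded_bilinear_matrix_mult
        bounded_bilinear.tendsto[OF bounded_bilinear_matrix_mult this tendsto_const] z]
    show "?R \<longlonglongrightarrow> 0" by (simp add: matrix_mult_zero)
  qed
  ultimately show ?thesis by (simp add: sums_def)
qed


section \<open>Smooth dependence of \<open>X\<close> and \<open>K\<close> on \<open>a\<close>\<close>

text \<open>
  The equation \<open>riccati A b a X = 0\<close> is an algebraic Riccati equation, and \<open>stein X K = A\<^sub>j\<close> (below) is the Stein
  equation solved by \<open>\<Sum>\<^sub>r X\<^sup>*\<^sup>r A\<^sub>j X\<^sup>r\<close>.
\<close>

definition riccati :: "('d::finite \<Rightarrow> complex^'n^'n) \<Rightarrow> real^'d \<Rightarrow> complex^'d \<Rightarrow> complex^'n^'n \<Rightarrow> complex^'n^'n" where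
  "riccati A b a X = pencil A a ** X ** X + shifted_pencil A b a ** X + conj_transpose (pencil A a)"

lemmas has_derivative_matrix_mult = bounded_bilinear.FDERIV[OF bounded_bilinear_matrix_mult]

lemma riccati_has_derivative:
  assumes \<alpha>: "(\<alpha> has_derivative \<alpha>') (at p)" and X: "(X has_derivative X') (at p)"
  shows "((\<lambda>p. riccati A b (\<alpha> p) (X p)) has_derivative
    (\<lambda>h. pencil A (\<alpha>' h) ** X p ** X p + pencil A (\<alpha> p) ** X' h ** X p + pencil A (\<alpha> p) ** X p ** X' h
      - pencil A (\<alpha>' h) ** X p - pencil A (cnj_vec (\<alpha>' h)) ** X p + shifted_pencil A b (\<alpha> p) ** X' h
      + conj_transpose (pencil A (\<alpha>' h)))) (at p)"
proof -
  have P: "((\<lambda>p. pencil A (\<alpha> p)) has_derivative (\<lambda>h. pencil A (\<alpha>' h))) (at p)"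
    by (rule bounded_linear.has_derivative[OF bounded_linear_pencil \<alpha>])
  have P': "((\<lambda>p. pencil A (cnj_vec (\<alpha> p))) has_derivative (\<lambda>h. pencil A (cnj_vec (\<alpha>' h)))) (at p)"
    by (intro bounded_linear.has_derivative[OF bounded_linear_pencil]
        bounded_linear.has_derivative[OF bounded_linear_cnj_vec \<alpha>])
  have S: "((\<lambda>p. shifted_pencil A b (\<alpha> p)) has_derivative
      (\<lambda>h. 0 - pencil A (\<alpha>' h) - pencil A (cnj_vec (\<alpha>' h)))) (at p)"
    unfolding shifted_pencil_eq by (intro has_derivative_diff has_derivative_const P P')
  have C: "((\<lambda>p. conj_transpose (pencil A (\<alpha> p))) has_derivative
      (\<lambda>h. conj_transpose (pencil A (\<alpha>' h)))) (at p)"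
    by (rule bounded_linear.has_derivative[OF bounded_linear_conj_transpose P])
  show ?thesis
    unfolding riccati_def
    by (rule has_derivative_eq_rhs[OF has_derivative_add[OF has_derivative_add[OF
          has_derivative_matrix_mult[OF has_derivative_matrix_mult[OF P X] X]
          has_derivative_matrix_mult[OF S X]] C]])
      (simp add: fun_eq_iff matrix_ring algebra_simps)
qed

lemma smooth_on_riccati:
  assumes "open S" "smooth_on \<alpha> S" "smooth_on X S"
  shows "smooth_on (\<lambda>p. riccati A b (\<alpha> p) (X p)) S"
proof -
  have P: "smooth_on (\<lambda>p. pencil A (\<alpha> p)) S"
    by (rule smooth_on_linear_compose[OF assms(1) bounded_linear_pencil assms(2)])
  have P': "smooth_on (\<lambda>p. pencil A (cnj_vec (\<alpha> p))) S"
    by (rule smooth_on_linear_compose[OF assms(1) bounded_linear_pencil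
          smooth_on_linear_compose[OF assms(1) bounded_linear_cnj_vec assms(2)]])
  show ?thesis
    unfolding riccati_def shifted_pencil_eq
    by (intro smooth_on_add smooth_on_diff smooth_on_bilinear[OF assms(1) bounded_bilinear_matrix_mult]
        smooth_on_linear_compose[OF assms(1) bounded_linear_conj_transpose] P P' assms smooth_on_const)
qed

definition stein :: "complex^'n^'n \<Rightarrow> complex^'n^'n \<Rightarrow> complex^'n^'n" where
  "stein X K = K - conj_transpose X ** K ** X"

lemma stein_has_derivative:
  assumes X: "(X has_derivative X') (at p)" and K: "(K has_derivative K') (at p)"
  shows "((\<lambda>p. stein (X p) (K p)) has_derivative
    (\<lambda>h. K' h - conj_transpose (X' h) ** K p ** X p - conj_transpose (X p) ** K' h ** X p
       - conj_transpose (X p) ** K p ** X' h)) (at p)"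
proof -
  have C: "((\<lambda>p. conj_transpose (X p)) has_derivative (\<lambda>h. conj_transpose (X' h))) (at p)"
    by (rule bounded_linear.has_derivative[OF bounded_linear_conj_transpose X])
  show ?thesis
    unfolding stein_def
    by (rule has_derivative_eq_rhs[OF has_derivative_diff[OF K
          has_derivative_matrix_mult[OF has_derivative_matrix_mult[OF C K] X]]])
      (simp add: fun_eq_iff matrix_ring algebra_simps)
qed

lemma smooth_on_stein:
  assumes "open S" "smooth_on X S" "smooth_on K S"
  shows "smooth_on (\<lambda>p. stein (X p) (K p)) S"
  unfolding stein_def
  by (intro smooth_on_diff smooth_on_bilinear[OF assms(1) bounded_bilinear_matrix_mult]
        smooth_on_linear_compose[OF assms(1) bounded_linear_conj_transpose] assms)

lemma has_derivative_componentwise: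
  fixes f :: "'a::real_normed_vector \<Rightarrow> 'b::euclidean_space ^ 'n::finite"
  assumes "\<And>i. ((\<lambda>x. f x $ i) has_derivative (\<lambda>h. f' h $ i)) F"
  shows "(f has_derivative f') F"
proof -
  have "((\<lambda>x. \<Sum>i\<in>UNIV. axis i (f x $ i)) has_derivative (\<lambda>h. \<Sum>i\<in>UNIV. axis i (f' h $ i))) F"
    by (intro has_derivative_sum bounded_linear.has_derivative[OF bounded_linear_axis assms])
  then show ?thesis unfolding sum_axis_components .
qed

text \<open>
  Near \<open>a = 0\<close> the zero set of the last two components is the graph of \<open>a \<mapsto> (X, K)\<close>. Carrying \<open>a\<close> along as
  first component turns the implicit function theorem into the inverse function theorem.
\<close>

definition structure_map ::
    "('d::finite \<Rightarrow> complex^'n^'n) \<Rightarrow> real^'d \<Rightarrow>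
     (complex^'d) \<times> (complex^'n^'n) \<times> ((complex^'n^'n)^'d) \<Rightarrow>
     (complex^'d) \<times> (complex^'n^'n) \<times> ((complex^'n^'n)^'d)" where
  "structure_map A b p = (fst p, riccati A b (fst p) (fst (snd p)),
     (\<chi> j. stein (fst (snd p)) (snd (snd p) $ j) - A j))"

lemma smooth_on_structure_map: "smooth_on (structure_map A b) UNIV"
proof -
  have 1: "smooth_on (\<lambda>p. fst (snd p)) UNIV"
    by (intro smooth_on_bounded_linear bounded_linear_compose[OF bounded_linear_fst bounded_linear_snd])
  have 2: "smooth_on (\<lambda>p. snd (snd p) $ j) UNIV" for j
    by (intro smooth_on_bounded_linear bounded_linear_compose[OF bounded_linear_vec_nth]
        bounded_linear_compose[OF bounded_linear_snd bounded_linear_snd])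
  show ?thesis
    unfolding structure_map_def[abs_def]
  proof (intro smooth_on_Pair open_UNIV smooth_on_riccati)
    have "smooth_on (\<lambda>p. (\<chi> j. stein (fst (snd p)) (snd (snd p) $ j) - A j) $ j) UNIV" for j
      unfolding vec_lambda_beta
      by (intro smooth_on_diff smooth_on_stein open_UNIV smooth_on_const 1 2)
    then show "smooth_on (\<lambda>p. \<chi> j. stein (fst (snd p)) (snd (snd p) $ j) - A j) UNIV"
      by (rule smooth_on_componentwise[OF open_UNIV])
  qed (auto intro: smooth_on_bounded_linear bounded_linear_fst 1)
qed

text \<open>
  At \<open>(0, 0, A)\<close> the map is \<open>(da, dX, dK) \<mapsto> (da, B dX + (dP)\<^sup>*, dK)\<close> to first order, where \<open>B\<close> is the invertible
  pencil at \<open>b\<close>.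
\<close>

lemma structure_map_derivative_injective:
  fixes A :: "'b::finite \<Rightarrow> complex^'a^'a"
  assumes "invertible (pencil A (cvec b))"
    and "frechet_derivative (structure_map A b) (at (0, 0, \<chi> j. A j)) h = 0"
  shows "h = 0"
proof -
  let ?p = "(0, 0, \<chi> j. A j) :: (complex^'b) \<times> (complex^'a^'a) \<times> ((complex^'a^'a)^'b)"
  have 1: "((\<lambda>p. fst (snd p)) has_derivative (\<lambda>h. fst (snd h))) (at ?p)"
    by (intro derivative_intros)
  have 2: "((\<lambda>p. snd (snd p) $ j) has_derivative (\<lambda>h. snd (snd h) $ j)) (at ?p)" for j
    by (intro bounded_linear.has_derivative[OF bounded_linear_vec_nth] derivative_intros)
  have "(structure_map A b has_derivative (\<lambda>h. (fst h,
      pencil A (cvec b) ** fst (snd h) + conj_transpose (pencil A (fst h)), snd (snd h)))) (at ?p)"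
    unfolding structure_map_def[abs_def]
  proof (rule has_derivative_Pair[OF _ has_derivative_Pair])
    show "((\<lambda>p. riccati A b (fst p) (fst (snd p))) has_derivative
        (\<lambda>h. pencil A (cvec b) ** fst (snd h) + conj_transpose (pencil A (fst h)))) (at ?p)"
      by (rule has_derivative_eq_rhs[OF riccati_has_derivative[OF has_derivative_fst[OF has_derivative_ident] 1]])
        (simp add: fun_eq_iff matrix_mult_zero shifted_pencil_eq
          linear_0[OF bounded_linear.linear[OF bounded_linear_cnj_vec]])
    have "((\<lambda>p. (\<chi> j. stein (fst (snd p)) (snd (snd p) $ j) - A j) $ j) has_derivative
        (\<lambda>h. snd (snd h) $ j)) (at ?p)" for j
      unfolding vec_lambda_beta
      by (rule has_derivative_eq_rhs[OF has_derivative_diff[OF stein_has_derivative[OF 1 2] has_derivative_const]])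
        (simp add: fun_eq_iff matrix_mult_zero)
    then show "((\<lambda>p. \<chi> j. stein (fst (snd p)) (snd (snd p) $ j) - A j) has_derivative
        (\<lambda>h. snd (snd h))) (at ?p)"
      by (rule has_derivative_componentwise)
  qed (intro derivative_intros)
  then have "frechet_derivative (structure_map A b) (at ?p) = (\<lambda>h. (fst h,
      pencil A (cvec b) ** fst (snd h) + conj_transpose (pencil A (fst h)), snd (snd h)))"
    by (rule frechet_derivative_at[symmetric])
  with assms(2) have h: "fst h = 0" "pencil A (cvec b) ** fst (snd h) = 0" "snd (snd h) = 0"
    by (auto simp: zero_prod_def)
  obtain B' where "B' ** pencil A (cvec b) = mat 1"
    using assms(1) by (auto simp: invertible_def)
  then have "fst (snd h) = 0"
    using h(2) by (metis matrix_mul_assoc matrix_mul_lid matrix_mult_zero(1))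
  then show ?thesis using h by (simp add: prod_eq_iff)
qed

lemma invertible_onorm_lower_bound:
  fixes B :: "complex^'n^'n"
  assumes "invertible B"
  obtains m where "m > 0" "\<And>Z :: complex^'n^'n. m * onorm ((*v) Z) \<le> onorm ((*v) (B ** Z))"
proof -
  obtain B' where B': "B' ** B = mat 1" using assms by (auto simp: invertible_def)
  let ?c = "onorm ((*v) B')"
  have c: "0 \<le> ?c" by (rule onorm_matrix_nonneg)
  show thesis
  proof
    show "1 / (?c + 1) > 0" using c by simp
    fix Z :: "complex^'n^'n"
    have "onorm ((*v) Z) = onorm ((*v) (B' ** (B ** Z)))"
      using B' by (simp add: matrix_mul_assoc)
    also have "\<dots> \<le> ?c * onorm ((*v) (B ** Z))" by (rule onorm_matrix_mult)
    also have "\<dots> \<le> (?c + 1) * onorm ((*v) (B ** Z))"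
      using onorm_matrix_nonneg[of "B ** Z"] by (simp add: algebra_simps)
    finally show "1 / (?c + 1) * onorm ((*v) Z) \<le> onorm ((*v) (B ** Z))"
      using c by (simp add: field_simps)
  qed
qed

lemma invertibleI_matrix:
  fixes S :: "complex^'n^'n"
  assumes "\<And>Z :: complex^'n^'n. S ** Z = 0 \<Longrightarrow> Z = 0"
  shows "invertible S"
proof -
  have "x = 0" if "S *v x = 0" for x
  proof -
    have "S ** (\<chi> i j. x $ i) = 0"
      using that by (simp add: vec_eq_iff matrix_mult_component matrix_vector_component)
    from assms[OF this] show ?thesis by (simp add: vec_eq_iff)
  qed
  then show ?thesis
    using matrix_left_invertible_ker[of S] invertible_left_inverse[of S] by blast
qed

lemma onorm_matrix_zero: "onorm ((*v) (0 :: complex^'n^'n)) = 0"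
  using onorm_zero[where 'a = "complex^'n" and 'b = "complex^'n"]
  by (simp add: matrix_vector_mult_0[abs_def])

text \<open>
  For two solutions the difference \<open>D\<close> satisfies \<open>S D = - P (X D + D Y)\<close>. The right-hand side is at most
  \<open>2 |P| |D|\<close> because both solutions have norm below one, whereas \<open>S\<close> is bounded below by \<open>m - |E|\<close>, where
  \<open>E\<close> is the difference of the pencil at \<open>b\<close> and \<open>S\<close>; for small \<open>a\<close> this forces \<open>D = 0\<close>.
\<close>

lemma riccati_unique:
  assumes m: "\<And>Z :: complex^'n^'n. m * onorm ((*v) Z) \<le> onorm ((*v) (pencil A (cvec b) ** Z))"
    and small: "onorm ((*v) (pencil A a + pencil A (cnj_vec a))) + 2 * onorm ((*v) (pencil A a)) < m"
  shows "invertible (shifted_pencil A b a)"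
    and "X_solution A b a X \<Longrightarrow> X_solution A b a Y \<Longrightarrow> X = Y"
proof -
  let ?N = "\<lambda>X :: complex^'n^'n. onorm ((*v) X)"
  let ?E = "pencil A a + pencil A (cnj_vec a)" and ?P = "pencil A a" and ?S = "shifted_pencil A b a"
  have lower: "(m - ?N ?E) * ?N Z \<le> ?N (?S ** Z)" for Z
  proof -
    have "m * ?N Z \<le> ?N (pencil A (cvec b) ** Z)" by (rule m)
    also have "pencil A (cvec b) ** Z = ?S ** Z + ?E ** Z"
      by (simp add: shifted_pencil_eq matrix_ring)
    also have "?N \<dots> \<le> ?N (?S ** Z) + ?N (?E ** Z)" by (rule onorm_matrix_add)
    also have "\<dots> \<le> ?N (?S ** Z) + ?N ?E * ?N Z" using onorm_matrix_mult by simp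
    finally show ?thesis by (simp add: algebra_simps)
  qed
  have gap: "2 * ?N ?P < m - ?N ?E" using small by simp
  show "invertible ?S"
  proof (rule invertibleI_matrix)
    fix Z :: "complex^'n^'n" assume "?S ** Z = 0"
    then have "(m - ?N ?E) * ?N Z \<le> 0" using lower[of Z] by (simp add: onorm_matrix_zero)
    moreover have "m - ?N ?E > 0" using gap onorm_matrix_nonneg[of ?P] by linarith
    ultimately have "?N Z = 0"
      using onorm_matrix_nonneg[of Z] by (simp add: mult_le_0_iff)
    then show "Z = 0" by (rule onorm_matrix_eq_0)
  qed
  assume "X_solution A b a X" "X_solution A b a Y"
  then have N: "?N X < 1" "?N Y < 1"
    and eq: "?P ** X ** X + ?S ** X + conj_transpose ?P = 0" "?P ** Y ** Y + ?S ** Y + conj_transpose ?P = 0"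
    by (auto simp: X_solution_def)
  let ?D = "X - Y"
  have "?S ** ?D + ?P ** (X ** ?D + ?D ** Y) = 0"
  proof -
    have "?S ** ?D + ?P ** (X ** ?D + ?D ** Y)
      = (?P ** X ** X + ?S ** X + conj_transpose ?P) - (?P ** Y ** Y + ?S ** Y + conj_transpose ?P)"
      by (simp add: matrix_ring)
    then show ?thesis unfolding eq by simp
  qed
  then have "?S ** ?D = - (?P ** (X ** ?D + ?D ** Y))" by (simp add: eq_neg_iff_add_eq_0)
  then have "?N (?S ** ?D) = ?N (?P ** (X ** ?D + ?D ** Y))" by (simp add: onorm_matrix_uminus)
  also have "\<dots> \<le> ?N ?P * (?N X * ?N ?D + ?N ?D * ?N Y)"
    by (intro order.trans[OF onorm_matrix_mult] mult_left_mono order.trans[OF onorm_matrix_add]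
        add_mono onorm_matrix_mult onorm_matrix_nonneg)
  also have "\<dots> \<le> ?N ?P * (?N ?D + ?N ?D)"
    using N onorm_matrix_nonneg[of ?D]
    by (intro mult_left_mono add_mono onorm_matrix_nonneg mult_left_le_one_le mult_right_le_one_le)
      (auto simp: onorm_matrix_nonneg)
  finally have "(m - ?N ?E) * ?N ?D \<le> 2 * ?N ?P * ?N ?D" using lower[of ?D] by simp
  then have "(m - ?N ?E - 2 * ?N ?P) * ?N ?D \<le> 0" by (simp add: algebra_simps)
  then have "?N ?D = 0"
    using gap onorm_matrix_nonneg[of ?D] by (simp add: mult_le_0_iff)
  then show "X = Y" using onorm_matrix_eq_0 by fastforce
qed

lemma X_solution_riccati: "X_solution A b a X \<longleftrightarrow> onorm ((*v) X) < 1 \<and> riccati A b a X = 0"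
  by (simp add: X_solution_def riccati_def)

text \<open>
  The local inverse of \<open>structure_map\<close> restricted to the slice \<open>(a, 0, 0)\<close> provides smooth families \<open>X\<close> and
  \<open>K\<close> solving both equations. By uniqueness of \<open>X\<close> and the series for \<open>K\<close> these are \<open>X_mat\<close> and \<open>K_mat\<close>.
\<close>

theorem X_mat_K_mat_smooth:
  fixes A :: "'d::finite \<Rightarrow> complex^'n^'n"
  assumes inv: "invertible (pencil A (cvec b))"
  obtains \<delta> where "\<delta> > 0"
    "\<And>a. norm a < \<delta> \<Longrightarrow> invertible (shifted_pencil A b a)"
    "\<And>a. norm a < \<delta> \<Longrightarrow> \<exists>!X. X_solution A b a X"
    "smooth_on (X_mat A b) (ball 0 \<delta>)" "\<And>j. smooth_on (\<lambda>a. K_mat A b a j) (ball 0 \<delta>)"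
    "\<And>a j. norm a < \<delta> \<Longrightarrow> stein (X_mat A b a) (K_mat A b a j) = A j"
proof -
  let ?p = "(0, 0, \<chi> j. A j) :: (complex^'d) \<times> (complex^'n^'n) \<times> ((complex^'n^'n)^'d)"
  let ?f = "structure_map A b"
  have "local_diffeomorphism_at ?f ?p"
    by (rule smooth_inverse_function_theorem[OF open_UNIV UNIV_I smooth_on_structure_map
          structure_map_derivative_injective[OF inv]]) simp_all
  then obtain U where U: "open U" "?p \<in> U" "inj_on ?f U" "open (?f ` U)"
    "smooth_on (inv_into U ?f) (?f ` U)"
    unfolding local_diffeomorphism_at_def by blast
  define s where "s = (\<lambda>a. inv_into U ?f (a, 0, 0))"
  define Xf where "Xf = (\<lambda>a. fst (snd (s a)))"
  define Kf where "Kf = (\<lambda>a. snd (snd (s a)))"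
  let ?e = "\<lambda>a :: complex^'d. (a, 0, 0) :: (complex^'d) \<times> (complex^'n^'n) \<times> ((complex^'n^'n)^'d)"
  have e: "bounded_linear ?e"
    by (intro bounded_linear_Pair bounded_linear_ident bounded_linear_zero)
  define W where "W = ?e -` (?f ` U)"
  have W: "open W"
    unfolding W_def using U(4) by (intro open_vimage) (auto intro: linear_continuous_on[OF e])
  have fp: "?f ?p = ?e 0"
    by (simp add: structure_map_def riccati_def stein_def matrix_mult_zero vec_eq_iff)
  then have "0 \<in> W" unfolding W_def using U(2) by (metis image_eqI vimageI2)
  have s0: "s 0 = ?p" unfolding s_def using inv_into_f_f[OF U(3,2)] fp by simp
  have s: "smooth_on s W"
    unfolding s_def
    by (rule smooth_on_compose[OF W U(4,5) smooth_on_bounded_linear[OF e]]) (auto simp: W_def)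
  have Xf: "smooth_on Xf W"
    unfolding Xf_def by (intro smooth_on_linear_compose[OF W _ s]
        bounded_linear_compose[OF bounded_linear_fst bounded_linear_snd])
  have Kf: "smooth_on (\<lambda>a. Kf a $ j) W" for j
    unfolding Kf_def by (intro smooth_on_linear_compose[OF W _ s]
        bounded_linear_compose[OF bounded_linear_vec_nth]
        bounded_linear_compose[OF bounded_linear_snd bounded_linear_snd])
  have sol: "riccati A b a (Xf a) = 0" "stein (Xf a) (Kf a $ j) = A j" if "a \<in> W" for a j
  proof -
    have "?f (s a) = ?e a" unfolding s_def using that by (intro f_inv_into_f) (auto simp: W_def)
    then have eq: "fst (s a) = a" "riccati A b (fst (s a)) (Xf a) = 0"
      "(\<chi> j. stein (Xf a) (Kf a $ j) - A j) = 0"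
      unfolding structure_map_def Xf_def Kf_def prod.inject by blast+
    have "(\<chi> j. stein (Xf a) (Kf a $ j) - A j) $ j = 0 $ j" by (simp only: eq(3))
    then show "stein (Xf a) (Kf a $ j) = A j" by simp
    show "riccati A b a (Xf a) = 0" using eq(1,2) by simp
  qed
  obtain m where m: "m > 0"
    "\<And>Z :: complex^'n^'n. m * onorm ((*v) Z) \<le> onorm ((*v) (pencil A (cvec b) ** Z))"
    using invertible_onorm_lower_bound[OF inv] by metis
  obtain C where C: "C > 0" "\<And>X :: complex^'n^'n. onorm ((*v) X) \<le> C * norm X"
    using onorm_matrix_bounded by blast
  have "((\<lambda>a. pencil A a) \<longlongrightarrow> pencil A 0) (nhds 0)"
    and "((\<lambda>a. pencil A (cnj_vec a)) \<longlongrightarrow> pencil A (cnj_vec 0)) (nhds 0)"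
    by (intro bounded_linear.tendsto[OF bounded_linear_pencil]
        bounded_linear.tendsto[OF bounded_linear_cnj_vec] tendsto_ident_at filterlim_ident)+
  then have "((\<lambda>a. C * norm (pencil A a + pencil A (cnj_vec a)) + 2 * (C * norm (pencil A a)))
      \<longlongrightarrow> C * norm (pencil A 0 + pencil A (cnj_vec 0)) + 2 * (C * norm (pencil A 0))) (nhds 0)"
    by (intro tendsto_intros)
  then have "((\<lambda>a. C * norm (pencil A a + pencil A (cnj_vec a)) + 2 * (C * norm (pencil A a))) \<longlongrightarrow> 0) (nhds 0)"
    by (simp add: linear_0[OF bounded_linear.linear[OF bounded_linear_cnj_vec]])
  then have ev1: "\<forall>\<^sub>F a in nhds 0. C * norm (pencil A a + pencil A (cnj_vec a)) + 2 * (C * norm (pencil A a)) < m"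
    using m(1) by (rule order_tendstoD)
  have "isCont Xf 0"
    using smooth_on_continuous[OF Xf] W \<open>0 \<in> W\<close> by (simp add: continuous_on_eq_continuous_at)
  then have "(Xf \<longlongrightarrow> Xf 0) (nhds 0)" by (simp add: tendsto_nhds_iff isCont_def)
  then have "((\<lambda>a. C * norm (Xf a)) \<longlongrightarrow> C * norm (Xf 0)) (nhds 0)"
    by (intro tendsto_intros)
  then have ev2: "\<forall>\<^sub>F a in nhds 0. C * norm (Xf a) < 1"
    by (intro order_tendstoD(2)[of _ 0]) (simp_all add: Xf_def s0)
  have ev3: "\<forall>\<^sub>F a in nhds 0. a \<in> W" using W \<open>0 \<in> W\<close> by (rule eventually_nhds_in_open)
  have "\<forall>\<^sub>F a in nhds 0. C * norm (pencil A a + pencil A (cnj_vec a)) + 2 * (C * norm (pencil A a)) < m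
      \<and> C * norm (Xf a) < 1 \<and> a \<in> W"
    using ev1 ev2 ev3 by eventually_elim blast
  then obtain \<delta> where \<delta>: "\<delta> > 0" "\<And>a. norm a < \<delta> \<Longrightarrow>
      C * norm (pencil A a + pencil A (cnj_vec a)) + 2 * (C * norm (pencil A a)) < m
      \<and> C * norm (Xf a) < 1 \<and> a \<in> W"
    unfolding eventually_nhds_metric by auto
  have small: "onorm ((*v) (pencil A a + pencil A (cnj_vec a))) + 2 * onorm ((*v) (pencil A a)) < m"
    if "norm a < \<delta>" for a
    using \<delta>(2)[OF that] C(2)[of "pencil A a + pencil A (cnj_vec a)"] C(2)[of "pencil A a"] by linarith
  have Xsol: "X_solution A b a (Xf a)" if "norm a < \<delta>" for a
    unfolding X_solution_riccati using \<delta>(2)[OF that] C(2)[of "Xf a"] sol(1)[of a] by auto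
  have ex1: "\<exists>!X. X_solution A b a X" if "norm a < \<delta>" for a
    using Xsol[OF that] riccati_unique(2)[OF m(2) small[OF that]] by blast
  have Xm: "X_mat A b a = Xf a" if "norm a < \<delta>" for a
    unfolding X_mat_def using ex1[OF that] Xsol[OF that] by (rule the1_equality)
  have Km: "K_mat A b a j = Kf a $ j" if "norm a < \<delta>" for a j
  proof -
    have "Kf a $ j = A j + conj_transpose (Xf a) ** (Kf a $ j) ** Xf a"
      using sol(2)[of a j] \<delta>(2)[OF that] by (simp add: stein_def algebra_simps)
    from stein_equation_sums[OF _ this] Xsol[OF that] show ?thesis
      unfolding K_mat_def Xm[OF that] by (simp add: sums_iff X_solution_def)
  qed
  have sub: "ball 0 \<delta> \<subseteq> W" using \<delta>(2) by auto
  show thesis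
  proof
    show "\<delta> > 0" by (rule \<delta>(1))
    show "invertible (shifted_pencil A b a)" if "norm a < \<delta>" for a
      by (rule riccati_unique(1)[OF m(2) small[OF that]])
    show "\<exists>!X. X_solution A b a X" if "norm a < \<delta>" for a by (rule ex1[OF that])
    show "smooth_on (X_mat A b) (ball 0 \<delta>)"
      using smooth_on_cong[of "ball 0 \<delta>" "X_mat A b" Xf] Xm smooth_on_subset[OF Xf sub] by simp
    show "smooth_on (\<lambda>a. K_mat A b a j) (ball 0 \<delta>)" for j
      using smooth_on_cong[of "ball 0 \<delta>" "\<lambda>a. K_mat A b a j" "\<lambda>a. Kf a $ j"] Km
        smooth_on_subset[OF Kf sub] by simp
    show "stein (X_mat A b a) (K_mat A b a j) = A j" if "norm a < \<delta>" for a j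
      using Xm[OF that] Km[OF that] sol(2) \<delta>(2)[OF that] by simp
  qed
qed


section \<open>The disc algebra\<close>

definition disc_algebra :: "(complex \<Rightarrow> complex) \<Rightarrow> bool" where
  "disc_algebra f \<longleftrightarrow> continuous_on (cball 0 1) f \<and> f holomorphic_on ball 0 1"

named_theorems disc_algebra_intros

lemma disc_algebra_const [disc_algebra_intros]: "disc_algebra (\<lambda>z. c)"
  and disc_algebra_ident [disc_algebra_intros]: "disc_algebra (\<lambda>z. z)"
  and disc_algebra_add [disc_algebra_intros]: "disc_algebra f \<Longrightarrow> disc_algebra g \<Longrightarrow> disc_algebra (\<lambda>z. f z + g z)"
  and disc_algebra_diff [disc_algebra_intros]: "disc_algebra f \<Longrightarrow> disc_algebra g \<Longrightarrow> disc_algebra (\<lambda>z. f z - g z)"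
  and disc_algebra_minus [disc_algebra_intros]: "disc_algebra f \<Longrightarrow> disc_algebra (\<lambda>z. - f z)"
  and disc_algebra_mult [disc_algebra_intros]: "disc_algebra f \<Longrightarrow> disc_algebra g \<Longrightarrow> disc_algebra (\<lambda>z. f z * g z)"
  unfolding disc_algebra_def by (auto intro!: continuous_intros holomorphic_intros)

lemma disc_algebra_power [disc_algebra_intros]: "disc_algebra f \<Longrightarrow> disc_algebra (\<lambda>z. f z ^ n)"
  unfolding disc_algebra_def by (auto intro!: continuous_intros holomorphic_intros)

lemma disc_algebra_sum [disc_algebra_intros]:
  "(\<And>i. i \<in> I \<Longrightarrow> disc_algebra (f i)) \<Longrightarrow> disc_algebra (\<lambda>z. \<Sum>i\<in>I. f i z)"
  unfolding disc_algebra_def by (auto intro!: continuous_intros holomorphic_intros)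

lemma disc_algebra_prod [disc_algebra_intros]:
  "(\<And>i. i \<in> I \<Longrightarrow> disc_algebra (f i)) \<Longrightarrow> disc_algebra (\<lambda>z. \<Prod>i\<in>I. f i z)"
  unfolding disc_algebra_def by (auto intro!: continuous_intros holomorphic_intros)

lemma disc_algebra_divide:
  assumes "disc_algebra f" "disc_algebra g" "\<And>z. z \<in> cball 0 1 \<Longrightarrow> g z \<noteq> 0"
  shows "disc_algebra (\<lambda>z. f z / g z)"
  using assms unfolding disc_algebra_def by (auto intro!: continuous_intros holomorphic_intros)

lemma disc_algebra_cong:
  assumes "disc_algebra f" "\<And>z. z \<in> cball 0 1 \<Longrightarrow> g z = f z"
  shows "disc_algebra g"
  using assms unfolding disc_algebra_def
  by (auto intro: continuous_on_eq holomorphic_transform)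

lemma disc_algebra_Im_le_0:
  assumes "disc_algebra f" "\<And>z. z \<in> sphere 0 1 \<Longrightarrow> Im (f z) \<le> 0" "z \<in> cball 0 1"
  shows "Im (f z) \<le> 0"
proof -
  have g: "disc_algebra (\<lambda>z. - \<i> * f z)" using assms(1) by (intro disc_algebra_intros)
  have "Re (- \<i> * f z) \<le> 0"
  proof (rule maximum_real_frontier[of "\<lambda>z. - \<i> * f z" "cball 0 1"])
    show "(\<lambda>z. - \<i> * f z) holomorphic_on interior (cball 0 1)"
      "continuous_on (closure (cball 0 1)) (\<lambda>z. - \<i> * f z)"
      using g by (simp_all add: disc_algebra_def)
    show "Re (- \<i> * f z) \<le> 0" if "z \<in> frontier (cball 0 1)" for z
      using assms(2)[of z] that by simp
  qed (use assms(3) in auto)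
  then show ?thesis by simp
qed

text \<open>
  The maximum principle for the imaginary part makes the function real on the whole disc, so its image
  is not open and the function is constant.
\<close>

lemma disc_algebra_real_on_circle:
  assumes f: "disc_algebra f" and re: "\<And>z. z \<in> sphere 0 1 \<Longrightarrow> Im (f z) = 0"
    and z: "z \<in> cball 0 1"
  shows "f z = f 1"
proof -
  have Im0: "Im (f z) = 0" if "z \<in> ball 0 1" for z
    using disc_algebra_Im_le_0[OF f, of z] disc_algebra_Im_le_0[OF disc_algebra_minus[OF f], of z] re that
    by (force intro: antisym)
  have "f constant_on ball 0 1"
  proof (rule ccontr)
    assume "\<not> f constant_on ball 0 1"
    then have "open (f ` ball 0 1)"
      using f by (intro open_mapping_thm[of f "ball 0 1"]) (auto simp: disc_algebra_def)
    then obtain e where e: "e > 0" "ball (f 0) e \<subseteq> f ` ball 0 1"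
      unfolding open_contains_ball by force
    \<comment> \<open>The image would contain a point off the real line.\<close>
    have "f 0 + \<i> * of_real (e / 2) \<in> ball (f 0) e"
      using e(1) by (simp add: dist_norm norm_mult)
    then obtain y where "y \<in> ball 0 1" "f y = f 0 + \<i> * of_real (e / 2)"
      using e(2) by force
    then show False using Im0[of y] Im0[of 0] e(1) by simp
  qed
  then obtain c where c: "\<And>z. z \<in> ball 0 1 \<Longrightarrow> f z = c" by (auto simp: constant_on_def)
  have "f z = c" if "z \<in> cball 0 1" for z
    using continuous_constant_on_closure[of "ball 0 1" f c z] f c that by (simp add: disc_algebra_def)
  then show ?thesis using z by simp
qed

lemma disc_algebra_eqI:
  assumes "disc_algebra f" "disc_algebra g" "\<And>z. z \<in> sphere 0 1 \<Longrightarrow> f z = g z" "z \<in> cball 0 1"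
  shows "f z = g z"
  using disc_algebra_real_on_circle[OF disc_algebra_diff[OF assms(1,2)] _ assms(4)] assms(3) by simp

lemma disc_algebra_factor:
  assumes f: "disc_algebra f" "f 0 = 0"
  obtains g where "disc_algebra g" "\<And>z. f z = z * g z"
proof -
  define g where "g = (\<lambda>z. if z = 0 then deriv f 0 else (f z - f 0) / (z - 0))"
  have hol: "g holomorphic_on ball 0 1"
    unfolding g_def using f(1) by (intro pole_lemma_open) (auto simp: disc_algebra_def)
  have "continuous (at z within cball 0 1) g" if z: "z \<in> cball 0 1" for z
  proof (cases "z = 0")
    case True
    then have "isCont g z"
      using holomorphic_on_imp_continuous_on[OF hol] by (simp add: continuous_on_eq_continuous_at)
    then show ?thesis by (rule continuous_at_imp_continuous_at_within)
  next
    case False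
    have "continuous (at z within cball 0 1) (\<lambda>z. f z / z)"
      using f(1) z False by (intro continuous_at_within_divide continuous_ident)
        (auto simp: disc_algebra_def continuous_on_eq_continuous_within)
    then show ?thesis
    proof (rule continuous_transform_within)
      show "dist z 0 > 0" using False by simp
      show "f y / y = g y" if "y \<in> cball 0 1" "dist y z < dist z 0" for y
        using that f(2) by (auto simp: g_def dist_commute)
    qed (rule z)
  qed
  then have "disc_algebra g" using hol by (simp add: disc_algebra_def continuous_on_eq_continuous_within)
  moreover have "f z = z * g z" for z using f(2) by (simp add: g_def)
  ultimately show thesis by (rule that)
qed

lemma sphere_cnj: "z \<in> sphere 0 1 \<Longrightarrow> cnj z * z = 1" "z \<in> sphere 0 1 \<Longrightarrow> z * cnj z = 1" for z :: complex
  using complex_norm_square[of z] by (auto simp: mult.commute)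

text \<open>
  Dividing \<open>f - f(0)\<close> by \<open>z\<close> and subtracting \<open>cnj (f 0) z\<close> leaves a function that is real on the circle, hence
  constant. Applied to \<open>2 w~\<close>, this determines the multipliers \<open>c\<^sub>j\<close> of a stationary disc from \<open>a\<close> and \<open>b\<close>.
\<close>

lemma disc_algebra_quadratic:
  assumes f: "disc_algebra f" and re: "\<And>z. z \<in> sphere 0 1 \<Longrightarrow> Im (cnj z * f z) = 0"
    and z: "z \<in> cball 0 1"
  shows "f z = f 0 + (f 1 - f 0 - cnj (f 0)) * z + cnj (f 0) * z\<^sup>2"
proof -
  obtain g where g: "disc_algebra g" "\<And>z. f z - f 0 = z * g z"
    using disc_algebra_factor[OF disc_algebra_diff[OF f disc_algebra_const[of "f 0"]]] by auto
  have "g z - cnj (f 0) * z = g 1 - cnj (f 0) * 1"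
  proof (rule disc_algebra_real_on_circle[OF _ _ z])
    show "disc_algebra (\<lambda>z. g z - cnj (f 0) * z)" using g(1) by (intro disc_algebra_intros)
    fix z :: complex assume z: "z \<in> sphere 0 1"
    have "g z = cnj z * (f z - f 0)" using g(2)[of z] sphere_cnj(1)[OF z] by (simp flip: mult.assoc)
    then have "g z - cnj (f 0) * z = cnj z * f z - (cnj z * f 0 + cnj (cnj z * f 0))"
      by (simp add: algebra_simps)
    then show "Im (g z - cnj (f 0) * z) = 0" using re[OF z] by simp
  qed
  then have gz: "g z = f 1 - f 0 - cnj (f 0) + cnj (f 0) * z"
    using g(2)[of 1] by (simp add: algebra_simps)
  have "f z = f 0 + z * g z" using g(2)[of z] by (simp add: algebra_simps)
  then show ?thesis unfolding gz by (simp add: algebra_simps power2_eq_square)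
qed

text \<open>
  If \<open>u\<close> and \<open>z cnj u\<close> both extend holomorphically, then so do \<open>s = (u - u(0)) / z\<close> and its conjugate; the
  functions \<open>s + cnj s\<close> and \<open>i (s - cnj s)\<close> are real on the circle, hence constant.
\<close>

lemma disc_algebra_affine:
  assumes u: "disc_algebra u" and m: "disc_algebra m"
    and eq: "\<And>z. z \<in> sphere 0 1 \<Longrightarrow> m z = z * cnj (u z)"
    and z: "z \<in> cball 0 1"
  shows "u z = u 0 + (u 1 - u 0) * z"
proof -
  obtain s where s: "disc_algebra s" "\<And>z. u z - u 0 = z * s z"
    using disc_algebra_factor[OF disc_algebra_diff[OF u disc_algebra_const[of "u 0"]]] by auto
  define t where "t = (\<lambda>z. m z - cnj (u 0) * z)"
  have t: "disc_algebra t" unfolding t_def by (intro disc_algebra_intros m)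
  have st: "t z = cnj (s z)" if "z \<in> sphere 0 1" for z
  proof -
    have "s z = cnj z * (u z - u 0)" using s(2)[of z] sphere_cnj(1)[OF that] by (simp flip: mult.assoc)
    then have "cnj (s z) = z * (cnj (u z) - cnj (u 0))" by simp
    then show ?thesis using eq[OF that] by (simp add: t_def right_diff_distrib mult.commute)
  qed
  have "s z + t z = s 1 + t 1"
    using disc_algebra_real_on_circle[of "\<lambda>z. s z + t z", OF disc_algebra_add[OF s(1) t] _ z] st by simp
  moreover have "\<i> * (s z - t z) = \<i> * (s 1 - t 1)"
    using st by (intro disc_algebra_real_on_circle[of "\<lambda>z. \<i> * (s z - t z)", OF _ _ z]
      disc_algebra_intros s t) simp
  ultimately have "s z + t z = s 1 + t 1" "s z - t z = s 1 - t 1" by simp_all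
  then have "s z + t z + (s z - t z) = s 1 + t 1 + (s 1 - t 1)" by (simp only:)
  then have "s z = s 1" by simp
  then show ?thesis using s(2)[of z] s(2)[of 1] by (simp add: algebra_simps)
qed

section \<open>The resolvent on the closed disc\<close>

text \<open>
  The matrix \<open>I - z X\<close>, written by entries because a complex number does not act on a vector of vectors by
  \<open>*s\<close>.
\<close>

definition one_minus :: "complex^'n^'n \<Rightarrow> complex \<Rightarrow> complex^'n^'n" where
  "one_minus X z = (\<chi> i j. (if i = j then 1 else 0) - z * X $ i $ j)"

definition disc_regular :: "complex^'n^'n \<Rightarrow> bool" where
  "disc_regular X \<longleftrightarrow> (\<forall>z\<in>cball 0 1. det (one_minus X z) \<noteq> 0)"

definition resolvent :: "complex^'n^'n \<Rightarrow> complex \<Rightarrow> complex^'n \<Rightarrow> complex^'n" where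
  "resolvent X z v = matrix_inv (one_minus X z) *v v"

lemma matrix_inv_inverse:
  assumes "invertible M"
  shows "M ** matrix_inv M = mat 1" "matrix_inv M ** M = mat 1"
  using assms someI_ex[of "\<lambda>B. M ** B = mat 1 \<and> B ** M = mat 1"]
  by (auto simp: invertible_def matrix_inv_def)

lemma one_minus_mult: "one_minus X z *v v = v - z *s (X *v v)"
proof -
  have "(one_minus X z *v v) $ i = (v - z *s (X *v v)) $ i" for i
  proof -
    have "(one_minus X z *v v) $ i = (\<Sum>k\<in>UNIV. (if i = k then 1 else 0) * v $ k) - (\<Sum>k\<in>UNIV. z * (X $ i $ k * v $ k))"
      by (simp add: matrix_vector_component one_minus_def algebra_simps sum_subtractf)
    also have "(\<Sum>k\<in>UNIV. (if i = k then 1 else 0) * v $ k) = v $ i"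
      by (simp add: if_distrib[of "\<lambda>c. c * _"] cong: if_cong)
    finally show ?thesis by (simp add: matrix_vector_component sum_distrib_left)
  qed
  then show ?thesis by (simp add: vec_eq_iff)
qed

lemma one_minus_transpose: "one_minus (transpose X) z = transpose (one_minus X z)"
  by (auto simp add: one_minus_def transpose_def vec_eq_iff)

lemma disc_regular_transpose: "disc_regular X \<Longrightarrow> disc_regular (transpose X)"
  by (simp add: disc_regular_def one_minus_transpose)

lemma norm_vec_scale: "norm (z *s v) = norm z * norm v" for v :: "complex^'n"
  by (simp add: norm_vec_def norm_mult L2_set_right_distrib)

lemma disc_regular_onorm:
  fixes X :: "complex^'n^'n"
  assumes "onorm ((*v) X) < 1"
  shows "disc_regular X"
  unfolding disc_regular_def
proof
  fix z :: complex assume z: "z \<in> cball 0 1"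
  have "v = 0" if "one_minus X z *v v = 0" for v
  proof (rule ccontr)
    assume "v \<noteq> 0"
    have "norm v = norm (z *s (X *v v))" using that by (simp add: one_minus_mult)
    also have "\<dots> \<le> norm (X *v v)" using z by (simp add: norm_vec_scale mult_left_le_one_le)
    also have "\<dots> \<le> onorm ((*v) X) * norm v" by (rule onorm) simp
    also have "\<dots> < norm v" using assms \<open>v \<noteq> 0\<close> by simp
    finally show False by simp
  qed
  then show "det (one_minus X z) \<noteq> 0"
    using matrix_left_invertible_ker[of "one_minus X z"] invertible_left_inverse invertible_det_nz by metis
qed

lemma resolvent_iff:
  assumes "disc_regular X" "z \<in> cball 0 1"
  shows "y - z *s (X *v y) = v \<longleftrightarrow> y = resolvent X z v"
proof -
  have "invertible (one_minus X z)" using assms by (simp add: disc_regular_def invertible_det_nz)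
  then have "matrix_inv (one_minus X z) ** one_minus X z = mat 1" "one_minus X z ** matrix_inv (one_minus X z) = mat 1"
    by (simp_all add: matrix_inv_inverse)
  then show ?thesis
    unfolding resolvent_def one_minus_mult[symmetric]
    by (metis matrix_vector_mul_assoc matrix_vector_mul_lid)
qed

lemma resolvent_eq:
  assumes "disc_regular X" "z \<in> cball 0 1"
  shows "resolvent X z v - z *s (X *v resolvent X z v) = v"
  using resolvent_iff[OF assms] by blast

lemma disc_algebra_det:
  assumes "\<And>i j. disc_algebra (\<lambda>z. M z $ i $ j)"
  shows "disc_algebra (\<lambda>z. det (M z))"
  unfolding det_def by (intro disc_algebra_intros assms)

lemma disc_algebra_if:
  "disc_algebra f \<Longrightarrow> disc_algebra g \<Longrightarrow> disc_algebra (\<lambda>z. if b then f z else g z)"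
  by (cases b) simp_all

text \<open>
  By Cramer's rule the components are quotients of functions of the disc algebra with nonvanishing
  denominator \<open>det (I - z X)\<close>.
\<close>

lemma disc_algebra_resolvent:
  assumes X: "disc_regular X" and v: "\<And>i. disc_algebra (\<lambda>z. v z $ i)"
  shows "disc_algebra (\<lambda>z. resolvent X z (v z) $ k)"
proof (rule disc_algebra_cong)
  have om: "disc_algebra (\<lambda>z. one_minus X z $ i $ j)" for i j
    unfolding one_minus_def vec_lambda_beta by (intro disc_algebra_intros)
  show "disc_algebra (\<lambda>z. det (\<chi> i j. if j = k then v z $ i else one_minus X z $ i $ j) / det (one_minus X z))"
    using X
    by (intro disc_algebra_divide disc_algebra_det) (auto simp: disc_regular_def intro!: disc_algebra_if om v)
next
  fix z :: complex assume z: "z \<in> cball 0 1"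
  have "one_minus X z *v resolvent X z (v z) = v z"
    unfolding one_minus_mult by (rule resolvent_eq[OF X z])
  then have "resolvent X z (v z) = (\<chi> k. det (\<chi> i j. if j = k then v z $ i else one_minus X z $ i $ j) / det (one_minus X z))"
    using X z by (subst (asm) cramer) (auto simp: disc_regular_def)
  then show "resolvent X z (v z) $ k =
      det (\<chi> i j. if j = k then v z $ i else one_minus X z $ i $ j) / det (one_minus X z)"
    by (simp add: vec_eq_iff)
qed

section \<open>Factorization of the pencil on the circle\<close>

lemma stein_zero:
  fixes X E :: "complex^'n^'n"
  assumes "onorm ((*v) X) < 1" "E = conj_transpose X ** E ** X"
  shows "E = 0"
proof -
  have "E = 0 + conj_transpose X ** E ** X" using assms(2) by (simp only: add_0)
  from stein_equation_sums[OF assms(1) this] have "(\<lambda>r. 0) sums E" by (simp add: matrix_mult_zero)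
  then show ?thesis using sums_unique2[OF _ sums_zero] by blast
qed

lemma cnj_vec_cnj_vec: "cnj_vec (cnj_vec a) = a"
  by (simp add: cnj_vec_def)

lemma cnj_vec_cvec: "cnj_vec (cvec c) = cvec c"
  by (simp add: cnj_vec_def cvec_def)

lemma hermitian_pencil_cvec:
  assumes "\<And>j. hermitian (A j)"
  shows "conj_transpose (pencil A (cvec c)) = pencil A (cvec c)"
  using conj_transpose_pencil[of A "cvec c"] assms by (simp add: cnj_vec_cvec)

text \<open>
  The skew part of a solution solves the homogeneous equation, which has only the zero solution.
\<close>

lemma stein_hermitian:
  fixes X K :: "complex^'n^'n"
  assumes X: "onorm ((*v) X) < 1" and "stein X K = S" "hermitian S"
  shows "conj_transpose K = K"
proof -
  have "stein X K = conj_transpose (stein X K)" using assms by (simp add: hermitian_def)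
  then have "K - conj_transpose X ** K ** X = conj_transpose K - conj_transpose X ** conj_transpose K ** X"
    by (simp add: stein_def conj_transpose_mult matrix_mul_assoc)
  then have "conj_transpose K - K = conj_transpose X ** (conj_transpose K - K) ** X"
    by (simp add: matrix_ring algebra_simps)
  from stein_zero[OF X this] show ?thesis by simp
qed

text \<open>
  The middle factor \<open>Q = S + P X\<close> of \<open>P / \<zeta> + S + \<zeta> P\<^sup>* = (I - X\<^sup>* / \<zeta>) Q (I - \<zeta> X)\<close>.
\<close>

definition factor_mat :: "('d::finite \<Rightarrow> complex^'n^'n) \<Rightarrow> real^'d \<Rightarrow> complex^'d \<Rightarrow> complex^'n^'n \<Rightarrow> complex^'n^'n" where
  "factor_mat A b a X = shifted_pencil A b a + pencil A a ** X"

text \<open>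
  With \<open>Q = S + P X\<close> the quadratic equation reads \<open>Q X = - P\<^sup>*\<close>. Then \<open>S = Q + X\<^sup>* Q\<^sup>* X\<close>, and as \<open>S\<close> is
  Hermitian, \<open>Q - Q\<^sup>*\<close> solves the homogeneous Stein equation and vanishes. The four matrices \<open>P\<close>, \<open>S\<close>,
  \<open>P\<^sup>*\<close>, \<open>B\<close> are thus all expressed through \<open>X\<close> and the Hermitian \<open>Q\<close>.
\<close>

lemma factorization:
  fixes A :: "'d::finite \<Rightarrow> complex^'n^'n"
  assumes herm: "\<And>j. hermitian (A j)" and X: "X_solution A b a X"
  defines "Q \<equiv> factor_mat A b a X"
  shows "conj_transpose Q = Q" "pencil A (cnj_vec a) = - (Q ** X)" "pencil A a = - (conj_transpose X ** Q)"
    "shifted_pencil A b a = Q + conj_transpose X ** Q ** X"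
    "pencil A (cvec b) = (mat 1 - conj_transpose X) ** Q ** (mat 1 - X)"
proof -
  have N: "onorm ((*v) X) < 1" and eq: "riccati A b a X = 0"
    using X by (auto simp: X_solution_riccati)
  have "Q ** X + conj_transpose (pencil A a) = 0"
    using eq by (simp add: Q_def factor_mat_def riccati_def matrix_ring algebra_simps)
  then have P': "pencil A (cnj_vec a) = - (Q ** X)"
    by (simp add: conj_transpose_pencil[OF herm] add_eq_0_iff)
  then have "conj_transpose (pencil A (cnj_vec a)) = - (conj_transpose X ** conj_transpose Q)"
    by (simp add: conj_transpose_mult)
  then have P: "pencil A a = - (conj_transpose X ** conj_transpose Q)"
    by (simp add: conj_transpose_pencil[OF herm] cnj_vec_cnj_vec)
  have S: "shifted_pencil A b a = Q + conj_transpose X ** conj_transpose Q ** X"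
  proof -
    have "shifted_pencil A b a = Q - pencil A a ** X" by (simp add: Q_def factor_mat_def)
    also have "pencil A a ** X = - (conj_transpose X ** conj_transpose Q ** X)"
      unfolding P by (simp add: matrix_ring)
    finally show ?thesis by simp
  qed
  have "conj_transpose (shifted_pencil A b a) = shifted_pencil A b a"
    by (simp add: shifted_pencil_eq hermitian_pencil_cvec[OF herm] conj_transpose_pencil[OF herm] cnj_vec_cnj_vec cnj_vec_cvec)
  then have "Q + conj_transpose X ** conj_transpose Q ** X = conj_transpose Q + conj_transpose X ** Q ** X"
    unfolding S by (simp add: conj_transpose_mult matrix_mul_assoc)
  then have "Q - conj_transpose Q = conj_transpose X ** (Q - conj_transpose Q) ** X"
    by (simp add: matrix_ring algebra_simps)
  from stein_zero[OF N this] show Q: "conj_transpose Q = Q" by simp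
  show "pencil A (cnj_vec a) = - (Q ** X)" by (rule P')
  show P2: "pencil A a = - (conj_transpose X ** Q)" using P Q by simp
  show S2: "shifted_pencil A b a = Q + conj_transpose X ** Q ** X" using S Q by simp
  have "pencil A (cvec b) = shifted_pencil A b a + pencil A a + pencil A (cnj_vec a)"
    by (simp add: shifted_pencil_eq)
  then show "pencil A (cvec b) = (mat 1 - conj_transpose X) ** Q ** (mat 1 - X)"
    unfolding S2 P2 P' by (simp add: matrix_ring algebra_simps)
qed


section \<open>The conormal field of a quadric\<close>

lemma del_defining_fun:
  fixes A :: "'d::finite \<Rightarrow> complex^'n^'n"
  assumes herm: "\<And>j. hermitian (A j)"
  shows "del (defining_fun A j) p = ((\<chi> k. - cnj ((A j *v fst p) $ k)), axis j (1/2))"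
proof -
  have D: "frechet_derivative (defining_fun A j) (at p) =
      (\<lambda>h. Re (snd h $ j) - 2 * Re (cinner (A j *v fst p) (fst h)))"
  proof (rule frechet_derivative_at[symmetric])
    have "((\<lambda>p. Re (snd p $ j) - Re (cinner (fst p) (A j *v fst p))) has_derivative
       (\<lambda>h. Re (snd h $ j) - Re (cinner (fst p) (A j *v fst h) + cinner (fst h) (A j *v fst p)))) (at p)"
      by (intro has_derivative_diff bounded_linear.has_derivative[OF bounded_linear_Re]
          bounded_linear.has_derivative[OF bounded_linear_vec_nth]
          bounded_bilinear.FDERIV[OF bounded_bilinear_cinner]
          bounded_linear.has_derivative[OF matrix_vector_mul_bounded_linear] derivative_intros)
    then have "(defining_fun A j has_derivative
       (\<lambda>h. Re (snd h $ j) - Re (cinner (fst p) (A j *v fst h) + cinner (fst h) (A j *v fst p)))) (at p)"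
      unfolding defining_fun_def[abs_def] .
    moreover have "Re (cinner (fst p) (A j *v u) + cinner u (A j *v fst p)) = 2 * Re (cinner (A j *v fst p) u)" for u
    proof -
      have "cinner (fst p) (A j *v u) = cinner (A j *v fst p) u"
        using herm[of j] by (simp add: cinner_adjoint[of "fst p"] hermitian_def)
      moreover have "cinner u (A j *v fst p) = cnj (cinner (A j *v fst p) u)" by (simp add: cinner_commute)
      ultimately show ?thesis by simp
    qed
    ultimately show "(defining_fun A j has_derivative
        (\<lambda>h. Re (snd h $ j) - 2 * Re (cinner (A j *v fst p) (fst h)))) (at p)" by simp
  qed
  have ax: "cinner x (axis k c) = cnj (x $ k) * c" for x :: "complex^'n" and k c
    by (simp add: cinner_def axis_def if_distrib[of "\<lambda>c. _ * c"] cong: if_cong)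
  have "cinner x 0 = 0" for x :: "complex^'n" by (simp add: cinner_def)
  moreover have "Re ((axis k c :: complex^'d) $ j) = (if k = j then Re c else 0)" for k c
    by (simp add: axis_def)
  ultimately show ?thesis
    unfolding del_def D
    by (simp add: ax vec_eq_iff complex_eq_iff) (simp add: axis_def)
qed

lemma pencil_cvec_mult:
  "pencil A (cvec t) *v v = (\<Sum>j\<in>UNIV. (t $ j) *\<^sub>R (A j *v v))" for A :: "'d::finite \<Rightarrow> complex^'n^'n"
proof -
  have "(pencil A (cvec t) *v v) $ k = (\<Sum>j\<in>UNIV. (t $ j) *\<^sub>R (A j *v v)) $ k" for k
  proof -
    have "(pencil A (cvec t) *v v) $ k = (\<Sum>i\<in>UNIV. \<Sum>j\<in>UNIV. (t $ j) *\<^sub>R (A j $ k $ i * v $ i))"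
      by (simp add: matrix_vector_component pencil_def cvec_def sum_distrib_right scaleR_conv_of_real mult.assoc)
    also have "\<dots> = (\<Sum>j\<in>UNIV. \<Sum>i\<in>UNIV. (t $ j) *\<^sub>R (A j $ k $ i * v $ i))" by (rule sum.swap)
    finally show ?thesis by (simp add: matrix_vector_component scaleR_sum_right)
  qed
  then show ?thesis by (simp add: vec_eq_iff)
qed

text \<open>
  The first component is \<open>- (C h)\<^sup>*\<close>, with \<open>C\<close> the pencil at the real vector \<open>c\<close>; it is the conjugate of a linear
  expression because \<open>C\<close> is Hermitian.
\<close>

lemma conormal_sum:
  fixes A :: "'d::finite \<Rightarrow> complex^'n^'n"
  assumes herm: "\<And>j. hermitian (A j)"
  shows "(\<Sum>j\<in>UNIV. (c $ j) *\<^sub>R del (defining_fun A j) p) =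
    ((\<chi> k. - cnj ((pencil A (cvec c) *v fst p) $ k)), (1/2) *s cvec c)"
proof -
  have "(\<Sum>j\<in>UNIV. (c $ j) *\<^sub>R del (defining_fun A j) p) =
     ((\<Sum>j\<in>UNIV. (c $ j) *\<^sub>R (\<chi> k. - cnj ((A j *v fst p) $ k))), (\<Sum>j\<in>UNIV. (c $ j) *\<^sub>R axis j (1/2)))"
    unfolding del_defining_fun[OF herm] by (simp add: sum_prod scaleR_Pair)
  moreover have "(\<Sum>j\<in>UNIV. (c $ j) *\<^sub>R (\<chi> k. - cnj ((A j *v fst p) $ k))) =
     (\<chi> k. - cnj ((pencil A (cvec c) *v fst p) $ k))"
  proof -
    have "(pencil A (cvec c) *v fst p) $ k = (\<Sum>j\<in>UNIV. (c $ j) *\<^sub>R (A j *v fst p) $ k)" for k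
      by (simp only: pencil_cvec_mult sum_component vector_scaleR_component)
    then show ?thesis by (simp add: vec_eq_iff sum_negf cnj_scaleR)
  qed
  moreover have "(\<Sum>j\<in>UNIV. (c $ j) *\<^sub>R axis j (1/2)) = (1/2) *s cvec c"
  proof -
    have "(\<Sum>j\<in>UNIV. (c $ j) *\<^sub>R (axis j (1/2) :: complex^'d) $ i) = (\<Sum>j\<in>UNIV. if i = j then complex_of_real (c $ j) / 2 else 0)" for i
      by (rule sum.cong) (auto simp: axis_def scaleR_conv_of_real)
    then show ?thesis by (simp add: vec_eq_iff cvec_def)
  qed
  ultimately show ?thesis by simp
qed

lemma in_quadric_iff: "p \<in> quadric A \<longleftrightarrow> (\<forall>j. Re (snd p $ j) = Re (cinner (fst p) (A j *v fst p)))"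
  by (simp add: quadric_def defining_fun_def)

lemma analytic_disc_iff:
  "analytic_disc f \<longleftrightarrow> (\<forall>k. disc_algebra (\<lambda>\<zeta>. fst (f \<zeta>) $ k)) \<and> (\<forall>j. disc_algebra (\<lambda>\<zeta>. snd (f \<zeta>) $ j))"
proof -
  have "continuous_on (cball 0 1) f \<longleftrightarrow> (\<forall>k. continuous_on (cball 0 1) (\<lambda>\<zeta>. fst (f \<zeta>) $ k)) \<and>
      (\<forall>j. continuous_on (cball 0 1) (\<lambda>\<zeta>. snd (f \<zeta>) $ j))" (is "?L \<longleftrightarrow> ?R")
  proof
    assume ?R
    then have "continuous_on (cball 0 1) (\<lambda>\<zeta>. (\<chi> k. fst (f \<zeta>) $ k, \<chi> j. snd (f \<zeta>) $ j))"
      by (intro continuous_on_Pair continuous_on_vec_lambda) auto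
    then show ?L by simp
  qed (auto intro!: continuous_intros)
  then show ?thesis unfolding analytic_disc_def disc_algebra_def by blast
qed

section \<open>Multipliers of stationary discs\<close>

text \<open>
  The vector \<open>c(\<zeta>) = a / \<zeta> + (b - a - cnj a) + \<zeta> cnj a\<close> of multipliers of a stationary disc on the unit circle;
  \<open>cnj \<zeta>\<close> replaces \<open>1 / \<zeta>\<close> there. The real form below is what the definition of a stationary lift asks for.
\<close>

definition multiplier :: "real^'d \<Rightarrow> complex^'d \<Rightarrow> complex \<Rightarrow> complex^'d" where
  "multiplier b a \<zeta> = cnj \<zeta> *s a + (cvec b - a - cnj_vec a) + \<zeta> *s cnj_vec a"

lemma pencil_smult_mult: "pencil A (z *s c) *v v = z *s (pencil A c *v v)"
  by (simp add: vec_eq_iff matrix_vector_component pencil_scale sum_distrib_left mult.assoc)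

lemma matrix_vector_smult: "M *v (z *s v) = z *s (M *v v)" for M :: "complex^'n^'m"
  by (simp add: vec_eq_iff matrix_vector_component sum_distrib_left mult_ac)

lemma matrix_vector_uminus: "(- M) *v v = - (M *v v)" for M :: "complex^'n^'m"
  by (simp add: vec_eq_iff matrix_vector_component sum_negf)

text \<open>
  Inserting the expressions for \<open>P\<close>, \<open>S\<close>, \<open>P\<^sup>*\<close> and using \<open>\<zeta> cnj \<zeta> = 1\<close> gives
  \<open>P / \<zeta> + S + \<zeta> P\<^sup>* = (I - X\<^sup>* / \<zeta>) Q (I - \<zeta> X)\<close>. The last factor is invertible inside the disc and the first one
  outside, which is what makes the boundary condition on \<open>h\<close> solvable.
\<close>

lemma multiplier_factorization:
  fixes A :: "'d::finite \<Rightarrow> complex^'n^'n"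
  assumes herm: "\<And>j. hermitian (A j)" and X: "X_solution A b a X" and \<zeta>: "\<zeta> \<in> sphere 0 1"
    and u_def: "u = v - \<zeta> *s (X *v v)"
  defines "Q \<equiv> factor_mat A b a X"
  shows "pencil A (multiplier b a \<zeta>) *v v = Q *v u - cnj \<zeta> *s (conj_transpose X *v (Q *v u))"
proof -
  note F = factorization[OF herm X, folded Q_def]
  let ?X' = "conj_transpose X"
  have S: "pencil A (cvec b - a - cnj_vec a) = Q + ?X' ** Q ** X"
    using F(4) by (simp add: shifted_pencil_eq pencil_diff)
  have "pencil A (multiplier b a \<zeta>) *v v =
     cnj \<zeta> *s (pencil A a *v v) + (Q + ?X' ** Q ** X) *v v + \<zeta> *s (pencil A (cnj_vec a) *v v)"
    unfolding multiplier_def pencil_add S matrix_vector_mult_add_rdistrib pencil_smult_mult ..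
  also have "\<dots> = - (cnj \<zeta> *s (?X' *v (Q *v v))) + (Q *v v + ?X' *v (Q *v (X *v v))) - \<zeta> *s (Q *v (X *v v))"
    unfolding F(2,3) matrix_vector_uminus matrix_vector_mult_add_rdistrib matrix_vector_mul_assoc matrix_mul_assoc
    by (simp add: vec_eq_iff)
  also have "\<dots> = Q *v u - cnj \<zeta> *s (?X' *v (Q *v u))"
  proof -
    have "cnj \<zeta> *s (\<zeta> *s x) = x" for x :: "complex^'n"
      using sphere_cnj(1)[OF \<zeta>] by (simp add: vec_eq_iff flip: mult.assoc)
    then show ?thesis
      unfolding u_def
      by (simp add: matrix_vector_mult_diff_distrib matrix_vector_smult vector_ssub_ldistrib algebra_simps)
  qed
  finally show ?thesis .
qed

definition real_multiplier :: "real^'d \<Rightarrow> complex^'d \<Rightarrow> complex \<Rightarrow> real^'d" where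
  "real_multiplier b a \<zeta> = (\<chi> j. b $ j - 2 * Re (a $ j) + 2 * Re (cnj \<zeta> * a $ j))"

lemma cvec_real_multiplier: "cvec (real_multiplier b a \<zeta>) = multiplier b a \<zeta>"
  by (simp add: vec_eq_iff cvec_def real_multiplier_def multiplier_def cnj_vec_def complex_eq_iff)

section \<open>The explicit lifts\<close>

text \<open>
  With \<open>R = (I - \<zeta> X)\<inverse>\<close> and \<open>W = (I - X) V\<close>, the components \<open>h, w, h~, w~\<close> of the lift with parameters
  \<open>(a, V)\<close> are \<open>(\<zeta> - 1) R W\<close>, \<open>2 (1 - \<zeta>) W\<^sup>* K\<^sub>j (I - X) R W\<close>, \<open>(\<zeta> - 1) W\<^sup>* Q (I - \<zeta> X)\<close> and
  \<open>(a\<^sub>j + (b\<^sub>j - a\<^sub>j - cnj a\<^sub>j) \<zeta> + cnj a\<^sub>j \<zeta>\<^sup>2) / 2\<close>.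
\<close>

definition lift_h where
  "lift_h X W \<zeta> = (\<zeta> - 1) *s resolvent X \<zeta> W"
definition lift_w where
  "lift_w X K W \<zeta> = (\<chi> j. 2 * (1 - \<zeta>) * cinner W (K j *v ((mat 1 - X) *v resolvent X \<zeta> W)))"
definition lift_h' where
  "lift_h' X Q W \<zeta> = (\<chi> k. (\<zeta> - 1) * (cnj ((Q *v W) $ k) - \<zeta> * cnj ((conj_transpose X *v (Q *v W)) $ k)))"
definition lift_w' where
  "lift_w' b a \<zeta> = (\<chi> j. (a $ j + (cvec b - a - cnj_vec a) $ j * \<zeta> + cnj (a $ j) * \<zeta>\<^sup>2) / 2)"

definition explicit_lift where
  "explicit_lift b a X Q K W = restrict (\<lambda>\<zeta>. ((lift_h X W \<zeta>, lift_w X K W \<zeta>), (lift_h' X Q W \<zeta>, lift_w' b a \<zeta>))) (cball 0 1)"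

lemma one_in_cball: "(1::complex) \<in> cball 0 1" "(0::complex) \<in> cball 0 1" "(1::complex) \<in> sphere 0 1"
  by auto

lemma cinner_hermitian_swap:
  fixes K :: "complex^'n^'n"
  assumes K: "conj_transpose K = K"
  shows "cinner x (K *v y) = cnj (cinner y (K *v x))"
  by (simp add: cinner_adjoint[of x] K cinner_commute)

text \<open>
  On the circle \<open>y = resolvent X \<zeta> W\<close> satisfies \<open>\<zeta> X y = y - W\<close>, so replacing \<open>A\<^sub>j\<close> by \<open>K\<^sub>j - X\<^sup>* K\<^sub>j X\<close> cancels
  the term \<open>y\<^sup>* K\<^sub>j y\<close> and leaves \<open>y\<^sup>* A\<^sub>j y = 2 Re (W\<^sup>* K\<^sub>j y) - W\<^sup>* K\<^sub>j W\<close>.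
  After multiplication by \<open>|\<zeta> - 1|\<^sup>2 = 2 - 2 Re \<zeta>\<close> this is the real part of \<open>lift_w\<close>.
\<close>

lemma lift_on_quadric:
  fixes X :: "complex^'n^'n"
  assumes X: "disc_regular X" and K: "\<And>j. stein X (K j) = A j" "\<And>j. conj_transpose (K j) = K j"
    and \<zeta>: "\<zeta> \<in> sphere 0 1"
  shows "Re (lift_w X K W \<zeta> $ j) = Re (cinner (lift_h X W \<zeta>) (A j *v lift_h X W \<zeta>))"
proof -
  have \<zeta>': "\<zeta> \<in> cball 0 1" using \<zeta> by auto
  define y where "y = resolvent X \<zeta> W"
  define g where "g = cinner W (K j *v y)"
  define g0 where "g0 = cinner W (K j *v W)"
  have y: "\<zeta> *s (X *v y) = y - W"
    using resolvent_eq[OF X \<zeta>', of W] by (simp add: y_def algebra_simps)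
  have n: "cnj \<zeta> * \<zeta> = 1" by (rule sphere_cnj[OF \<zeta>])
  have Xy: "X *v y = cnj \<zeta> *s (y - W)"
    unfolding y[symmetric] using n by (simp add: vec_eq_iff flip: mult.assoc)
  have g0r: "Im g0 = 0"
    using cinner_hermitian_swap[OF K(2), of W j W] by (simp add: g0_def complex_eq_iff)
  have gc: "cinner y (K j *v W) = cnj g"
    unfolding g_def by (rule cinner_hermitian_swap[OF K(2)])
  have "A j *v y = K j *v y - conj_transpose X *v (K j *v (X *v y))"
    by (simp add: K(1)[symmetric] stein_def matrix_vector_mult_diff_rdistrib matrix_vector_mul_assoc matrix_mul_assoc)
  then have "cinner y (A j *v y) = cinner y (K j *v y) - cinner (X *v y) (K j *v (X *v y))"
    using cinner_adjoint[of y "conj_transpose X"] by (simp add: cinner_diff)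
  also have "cinner (X *v y) (K j *v (X *v y)) = cinner (y - W) (K j *v (y - W))"
    unfolding Xy matrix_vector_smult cinner_scale using n by (simp flip: mult.assoc add: mult.commute)
  also have "\<dots> = cinner y (K j *v y) - cnj g - g + g0"
    by (simp add: matrix_vector_mult_diff_distrib cinner_diff gc g_def g0_def)
  finally have "cinner y (A j *v y) = cnj g + g - g0" by simp
  then have "cinner (lift_h X W \<zeta>) (A j *v lift_h X W \<zeta>) = cnj (\<zeta> - 1) * (\<zeta> - 1) * (cnj g + g - g0)"
    unfolding lift_h_def y_def[symmetric] matrix_vector_smult cinner_scale by (simp add: mult.assoc)
  also have "cnj (\<zeta> - 1) * (\<zeta> - 1) = complex_of_real (2 - 2 * Re \<zeta>)"
    using n by (simp add: algebra_simps complex_eq_iff)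
  finally have R: "Re (cinner (lift_h X W \<zeta>) (A j *v lift_h X W \<zeta>)) = (2 - 2 * Re \<zeta>) * (2 * Re g - Re g0)"
    by simp
  have "cinner W (K j *v ((mat 1 - X) *v y)) = g - cnj \<zeta> * (g - g0)"
    by (simp add: matrix_vector_mult_diff_rdistrib Xy matrix_vector_mult_diff_distrib matrix_vector_smult
        cinner_diff cinner_scale g_def g0_def right_diff_distrib)
  then have "lift_w X K W \<zeta> $ j = 2 * (1 - \<zeta>) * (g - cnj \<zeta> * (g - g0))"
    by (simp add: lift_w_def y_def)
  also have "\<dots> = 2 * (2 - \<zeta> - cnj \<zeta>) * g + 2 * (cnj \<zeta> - 1) * g0"
  proof -
    have "2 * (1 - \<zeta>) * (g - cnj \<zeta> * (g - g0)) =
        2 * (1 - \<zeta> - cnj \<zeta> + cnj \<zeta> * \<zeta>) * g + 2 * (cnj \<zeta> - cnj \<zeta> * \<zeta>) * g0"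
      by (simp add: algebra_simps)
    then show ?thesis unfolding n by simp
  qed
  finally have "Re (lift_w X K W \<zeta> $ j) = Re (2 * (2 - \<zeta> - cnj \<zeta>) * g + 2 * (cnj \<zeta> - 1) * g0)"
    by (rule arg_cong)
  then show ?thesis unfolding R using g0r by (simp add: algebra_simps)
qed

text \<open>
  Since \<open>(I - \<zeta> X) h = (\<zeta> - 1) W\<close>, the factorization of the multiplier leaves in \<open>\<zeta> (C h)\<^sup>*\<close> only a
  polynomial in \<open>\<zeta>\<close>.
\<close>

lemma lift_conormal:
  fixes A :: "'d::finite \<Rightarrow> complex^'n^'n"
  assumes herm: "\<And>j. hermitian (A j)" and X: "X_solution A b a X" and \<zeta>: "\<zeta> \<in> sphere 0 1"
  shows "(lift_h' X (factor_mat A b a X) W \<zeta>, lift_w' b a \<zeta>) =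
    cscale \<zeta> (\<Sum>j\<in>UNIV. (real_multiplier b a \<zeta> $ j) *\<^sub>R del (defining_fun A j) (lift_h X W \<zeta>, w))"
proof -
  let ?Q = "factor_mat A b a X" and ?h = "lift_h X W \<zeta>"
  have X': "disc_regular X" using X by (intro disc_regular_onorm) (simp add: X_solution_def)
  have \<zeta>': "\<zeta> \<in> cball 0 1" using \<zeta> by auto
  have n: "\<zeta> * cnj \<zeta> = 1" "\<zeta> * (cnj \<zeta> * x) = x" for x
    using sphere_cnj[OF \<zeta>] by (simp_all flip: mult.assoc)
  have u: "?h - \<zeta> *s (X *v ?h) = (\<zeta> - 1) *s W"
  proof -
    have "?h - \<zeta> *s (X *v ?h) = (\<zeta> - 1) *s (resolvent X \<zeta> W - \<zeta> *s (X *v resolvent X \<zeta> W))"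
      by (simp add: lift_h_def matrix_vector_smult vec_eq_iff algebra_simps)
    then show ?thesis unfolding resolvent_eq[OF X' \<zeta>'] .
  qed
  have C: "pencil A (multiplier b a \<zeta>) *v ?h =
      (\<zeta> - 1) *s (?Q *v W - cnj \<zeta> *s (conj_transpose X *v (?Q *v W)))"
    unfolding multiplier_factorization[OF herm X \<zeta> refl] u matrix_vector_smult
    by (simp add: vec_eq_iff algebra_simps)
  have 1: "lift_h' X ?Q W \<zeta> $ k = \<zeta> * - cnj ((pencil A (multiplier b a \<zeta>) *v ?h) $ k)" for k
    unfolding C by (simp add: lift_h'_def algebra_simps n)
  have 2: "lift_w' b a \<zeta> $ j = \<zeta> * (1 / 2 * multiplier b a \<zeta> $ j)" for j
  proof -
    have "\<zeta> * multiplier b a \<zeta> $ j = a $ j + (cvec b - a - cnj_vec a) $ j * \<zeta> + cnj (a $ j) * \<zeta>\<^sup>2"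
      by (simp add: multiplier_def cnj_vec_def algebra_simps power2_eq_square n)
    then show ?thesis by (simp add: lift_w'_def)
  qed
  show ?thesis
    unfolding conormal_sum[OF herm] cvec_real_multiplier cscale_def prod_eq_iff vec_eq_iff
    by (simp add: 1 2)
qed

lemma invertible_factor_mat:
  fixes A :: "'d::finite \<Rightarrow> complex^'n^'n"
  assumes "\<And>j. hermitian (A j)" "X_solution A b a X" "invertible (pencil A (cvec b))"
  shows "invertible (factor_mat A b a X)"
  using assms(3) unfolding factorization(5)[OF assms(1,2)] by (simp add: invertible_det_nz det_mul)

lemma cinner_self_eq_0: "cinner x x = 0 \<longleftrightarrow> x = 0"
proof
  assume "cinner x x = 0"
  moreover have "cinner x x = complex_of_real (\<Sum>i\<in>UNIV. (cmod (x $ i))\<^sup>2)"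
    unfolding cinner_def of_real_sum complex_norm_square by (simp add: mult.commute)
  ultimately have "(\<Sum>i\<in>UNIV. (cmod (x $ i))\<^sup>2) = 0" by (simp only: of_real_eq_0_iff)
  then show "x = 0" by (simp add: sum_nonneg_eq_0_iff vec_eq_iff)
qed (simp add: cinner_def)

text \<open>
  If the multiplier vanished at \<open>\<zeta>\<close>, so would \<open>(I - X\<^sup>* / \<zeta>) Q (I - \<zeta> X)\<close>, a product of invertible matrices. In place of
  inverting \<open>I - X\<^sup>* / \<zeta>\<close>, the product is paired with vectors in the range of \<open>I - \<zeta> X\<close>.
\<close>

lemma multiplier_nonzero:
  fixes A :: "'d::finite \<Rightarrow> complex^'n^'n"
  assumes herm: "\<And>j. hermitian (A j)" and X: "X_solution A b a X"
    and inv: "invertible (pencil A (cvec b))" and \<zeta>: "\<zeta> \<in> sphere 0 1"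
  shows "multiplier b a \<zeta> \<noteq> 0"
proof
  let ?Q = "factor_mat A b a X"
  assume m: "multiplier b a \<zeta> = 0"
  have X': "disc_regular X" using X by (intro disc_regular_onorm) (simp add: X_solution_def)
  have \<zeta>': "\<zeta> \<in> cball 0 1" using \<zeta> by auto
  define e :: "complex^'n" where "e = (\<chi> i. 1)"
  define v where "v = resolvent X \<zeta> e"
  define x where "x = resolvent X \<zeta> (?Q *v e)"
  have v: "e = v - \<zeta> *s (X *v v)" and x: "x - \<zeta> *s (X *v x) = ?Q *v e"
    unfolding v_def x_def by (simp_all add: resolvent_eq[OF X' \<zeta>'])
  have "?Q *v e - cnj \<zeta> *s (conj_transpose X *v (?Q *v e)) = 0"
    using multiplier_factorization[OF herm X \<zeta> v] by (simp add: m)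
  then have "0 = cinner x (?Q *v e - cnj \<zeta> *s (conj_transpose X *v (?Q *v e)))"
    by (simp add: cinner_def)
  also have "\<dots> = cinner (x - \<zeta> *s (X *v x)) (?Q *v e)"
    by (simp add: cinner_diff cinner_scale cinner_adjoint[of x "conj_transpose X"])
  finally have "?Q *v e = 0" unfolding x by (simp add: cinner_self_eq_0)
  then have "e = 0"
    using invertible_factor_mat[OF herm X inv] matrix_left_invertible_ker[of ?Q] invertible_left_inverse
    by blast
  then show False by (simp add: e_def vec_eq_iff)
qed


section \<open>Derivatives at the boundary point\<close>

lemma has_field_derivative_factor:
  fixes f :: "complex \<Rightarrow> complex"
  assumes "continuous (at c within S) f"
  shows "((\<lambda>z. (z - c) * f z) has_field_derivative f c) (at c within S)"
proof -
  have "((\<lambda>z. ((z - c) * f z - (c - c) * f c) / (z - c)) \<longlongrightarrow> f c) (at c within S)"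
  proof (rule Lim_transform_within[OF _ zero_less_one])
    show "(f \<longlongrightarrow> f c) (at c within S)" using assms by (simp add: continuous_within)
  qed (auto simp: dist_commute)
  then show ?thesis unfolding has_field_derivative_iff .
qed

text \<open>
  All components of an explicit lift have the form \<open>constant + (\<zeta> - 1) y(\<zeta>)\<close>, so that mere continuity of \<open>y\<close> up to the
  boundary yields the derivative at \<open>1\<close>.
\<close>

lemma has_derivative_vec_factor:
  fixes y :: "complex \<Rightarrow> complex^'n"
  assumes "\<And>i. disc_algebra (\<lambda>z. y z $ i)"
  shows "((\<lambda>z. (z - 1) *s y z) has_derivative (\<lambda>h. h *s y 1)) (at 1 within cball 0 1)"
proof (rule has_derivative_componentwise)
  fix i
  have "continuous (at 1 within cball 0 1) (\<lambda>z. y z $ i)"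
    using assms[of i] one_in_cball(1) by (simp add: disc_algebra_def continuous_on_eq_continuous_within)
  from has_field_derivative_factor[OF this]
  show "((\<lambda>z. ((z - 1) *s y z) $ i) has_derivative (\<lambda>h. (h *s y 1) $ i)) (at 1 within cball 0 1)"
    unfolding has_field_derivative_def vector_smult_component
    by (rule has_derivative_eq_rhs) (simp add: fun_eq_iff)
qed

lemma derivative_at_one_unique:
  fixes f :: "complex \<Rightarrow> complex^'n"
  assumes "(f has_derivative (\<lambda>h. h *s v)) (at 1 within cball 0 1)"
    "(f has_derivative (\<lambda>h. h *s v')) (at 1 within cball 0 1)"
  shows "v = v'"
proof -
  have D: "((\<lambda>z. f z $ i) has_field_derivative u $ i) (at 1 within cball 0 1)"
    if "(f has_derivative (\<lambda>h. h *s u)) (at 1 within cball 0 1)" for u i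
    using bounded_linear.has_derivative[OF bounded_linear_vec_nth[of i] that]
    unfolding has_field_derivative_def vector_smult_component
    by (rule has_derivative_eq_rhs) (simp add: fun_eq_iff)
  have "(1::complex) islimpt ball 0 1" by (simp add: islimpt_ball)
  then have "at (1::complex) within cball 0 1 \<noteq> bot"
    by (meson ball_subset_cball islimpt_subset trivial_limit_within)
  then have "v $ i = v' $ i" for i
    using D[OF assms(1), of i] D[OF assms(2), of i] unfolding has_field_derivative_iff
    by (rule tendsto_unique)
  then show ?thesis by (simp add: vec_eq_iff)
qed

lemma disc_algebra_matrix_vector:
  "(\<And>i. disc_algebra (\<lambda>z. v z $ i)) \<Longrightarrow> disc_algebra (\<lambda>z. (M *v v z) $ i)"
  unfolding matrix_vector_component by (intro disc_algebra_intros)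

lemma disc_algebra_cinner:
  "(\<And>i. disc_algebra (\<lambda>z. v z $ i)) \<Longrightarrow> disc_algebra (\<lambda>z. cinner w (v z))"
  unfolding cinner_def by (intro disc_algebra_intros)

lemma disc_algebra_resolvent_const:
  "disc_regular X \<Longrightarrow> disc_algebra (\<lambda>z. resolvent X z W $ k)"
  by (rule disc_algebra_resolvent) (auto intro: disc_algebra_intros)

lemma disc_algebra_lift:
  assumes "disc_regular X"
  shows "disc_algebra (\<lambda>z. lift_h X W z $ k)" "disc_algebra (\<lambda>z. lift_w X K W z $ j)"
    "disc_algebra (\<lambda>z. lift_h' X Q W z $ k)" "disc_algebra (\<lambda>z. lift_w' b a z $ j)"
  unfolding lift_h_def lift_w_def lift_h'_def lift_w'_def vec_lambda_beta vector_smult_component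
  by (intro disc_algebra_intros disc_algebra_resolvent_const disc_algebra_cinner
      disc_algebra_matrix_vector disc_algebra_divide assms; simp)+

lemma explicit_lift_at:
  "z \<in> cball 0 1 \<Longrightarrow> explicit_lift b a X Q K W z = ((lift_h X W z, lift_w X K W z), (lift_h' X Q W z, lift_w' b a z))"
  by (simp add: explicit_lift_def)

lemma explicit_lift_one: "explicit_lift b a X Q K W 1 = ((0, 0), (0, (1/2) *s cvec b))"
  by (simp add: explicit_lift_at lift_h_def lift_w_def lift_h'_def lift_w'_def vec_eq_iff cnj_vec_def)

lemma explicit_lift_has_derivative:
  assumes X: "disc_regular X"
  shows "(explicit_lift b a X Q K W has_derivative (\<lambda>h.
      ((h *s resolvent X 1 W,
        h *s (\<chi> j. - 2 * cinner W (K j *v ((mat 1 - X) *v resolvent X 1 W)))),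
       (h *s (\<chi> k. cnj ((Q *v W) $ k) - cnj ((conj_transpose X *v (Q *v W)) $ k)),
        h *s (\<chi> j. ((cvec b - a - cnj_vec a) $ j + 2 * cnj (a $ j)) / 2))))) (at 1 within cball 0 1)"
proof (rule has_derivative_transform[OF one_in_cball(1) explicit_lift_at])
  let ?w = "\<lambda>z. \<chi> j. - 2 * cinner W (K j *v ((mat 1 - X) *v resolvent X z W))"
  let ?h' = "\<lambda>z. \<chi> k. cnj ((Q *v W) $ k) - z * cnj ((conj_transpose X *v (Q *v W)) $ k)"
  let ?w' = "\<lambda>z. \<chi> j. ((cvec b - a - cnj_vec a) $ j + cnj (a $ j) * (z + 1)) / 2"
  have w: "lift_w X K W z = (z - 1) *s ?w z" for z
    by (simp add: lift_w_def vec_eq_iff algebra_simps)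
  have h': "lift_h' X Q W z = (z - 1) *s ?h' z" for z
    unfolding lift_h'_def vec_eq_iff vector_smult_component vec_lambda_beta by blast
  have w': "lift_w' b a z = (1/2) *s cvec b + (z - 1) *s ?w' z" for z
    by (simp add: lift_w'_def vec_eq_iff cnj_vec_def power2_eq_square field_simps)
  have "((\<lambda>z. (1/2) *s cvec b + (z - 1) *s ?w' z) has_derivative (\<lambda>h. 0 + h *s ?w' 1)) (at 1 within cball 0 1)"
    unfolding vec_lambda_beta
    by (intro has_derivative_add has_derivative_const has_derivative_vec_factor)
      (simp, intro disc_algebra_intros disc_algebra_divide; simp)
  moreover have "((\<lambda>z. (z - 1) *s ?h' z) has_derivative (\<lambda>h. h *s ?h' 1)) (at 1 within cball 0 1)"
    by (intro has_derivative_vec_factor) (simp, intro disc_algebra_intros)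
  moreover have "((\<lambda>z. (z - 1) *s ?w z) has_derivative (\<lambda>h. h *s ?w 1)) (at 1 within cball 0 1)"
  proof (intro has_derivative_vec_factor)
    show "disc_algebra (\<lambda>z. ?w z $ j)" for j
      unfolding vec_lambda_beta
      by (intro disc_algebra_intros disc_algebra_cinner disc_algebra_matrix_vector disc_algebra_resolvent_const X)
  qed
  moreover have "((\<lambda>z. lift_h X W z) has_derivative (\<lambda>h. h *s resolvent X 1 W)) (at 1 within cball 0 1)"
    unfolding lift_h_def by (intro has_derivative_vec_factor disc_algebra_resolvent_const X)
  ultimately show "((\<lambda>z. ((lift_h X W z, lift_w X K W z), lift_h' X Q W z, lift_w' b a z)) has_derivative (\<lambda>h.
      ((h *s resolvent X 1 W,
        h *s (\<chi> j. - 2 * cinner W (K j *v ((mat 1 - X) *v resolvent X 1 W)))),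
       (h *s (\<chi> k. cnj ((Q *v W) $ k) - cnj ((conj_transpose X *v (Q *v W)) $ k)),
        h *s (\<chi> j. ((cvec b - a - cnj_vec a) $ j + 2 * cnj (a $ j)) / 2))))) (at 1 within cball 0 1)"
    unfolding w h' w' by (intro has_derivative_Pair) (simp_all add: mult.commute)
qed

section \<open>Lifts with given parameters\<close>

lemma resolvent_one:
  assumes "disc_regular X"
  shows "resolvent X 1 ((mat 1 - X) *v V) = V"
proof -
  have "V - 1 *s (X *v V) = (mat 1 - X) *v V" by (simp add: matrix_vector_mult_diff_rdistrib)
  then show ?thesis using resolvent_iff[OF assms one_in_cball(1)] by metis
qed

lemma explicit_lift_in_S0:
  fixes A :: "'d::finite \<Rightarrow> complex^'n^'n"
  assumes herm: "\<And>j. hermitian (A j)" and inv: "invertible (pencil A (cvec b))"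
    and X: "X_solution A b a X" and K: "\<And>j. stein X (K j) = A j" and V: "V \<noteq> 0"
  defines "F \<equiv> explicit_lift b a X (factor_mat A b a X) K ((mat 1 - X) *v V)"
  shows "F \<in> S0 A b" "parametrized_by F (a, V)"
proof -
  let ?Q = "factor_mat A b a X" and ?W = "(mat 1 - X) *v V"
  have N: "onorm ((*v) X) < 1" using X by (simp add: X_solution_def)
  have X': "disc_regular X" by (rule disc_regular_onorm[OF N])
  have Kh: "conj_transpose (K j) = K j" for j by (rule stein_hermitian[OF N K herm])
  have ext: "F \<in> extensional (cball 0 1)" by (simp add: F_def explicit_lift_def)
  have lift: "stationary_lift A (\<lambda>\<zeta>. fst (F \<zeta>)) (\<lambda>\<zeta>. snd (F \<zeta>))"
    unfolding stationary_lift_def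
  proof (intro conjI exI[of _ "real_multiplier b a"] ballI)
    show "analytic_disc (\<lambda>\<zeta>. fst (F \<zeta>))" "analytic_disc (\<lambda>\<zeta>. snd (F \<zeta>))"
      unfolding analytic_disc_iff
      by (intro conjI allI disc_algebra_cong[OF disc_algebra_lift(1)[OF X', of ?W]]
           disc_algebra_cong[OF disc_algebra_lift(2)[OF X', of K ?W]]
           disc_algebra_cong[OF disc_algebra_lift(3)[OF X', of ?Q ?W]]
           disc_algebra_cong[OF disc_algebra_lift(4)[OF X', of b a]];
          simp add: F_def explicit_lift_at)+
    show "(\<lambda>\<zeta>. fst (F \<zeta>)) ` sphere 0 1 \<subseteq> quadric A"
    proof (rule image_subsetI)
      fix \<zeta> :: complex assume \<zeta>: "\<zeta> \<in> sphere 0 1"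
      then have "\<zeta> \<in> cball 0 1" by auto
      then show "fst (F \<zeta>) \<in> quadric A"
        using lift_on_quadric[where K = K and A = A, OF X' K Kh \<zeta>] by (simp add: F_def explicit_lift_at in_quadric_iff)
    qed
    fix \<zeta> :: complex assume \<zeta>: "\<zeta> \<in> sphere 0 1"
    then have \<zeta>': "\<zeta> \<in> cball 0 1" by auto
    show "(\<Sum>j\<in>UNIV. (real_multiplier b a \<zeta> $ j) *\<^sub>R del (defining_fun A j) 0) \<noteq> 0"
      unfolding conormal_sum[OF herm] cvec_real_multiplier
      using multiplier_nonzero[OF herm X inv \<zeta>] by (auto simp: zero_prod_def vec_eq_iff)
    show "snd (F \<zeta>) = cscale \<zeta> (\<Sum>j\<in>UNIV. (real_multiplier b a \<zeta> $ j) *\<^sub>R del (defining_fun A j) (fst (F \<zeta>)))"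
      using lift_conormal[OF herm X \<zeta>] by (simp add: F_def explicit_lift_at[OF \<zeta>'])
  qed
  have res: "resolvent X 1 ?W = V" by (rule resolvent_one[OF X'])
  have W0: "?W \<noteq> 0"
  proof
    assume "?W = 0"
    then have "V - 1 *s (X *v V) = 0" by (simp add: matrix_vector_mult_diff_rdistrib)
    then have "V = resolvent X 1 0" using resolvent_iff[OF X' one_in_cball(1)] by blast
    moreover have "resolvent X 1 0 = 0" by (simp add: resolvent_def)
    ultimately show False using V by simp
  qed
  have "\<not> (\<lambda>\<zeta>. fst (F \<zeta>)) constant_on cball 0 1"
  proof
    assume "(\<lambda>\<zeta>. fst (F \<zeta>)) constant_on cball 0 1"
    then have "fst (F 0) = fst (F 1)" unfolding constant_on_def using one_in_cball by metis
    then have "resolvent X 0 ?W = 0"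
      by (simp add: F_def explicit_lift_at lift_h_def vec_eq_iff)
    then show False using resolvent_eq[OF X' one_in_cball(2), of ?W] W0 by simp
  qed
  then show "F \<in> S0 A b"
    unfolding S0_def using ext lift explicit_lift_one by (auto simp: F_def)
  have "(F has_derivative (\<lambda>h.
      ((h *s V, h *s (\<chi> j. - 2 * cinner ?W (K j *v ((mat 1 - X) *v V)))),
       (h *s (\<chi> k. cnj ((?Q *v ?W) $ k) - cnj ((conj_transpose X *v (?Q *v ?W)) $ k)),
        h *s (\<chi> j. ((cvec b - a - cnj_vec a) $ j + 2 * cnj (a $ j)) / 2))))) (at 1 within cball 0 1)"
    using explicit_lift_has_derivative[OF X', of b a ?Q K ?W] unfolding res F_def .
  from has_derivative_fst[OF has_derivative_fst[OF this]]
  show "parametrized_by F (a, V)"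
    by (simp add: parametrized_by_def F_def explicit_lift_at lift_w'_def vec_eq_iff)
qed

text \<open>
  The component \<open>w~\<close> is quadratic because \<open>w~ / \<zeta>\<close> is real on the circle. For \<open>h\<close>, put \<open>u = (I - \<zeta> X) h\<close>: the
  factorization of the multiplier shows that \<open>\<zeta> cnj (Q u)\<close> extends holomorphically, namely as the resolvent
  of the transpose of \<open>X\<close> applied to \<open>- h~\<close>. Hence \<open>u\<close> is affine, \<open>u = (1 - \<zeta>) u(0)\<close>, and \<open>u(0)\<close> is read off from
  \<open>h'(1) = V\<close>. Then \<open>w\<close> and \<open>h~\<close> are determined by their boundary values.
\<close>

theorem lift_is_explicit:
  fixes A :: "'d::finite \<Rightarrow> complex^'n^'n"
  assumes herm: "\<And>j. hermitian (A j)" and inv: "invertible (pencil A (cvec b))"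
    and X: "X_solution A b a X" and K: "\<And>j. stein X (K j) = A j"
    and F: "F \<in> S0 A b" and par: "parametrized_by F (a, V)"
  shows "F = explicit_lift b a X (factor_mat A b a X) K ((mat 1 - X) *v V)"
proof -
  let ?Q = "factor_mat A b a X" and ?W = "(mat 1 - X) *v V"
  have N: "onorm ((*v) X) < 1" using X by (simp add: X_solution_def)
  have X': "disc_regular X" by (rule disc_regular_onorm[OF N])
  have Kh: "conj_transpose (K j) = K j" for j by (rule stein_hermitian[OF N K herm])
  define h where "h = (\<lambda>\<zeta>. fst (fst (F \<zeta>)))"
  define w where "w = (\<lambda>\<zeta>. snd (fst (F \<zeta>)))"
  define g1 where "g1 = (\<lambda>\<zeta>. fst (snd (F \<zeta>)))"
  define g2 where "g2 = (\<lambda>\<zeta>. snd (snd (F \<zeta>)))"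
  have ext: "F \<in> extensional (cball 0 1)" and lift: "stationary_lift A (\<lambda>\<zeta>. fst (F \<zeta>)) (\<lambda>\<zeta>. snd (F \<zeta>))"
    and F1: "F 1 = ((0, 0), (0, (1/2) *s cvec b))"
    using F by (auto simp: S0_def)
  have at1: "h 1 = 0" "w 1 = 0" "g2 1 = (1/2) *s cvec b"
    by (simp_all add: h_def w_def g2_def F1)
  have a: "a = 2 *s g2 0" and hd: "(h has_derivative (\<lambda>u. u *s V)) (at 1 within cball 0 1)"
    using par by (simp_all add: parametrized_by_def g2_def h_def)
  have da: "disc_algebra (\<lambda>\<zeta>. h \<zeta> $ k)" "disc_algebra (\<lambda>\<zeta>. w \<zeta> $ j)"
    "disc_algebra (\<lambda>\<zeta>. g1 \<zeta> $ k)" "disc_algebra (\<lambda>\<zeta>. g2 \<zeta> $ j)" for j k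
    using lift by (simp_all add: stationary_lift_def analytic_disc_iff h_def w_def g1_def g2_def)
  have onM: "Re (w \<zeta> $ j) = Re (cinner (h \<zeta>) (A j *v h \<zeta>))" if "\<zeta> \<in> sphere 0 1" for \<zeta> j
  proof -
    have "fst (F \<zeta>) \<in> quadric A" using lift that unfolding stationary_lift_def by blast
    then show ?thesis by (simp add: in_quadric_iff h_def w_def)
  qed
  obtain c where c: "\<And>\<zeta>. \<zeta> \<in> sphere 0 1 \<Longrightarrow>
      snd (F \<zeta>) = cscale \<zeta> (\<Sum>j\<in>UNIV. (c \<zeta> $ j) *\<^sub>R del (defining_fun A j) (fst (F \<zeta>)))"
    using lift unfolding stationary_lift_def by blast
  have g: "g1 \<zeta> $ k = - (\<zeta> * cnj ((pencil A (cvec (c \<zeta>)) *v h \<zeta>) $ k))" "g2 \<zeta> $ j = \<zeta> * (complex_of_real (c \<zeta> $ j) / 2)"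
    if "\<zeta> \<in> sphere 0 1" for \<zeta> j k
    using c[OF that] unfolding conormal_sum[OF herm]
    by (simp_all add: g1_def g2_def h_def cscale_def cvec_def)
  \<comment> \<open>The multipliers \<open>c\<close> are real, which determines \<open>w~\<close> and then \<open>c\<close> itself.\<close>
  have g2: "g2 \<zeta> = lift_w' b a \<zeta>" if \<zeta>: "\<zeta> \<in> cball 0 1" for \<zeta>
  proof -
    have "g2 \<zeta> $ j = g2 0 $ j + (g2 1 $ j - g2 0 $ j - cnj (g2 0 $ j)) * \<zeta> + cnj (g2 0 $ j) * \<zeta>\<^sup>2" for j
    proof (rule disc_algebra_quadratic[OF da(4) _ \<zeta>])
      fix z :: complex assume z: "z \<in> sphere 0 1"
      have "cnj z * g2 z $ j = complex_of_real (c z $ j) / 2"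
        unfolding g(2)[OF z] using sphere_cnj(1)[OF z] by (simp flip: mult.assoc)
      moreover have "Im (complex_of_real (c z $ j) / 2) = 0" by simp
      ultimately show "Im (cnj z * g2 z $ j) = 0" by (simp only:)
    qed
    then show ?thesis
      unfolding vec_eq_iff lift_w'_def a at1(3) by (simp add: cnj_vec_def field_simps)
  qed
  have cm: "cvec (c \<zeta>) = multiplier b a \<zeta>" if \<zeta>: "\<zeta> \<in> sphere 0 1" for \<zeta>
  proof -
    have "cvec (c \<zeta>) $ j = multiplier b a \<zeta> $ j" for j
    proof -
      have n: "cnj \<zeta> * \<zeta> = 1" "cnj \<zeta> * (\<zeta> * x) = x" for x
        using sphere_cnj[OF \<zeta>] by (simp_all flip: mult.assoc)
      have "\<zeta> \<in> cball 0 1" using \<zeta> by auto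
      note g2 = g2[OF this]
      have half: "2 * (x / 2) = x" for x :: complex by simp
      have "\<zeta> * complex_of_real (c \<zeta> $ j) = 2 * g2 \<zeta> $ j" unfolding g(2)[OF \<zeta>] by simp
      also have "\<dots> = a $ j + (cvec b - a - cnj_vec a) $ j * \<zeta> + cnj (a $ j) * \<zeta>\<^sup>2"
        unfolding g2 lift_w'_def vec_lambda_beta by (rule half)
      finally have "\<zeta> * complex_of_real (c \<zeta> $ j) =
          a $ j + (cvec b - a - cnj_vec a) $ j * \<zeta> + cnj (a $ j) * \<zeta>\<^sup>2" .
      then have "cnj \<zeta> * (\<zeta> * complex_of_real (c \<zeta> $ j)) =
          cnj \<zeta> * (a $ j + (cvec b - a - cnj_vec a) $ j * \<zeta> + cnj (a $ j) * \<zeta>\<^sup>2)" by simp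
      then have "complex_of_real (c \<zeta> $ j) = cnj \<zeta> * (a $ j + (cvec b - a - cnj_vec a) $ j * \<zeta> + cnj (a $ j) * \<zeta>\<^sup>2)"
        unfolding n .
      also have "\<dots> = cnj \<zeta> * a $ j + (cvec b - a - cnj_vec a) $ j + cnj (a $ j) * \<zeta>"
      proof -
        have "cnj \<zeta> * (x + y * \<zeta> + z * \<zeta>\<^sup>2) = cnj \<zeta> * x + (cnj \<zeta> * \<zeta>) * y + (cnj \<zeta> * \<zeta>) * (z * \<zeta>)" for x y z
          by (simp add: algebra_simps power2_eq_square)
        then show ?thesis unfolding n by simp
      qed
      finally show ?thesis by (simp add: multiplier_def cvec_def cnj_vec_def mult.commute)
    qed
    then show ?thesis by (simp add: vec_eq_iff)
  qed
  \<comment> \<open>\<open>m\<close> is the holomorphic extension of \<open>\<zeta> cnj (Q u)\<close> from the circle.\<close>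
  define u where "u = (\<lambda>\<zeta>. h \<zeta> - \<zeta> *s (X *v h \<zeta>))"
  have u: "disc_algebra (\<lambda>\<zeta>. u \<zeta> $ k)" for k
    unfolding u_def vector_minus_component vector_smult_component
    by (intro disc_algebra_intros disc_algebra_matrix_vector da)
  have Qu: "disc_algebra (\<lambda>\<zeta>. (?Q *v u \<zeta>) $ k)" for k
    by (intro disc_algebra_matrix_vector u)
  define m where "m = (\<lambda>\<zeta>. resolvent (transpose X) \<zeta> (- g1 \<zeta>))"
  have m: "disc_algebra (\<lambda>\<zeta>. m \<zeta> $ k)" for k
    unfolding m_def by (intro disc_algebra_resolvent disc_regular_transpose X')
      (simp add: disc_algebra_minus da)
  have mQ: "m \<zeta> $ k = \<zeta> * cnj ((?Q *v u \<zeta>) $ k)" if \<zeta>: "\<zeta> \<in> sphere 0 1" for \<zeta> k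
  proof -
    define y where "y = \<zeta> *s cnj_vec (?Q *v u \<zeta>)"
    have \<zeta>': "\<zeta> \<in> cball 0 1" using \<zeta> by auto
    have "pencil A (cvec (c \<zeta>)) *v h \<zeta> = ?Q *v u \<zeta> - cnj \<zeta> *s (conj_transpose X *v (?Q *v u \<zeta>))"
      unfolding cm[OF \<zeta>] by (rule multiplier_factorization[OF herm X \<zeta>]) (simp add: u_def)
    then have g1: "- g1 \<zeta> $ i = \<zeta> * cnj ((?Q *v u \<zeta>) $ i) - \<zeta> * (\<zeta> * cnj ((conj_transpose X *v (?Q *v u \<zeta>)) $ i))" for i
      unfolding vector_uminus_component g(1)[OF \<zeta>] by (simp add: right_diff_distrib)
    have "(transpose X *v cnj_vec v) $ i = cnj ((conj_transpose X *v v) $ i)" for v i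
      by (simp add: matrix_vector_component transpose_def cnj_vec_def conj_transpose_component del: transpose_matrix_vector)
    then have "y - \<zeta> *s (transpose X *v y) = - g1 \<zeta>"
      unfolding y_def matrix_vector_smult vec_eq_iff
      by (simp add: g1 cnj_vec_def del: transpose_matrix_vector)
    then have "y = m \<zeta>"
      unfolding m_def using resolvent_iff[OF disc_regular_transpose[OF X'] \<zeta>'] by blast
    then show ?thesis by (simp add: y_def cnj_vec_def flip: \<open>y = m \<zeta>\<close>)
  qed
  have u1: "u 1 = 0" by (simp add: u_def at1)
  have hu: "h \<zeta> = lift_h X (- u 0) \<zeta>" if \<zeta>: "\<zeta> \<in> cball 0 1" for \<zeta>
  proof -
    have "(?Q *v u \<zeta>) $ k = (?Q *v ((1 - \<zeta>) *s u 0)) $ k" for k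
      using disc_algebra_affine[OF Qu m mQ \<zeta>, of k]
      unfolding u1 matrix_vector_smult by (simp add: algebra_simps)
    then have "?Q *v (u \<zeta> - (1 - \<zeta>) *s u 0) = 0"
      by (simp add: matrix_vector_mult_diff_distrib vec_eq_iff)
    then have "u \<zeta> - (1 - \<zeta>) *s u 0 = 0"
      using invertible_factor_mat[OF herm X inv] matrix_left_invertible_ker[of ?Q] invertible_left_inverse
      by blast
    then have "h \<zeta> - \<zeta> *s (X *v h \<zeta>) = (\<zeta> - 1) *s (- u 0)"
      by (simp add: u_def vec_eq_iff algebra_simps)
    also have "\<dots> = lift_h X (- u 0) \<zeta> - \<zeta> *s (X *v lift_h X (- u 0) \<zeta>)"
    proof -
      have "lift_h X (- u 0) \<zeta> - \<zeta> *s (X *v lift_h X (- u 0) \<zeta>) =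
          (\<zeta> - 1) *s (resolvent X \<zeta> (- u 0) - \<zeta> *s (X *v resolvent X \<zeta> (- u 0)))"
        by (simp add: lift_h_def matrix_vector_smult vec_eq_iff algebra_simps)
      then show ?thesis unfolding resolvent_eq[OF X' \<zeta>] by simp
    qed
    finally show ?thesis using resolvent_iff[OF X' \<zeta>] by metis
  qed
  have "(lift_h X (- u 0) has_derivative (\<lambda>v. v *s resolvent X 1 (- u 0))) (at 1 within cball 0 1)"
    unfolding lift_h_def[abs_def] by (intro has_derivative_vec_factor disc_algebra_resolvent_const X')
  from has_derivative_transform[OF one_in_cball(1) hu this]
  have "(h has_derivative (\<lambda>v. v *s resolvent X 1 (- u 0))) (at 1 within cball 0 1)" by simp
  from derivative_at_one_unique[OF hd this] have "V = resolvent X 1 (- u 0)" .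
  then have "V - 1 *s (X *v V) = - u 0" using resolvent_iff[OF X' one_in_cball(1)] by blast
  then have W: "- u 0 = ?W" by (simp add: matrix_vector_mult_diff_rdistrib)
  have h: "h \<zeta> = lift_h X ?W \<zeta>" if "\<zeta> \<in> cball 0 1" for \<zeta>
    using hu[OF that] unfolding W .
  \<comment> \<open>The real parts agree on the circle; the factor \<open>\<i>\<close> turns this into a vanishing imaginary part.\<close>
  have w: "w \<zeta> = lift_w X K ?W \<zeta>" if \<zeta>: "\<zeta> \<in> cball 0 1" for \<zeta>
  proof -
    have "\<i> * (w \<zeta> $ j - lift_w X K ?W \<zeta> $ j) = \<i> * (w 1 $ j - lift_w X K ?W 1 $ j)" for j
    proof (rule disc_algebra_real_on_circle[OF _ _ \<zeta>])
      show "disc_algebra (\<lambda>\<zeta>. \<i> * (w \<zeta> $ j - lift_w X K ?W \<zeta> $ j))"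
        by (intro disc_algebra_intros da disc_algebra_lift X')
      fix z :: complex assume z: "z \<in> sphere 0 1"
      then have "z \<in> cball 0 1" by auto
      then show "Im (\<i> * (w z $ j - lift_w X K ?W z $ j)) = 0"
        using onM[OF z] lift_on_quadric[where K = K and A = A, OF X' K Kh z] h by simp
    qed
    then show ?thesis by (simp add: vec_eq_iff at1 lift_w_def)
  qed
  have g1: "g1 \<zeta> = lift_h' X ?Q ?W \<zeta>" if \<zeta>: "\<zeta> \<in> cball 0 1" for \<zeta>
  proof -
    have "g1 \<zeta> $ k = lift_h' X ?Q ?W \<zeta> $ k" for k
    proof (rule disc_algebra_eqI[OF da(3) disc_algebra_lift(3)[OF X'] _ \<zeta>])
      fix z :: complex assume z: "z \<in> sphere 0 1"
      then have z': "z \<in> cball 0 1" by auto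
      have "(lift_h' X ?Q ?W z, lift_w' b a z) =
          ((\<chi> k. - (z * cnj ((pencil A (multiplier b a z) *v h z) $ k))), z *s ((1/2) *s multiplier b a z))"
        unfolding lift_conormal[OF herm X z, of ?W undefined] conormal_sum[OF herm] cvec_real_multiplier
        by (simp add: cscale_def h[OF z'] vec_eq_iff)
      then show "g1 z $ k = lift_h' X ?Q ?W z $ k"
        unfolding g(1)[OF z] cm[OF z] by simp
    qed
    then show ?thesis by (simp add: vec_eq_iff)
  qed
  have "F \<zeta> = explicit_lift b a X ?Q K ?W \<zeta>" if "\<zeta> \<in> cball 0 1" for \<zeta>
  proof -
    have "F \<zeta> = ((h \<zeta>, w \<zeta>), (g1 \<zeta>, g2 \<zeta>))" by (simp add: h_def w_def g1_def g2_def)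
    then show ?thesis using h[OF that] w[OF that] g1[OF that] g2[OF that] by (simp add: explicit_lift_at[OF that])
  qed
  then show ?thesis
    using ext by (intro extensionalityI[of _ "cball 0 1"]) (auto simp: explicit_lift_def)
qed

lemma explicit_lift_has_jet:
  fixes A :: "'d::finite \<Rightarrow> complex^'n^'n"
  assumes herm: "\<And>j. hermitian (A j)" and X: "X_solution A b a (X_mat A b a)"
    and K: "\<And>j. stein (X_mat A b a) (K_mat A b a j) = A j"
  defines "X0 \<equiv> X_mat A b a"
  shows "has_jet (explicit_lift b a X0 (factor_mat A b a X0) (K_mat A b a) ((mat 1 - X0) *v V))
    (jet_embedding A b (jet1 A b (a, V)))"
proof -
  let ?Q = "factor_mat A b a X0" and ?W = "(mat 1 - X0) *v V" and ?K = "K_mat A b a"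
  note X = X[folded X0_def] and K = K[folded X0_def]
  have N: "onorm ((*v) X0) < 1" using X by (simp add: X_solution_def)
  have X': "disc_regular X0" by (rule disc_regular_onorm[OF N])
  have Kh: "conj_transpose (?K j) = ?K j" for j by (rule stein_hermitian[OF N K herm])
  have 1: "- 2 * cinner ?W (?K j *v ((mat 1 - X0) *v V)) =
     - 2 * complex_of_real (Re (cinner V (((mat 1 - conj_transpose X0) ** ?K j ** (mat 1 - X0)) *v V)))" for j
  proof -
    have "cinner V (((mat 1 - conj_transpose X0) ** ?K j ** (mat 1 - X0)) *v V) = cinner ?W (?K j *v ?W)"
      using cinner_adjoint[of V "mat 1 - conj_transpose X0" "?K j *v ?W"]
      by (simp add: matrix_vector_mul_assoc matrix_mul_assoc)
    moreover have "Im (cinner ?W (?K j *v ?W)) = 0"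
      using cinner_hermitian_swap[OF Kh, of ?W j ?W] by (simp add: complex_eq_iff)
    ultimately show ?thesis by (simp add: complex_eq_iff)
  qed
  have 2: "cnj ((?Q *v ?W) $ k) - cnj ((conj_transpose X0 *v (?Q *v ?W)) $ k) =
      (\<Sum>i\<in>UNIV. cnj (V $ i) * pencil A (cvec b) $ i $ k)" for k
  proof -
    have "?Q *v ?W - conj_transpose X0 *v (?Q *v ?W) = pencil A (cvec b) *v V"
      unfolding factorization(5)[OF herm X]
      by (simp add: matrix_vector_mult_diff_rdistrib matrix_vector_mul_assoc[symmetric])
    then have "cnj ((?Q *v ?W) $ k) - cnj ((conj_transpose X0 *v (?Q *v ?W)) $ k) = cnj ((pencil A (cvec b) *v V) $ k)"
      by (metis complex_cnj_diff vector_minus_component)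
    also have "\<dots> = (\<Sum>i\<in>UNIV. cnj (V $ i) * conj_transpose (pencil A (cvec b)) $ i $ k)"
      by (simp add: matrix_vector_component conj_transpose_component mult.commute)
    finally show ?thesis unfolding hermitian_pencil_cvec[OF herm] .
  qed
  have 3: "((cvec b - a - cnj_vec a) $ j + 2 * cnj (a $ j)) / 2 = ((1/2) *s cvec b - \<i> *s cvec (\<chi> j. Im (a $ j))) $ j" for j
    by (simp add: cnj_vec_def cvec_def complex_eq_iff)
  have embed: "(\<chi> j. - 2 * complex_of_real (f j)) = (- 2) *s cvec (\<chi> j. f j)" for f :: "'d \<Rightarrow> real"
    by (simp add: vec_eq_iff cvec_def)
  show ?thesis
    unfolding has_jet_def
    by (rule has_derivative_eq_rhs[OF explicit_lift_has_derivative[OF X']])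
      (simp only: resolvent_one[OF X'] jet_embedding_def jet1_def cscale_def 1 2 3 X0_def[symmetric]
        prod.case fst_conv snd_conv vec_nth_inverse embed)
qed


section \<open>The derivative of the jet map\<close>

lemma jet1_eq:
  "jet1 A b (a, V) = (V,
     (\<chi> j. Re (cinner (V - X_mat A b a *v V) (K_mat A b a j *v (V - X_mat A b a *v V)))),
     (\<chi> j. Im (a $ j)))"
proof -
  let ?X = "X_mat A b a"
  have W: "(mat 1 - ?X) *v V = V - ?X *v V" by (simp add: matrix_vector_mult_diff_rdistrib)
  have "cinner V (((mat 1 - conj_transpose ?X) ** K_mat A b a j ** (mat 1 - ?X)) *v V) =
      cinner (V - ?X *v V) (K_mat A b a j *v (V - ?X *v V))" for j
    using cinner_adjoint[of V "mat 1 - conj_transpose ?X" "K_mat A b a j *v ((mat 1 - ?X) *v V)"]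
    by (simp add: matrix_vector_mul_assoc[symmetric] W)
  then show ?thesis by (simp add: jet1_def)
qed

lemma smooth_on_jet1:
  fixes A :: "'d::finite \<Rightarrow> complex^'n^'n"
  assumes O: "open T" and X: "smooth_on (X_mat A b) T" and K: "\<And>j. smooth_on (\<lambda>a. K_mat A b a j) T"
  shows "smooth_on (jet1 A b) (T \<times> UNIV)"
proof -
  let ?U = "T \<times> (UNIV :: (complex^'n) set)"
  have U: "open ?U" using O by (simp add: open_Times)
  have fst: "smooth_on fst ?U" and snd: "smooth_on snd ?U"
    by (auto intro: smooth_on_bounded_linear bounded_linear_fst bounded_linear_snd)
  have X': "smooth_on (\<lambda>p. X_mat A b (fst p)) ?U"
    by (rule smooth_on_compose[OF U O X fst]) auto
  have K': "smooth_on (\<lambda>p. K_mat A b (fst p) j) ?U" for j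
    by (rule smooth_on_compose[OF U O K fst]) auto
  have W: "smooth_on (\<lambda>p. snd p - X_mat A b (fst p) *v snd p) ?U"
    by (intro smooth_on_diff[OF U] snd smooth_on_bilinear[OF U bounded_bilinear_matrix_vector] X')
  have q: "smooth_on (\<lambda>p. Re (cinner (snd p - X_mat A b (fst p) *v snd p)
      (K_mat A b (fst p) j *v (snd p - X_mat A b (fst p) *v snd p)))) ?U" for j
    by (intro smooth_on_linear_compose[OF U bounded_linear_Re] smooth_on_bilinear[OF U bounded_bilinear_cinner]
        smooth_on_bilinear[OF U bounded_bilinear_matrix_vector] W K')
  have y: "smooth_on (\<lambda>p. Im (fst p $ j)) ?U" for j
    by (intro smooth_on_linear_compose[OF U bounded_linear_Im]
        smooth_on_linear_compose[OF U bounded_linear_vec_nth] fst)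
  have "jet1 A b = (\<lambda>p. (snd p,
     (\<chi> j. Re (cinner (snd p - X_mat A b (fst p) *v snd p)
        (K_mat A b (fst p) j *v (snd p - X_mat A b (fst p) *v snd p)))),
     (\<chi> j. Im (fst p $ j))))"
    by (rule ext) (metis jet1_eq prod.collapse)
  moreover have "smooth_on (\<lambda>p. \<chi> j. Re (cinner (snd p - X_mat A b (fst p) *v snd p)
        (K_mat A b (fst p) j *v (snd p - X_mat A b (fst p) *v snd p)))) ?U"
    by (rule smooth_on_componentwise[OF U]) (simp add: q)
  moreover have "smooth_on (\<lambda>p :: (complex^'d) \<times> (complex^'n). \<chi> j. Im (fst p $ j)) ?U"
    by (rule smooth_on_componentwise[OF U]) (simp add: y)
  ultimately show ?thesis
    by (simp only:) (intro smooth_on_Pair[OF U] snd)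
qed

text \<open>
  The linearized system along a real direction \<open>t\<close> of \<open>a\<close>: the unknowns \<open>Y\<close> and \<open>L\<close> stand for the derivatives
  of \<open>X\<close> and \<open>K\<close>, determined by differentiating the Riccati and Stein equations, and the last
  condition says that the derivative of the middle component of the jet map vanishes. Directions \<open>dV\<close> and
  \<open>Im da\<close> are seen directly by the jet map, so only real \<open>t\<close> matters.
\<close>

definition jet1_injective_at where
  "jet1_injective_at A b a V \<longleftrightarrow> (\<forall>t Y L.
     (let H = pencil A (cvec t); X = X_mat A b a; K = K_mat A b a; P = pencil A a; W = V - X *v V in
       H ** X ** X + P ** Y ** X + P ** X ** Y - H ** X - H ** X + shifted_pencil A b a ** Y + H = 0 \<longrightarrow>
       (\<forall>j. L j - conj_transpose Y ** K j ** X - conj_transpose X ** L j ** X - conj_transpose X ** K j ** Y = 0) \<longrightarrow>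
       (\<forall>j. Re (cinner W (L j *v W - K j *v (Y *v V)) - cinner (Y *v V) (K j *v W)) = 0) \<longrightarrow> t = 0))"

lemma locally_constant_derivative_zero:
  assumes "open T" "a \<in> T" "\<And>x. x \<in> T \<Longrightarrow> f x = c" "(f has_derivative f') (at a)"
  shows "f' h = 0"
proof -
  have "((\<lambda>x. c) has_derivative f') (at a)"
    using has_derivative_transform_within_open[OF assms(4,1,2)] assms(3) by simp
  then have "f' = (\<lambda>h. 0)" using has_derivative_unique has_derivative_const by blast
  then show ?thesis by simp
qed

lemma frechet_derivative_jet1_injective:
  fixes A :: "'d::finite \<Rightarrow> complex^'n^'n"
  assumes herm: "\<And>j. hermitian (A j)"
    and O: "open T" "a \<in> T" and X: "smooth_on (X_mat A b) T" and K: "\<And>j. smooth_on (\<lambda>a. K_mat A b a j) T"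
    and ric: "\<And>a. a \<in> T \<Longrightarrow> riccati A b a (X_mat A b a) = 0"
    and st: "\<And>a j. a \<in> T \<Longrightarrow> stein (X_mat A b a) (K_mat A b a j) = A j"
    and inj: "jet1_injective_at A b a V"
    and zero: "frechet_derivative (jet1 A b) (at (a, V)) h = 0"
  shows "h = 0"
proof -
  define X' where "X' = frechet_derivative (X_mat A b) (at a)"
  define K' where "K' = (\<lambda>j. frechet_derivative (\<lambda>a. K_mat A b a j) (at a))"
  have Xd: "(X_mat A b has_derivative X') (at a)"
    unfolding X'_def by (rule smooth_on_has_derivative[OF X O(2)])
  have Kd: "((\<lambda>a. K_mat A b a j) has_derivative K' j) (at a)" for j
    unfolding K'_def by (rule smooth_on_has_derivative[OF K O(2)])
  let ?W = "V - X_mat A b a *v V" and ?X = "X_mat A b a" and ?K = "K_mat A b a"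
  have fp: "(fst has_derivative fst) (at (a, V))"
    using has_derivative_fst[OF has_derivative_ident] .
  have Xp: "((\<lambda>p. X_mat A b (fst p)) has_derivative (\<lambda>h. X' (fst h))) (at (a, V))"
    using has_derivative_compose[OF fp, of "X_mat A b" X'] Xd by simp
  have Kp: "((\<lambda>p. K_mat A b (fst p) j) has_derivative (\<lambda>h. K' j (fst h))) (at (a, V))" for j
    using has_derivative_compose[OF fp, of "\<lambda>a. K_mat A b a j" "K' j"] Kd by simp
  have sp: "(snd has_derivative snd) (at (a, V))"
    using has_derivative_snd[OF has_derivative_ident] .
  have Wp: "((\<lambda>p. snd p - X_mat A b (fst p) *v snd p) has_derivative
      (\<lambda>h. snd h - (?X *v snd h + X' (fst h) *v V))) (at (a, V))"
    using has_derivative_diff[OF sp bounded_bilinear.FDERIV[OF bounded_bilinear_matrix_vector Xp sp]] by simp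
  define W' where "W' = (\<lambda>h :: (complex^'d) \<times> (complex^'n). snd h - (?X *v snd h + X' (fst h) *v V))"
  have qp: "((\<lambda>p. Re (cinner (snd p - X_mat A b (fst p) *v snd p)
        (K_mat A b (fst p) j *v (snd p - X_mat A b (fst p) *v snd p)))) has_derivative
      (\<lambda>h. Re (cinner ?W (?K j *v W' h + K' j (fst h) *v ?W) + cinner (W' h) (?K j *v ?W)))) (at (a, V))" for j
    using bounded_linear.has_derivative[OF bounded_linear_Re bounded_bilinear.FDERIV[OF bounded_bilinear_cinner
        Wp[folded W'_def] bounded_bilinear.FDERIV[OF bounded_bilinear_matrix_vector Kp[of j] Wp[folded W'_def]]]]
    by simp
  have yp: "((\<lambda>p. Im (fst p $ j)) has_derivative (\<lambda>h. Im (fst h $ j))) (at (a, V))" for j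
    by (intro bounded_linear.has_derivative[OF bounded_linear_Im] bounded_linear.has_derivative[OF bounded_linear_vec_nth]
        has_derivative_fst has_derivative_ident)
  let ?D = "\<lambda>h. (snd h, (\<chi> j. Re (cinner ?W (?K j *v W' h + K' j (fst h) *v ?W) + cinner (W' h) (?K j *v ?W))),
      (\<chi> j. Im (fst h $ j)))"
  have "jet1 A b = (\<lambda>p. (snd p,
     (\<chi> j. Re (cinner (snd p - X_mat A b (fst p) *v snd p)
        (K_mat A b (fst p) j *v (snd p - X_mat A b (fst p) *v snd p)))),
     (\<chi> j. Im (fst p $ j))))"
    by (rule ext) (metis jet1_eq prod.collapse)
  moreover have "((\<lambda>p. (snd p,
     (\<chi> j. Re (cinner (snd p - X_mat A b (fst p) *v snd p)
        (K_mat A b (fst p) j *v (snd p - X_mat A b (fst p) *v snd p)))),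
     (\<chi> j. Im (fst p $ j)))) has_derivative ?D) (at (a, V))"
    by (rule has_derivative_Pair[OF sp has_derivative_Pair[OF has_derivative_componentwise has_derivative_componentwise]])
      (simp_all only: vec_lambda_beta qp yp)
  ultimately have "(jet1 A b has_derivative ?D) (at (a, V))" by simp
  then have "frechet_derivative (jet1 A b) (at (a, V)) = ?D"
    by (rule frechet_derivative_at[symmetric])
  with zero have D0: "?D h = 0" by simp
  then have sh: "snd h = 0" and Dq: "Re (cinner ?W (?K j *v W' h + K' j (fst h) *v ?W) + cinner (W' h) (?K j *v ?W)) = 0"
    and Dy: "Im (fst h $ j) = 0" for j
    by (simp_all only: zero_prod_def prod.inject vec_eq_iff[of "\<chi> j. _ j" "0::real^'d"] vec_lambda_beta zero_index)
  define t :: "real^'d" where "t = (\<chi> j. Re (fst h $ j))"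
  have t: "fst h = cvec t" using Dy by (simp add: t_def cvec_def vec_eq_iff complex_eq_iff)
  define Y where "Y = X' (fst h)"
  define L where "L = (\<lambda>j. K' j (fst h))"
  let ?H = "pencil A (cvec t)" and ?P = "pencil A a"
  have W'h: "W' h = - (Y *v V)" by (simp add: W'_def sh Y_def)
  have "?H ** ?X ** ?X + ?P ** Y ** ?X + ?P ** ?X ** Y - ?H ** ?X - ?H ** ?X + shifted_pencil A b a ** Y + ?H = 0"
    using locally_constant_derivative_zero[OF O ric riccati_has_derivative[OF has_derivative_ident Xd], of "cvec t"]
    by (simp add: cnj_vec_cvec hermitian_pencil_cvec[OF herm] Y_def t)
  moreover have "L j - conj_transpose Y ** ?K j ** ?X - conj_transpose ?X ** L j ** ?X - conj_transpose ?X ** ?K j ** Y = 0" for j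
    using locally_constant_derivative_zero[OF O st stein_has_derivative[OF Xd Kd], of j "fst h"]
    by (simp add: Y_def L_def)
  moreover have "Re (cinner ?W (L j *v ?W - ?K j *v (Y *v V)) - cinner (Y *v V) (?K j *v ?W)) = 0" for j
  proof -
    have "?K j *v (- v) = - (?K j *v v)" for v using matrix_vector_mult_diff_distrib[of "?K j" 0 v] by simp
    moreover have "cinner (- u) v = - cinner u v" for u v :: "complex^'n" using cinner_diff(2)[of 0 u v] by (simp add: cinner_def)
    ultimately show ?thesis
      using Dq[of j] unfolding W'h L_def by (simp add: cinner_add cinner_diff)
  qed
  ultimately have "t = 0" using inj unfolding jet1_injective_at_def Let_def by blast
  then have "fst h = 0" using t by (simp add: cvec_def vec_eq_iff)
  with sh show ?thesis by (simp add: prod_eq_iff)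
qed

text \<open>
  The explicit lifts show that \<open>(a, V)\<close> parametrizes the lifts with \<open>a\<close> small and \<open>V \<noteq> 0\<close>; the condition
  \<open>V \<noteq> 0\<close> excludes constant discs. The jet map itself is handled by the inverse function theorem.
\<close>

theorem jet_map_local_diffeomorphism_criterion:
  fixes A :: "'d::finite \<Rightarrow> complex^'n^'n"
  assumes herm: "\<And>j. hermitian (A j)" and inv: "invertible (pencil A (cvec b))"
    and ex1: "\<And>a. norm a < \<delta> \<Longrightarrow> \<exists>!X. X_solution A b a X"
    and X: "smooth_on (X_mat A b) (ball 0 \<delta>)" and K: "\<And>j. smooth_on (\<lambda>a. K_mat A b a j) (ball 0 \<delta>)"
    and st: "\<And>a j. norm a < \<delta> \<Longrightarrow> stein (X_mat A b a) (K_mat A b a j) = A j"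
    and a: "norm a < \<delta>" and V: "V \<noteq> 0" and inj: "jet1_injective_at A b a V"
  shows "jet_map_local_diffeomorphism_at A b (a, V)"
proof -
  have Xs: "X_solution A b a (X_mat A b a)" if "norm a < \<delta>" for a
    unfolding X_mat_def using ex1[OF that] by (rule theI')
  have "local_diffeomorphism_at (jet1 A b) (a, V)"
  proof (rule smooth_inverse_function_theorem)
    show "open (ball (0::complex^'d) \<delta> \<times> (UNIV :: (complex^'n) set))" by (simp add: open_Times)
    show "(a, V) \<in> ball 0 \<delta> \<times> UNIV" using a by simp
    show "smooth_on (jet1 A b) (ball 0 \<delta> \<times> UNIV)" by (rule smooth_on_jet1[OF open_ball X K])
    show "h = 0" if "frechet_derivative (jet1 A b) (at (a, V)) h = 0" for h
      using frechet_derivative_jet1_injective[OF herm open_ball _ X K _ _ inj that] a st Xs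
      by (simp add: X_solution_riccati)
  qed simp
  moreover have "open (ball (0::complex^'d) \<delta> \<times> - {0::complex^'n})"
    by (intro open_Times open_ball open_Compl closed_singleton)
  moreover have "(a, V) \<in> ball 0 \<delta> \<times> - {0}" using a V by simp
  moreover have "\<exists>!F. F \<in> S0 A b \<and> parametrized_by F q"
    and "\<forall>F\<in>S0 A b. parametrized_by F q \<longrightarrow> has_jet F (jet_embedding A b (jet1 A b q))"
    if "q \<in> ball 0 \<delta> \<times> - {0}" for q
  proof -
    obtain a V where q: "q = (a, V)" by (cases q)
    have a: "norm a < \<delta>" and V: "V \<noteq> 0" using that by (auto simp: q)
    let ?F = "explicit_lift b a (X_mat A b a) (factor_mat A b a (X_mat A b a)) (K_mat A b a) ((mat 1 - X_mat A b a) *v V)"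
    have "?F \<in> S0 A b" "parametrized_by ?F q"
      unfolding q by (rule explicit_lift_in_S0[OF herm inv Xs[OF a] st[OF a] V])+
    moreover have eq: "F = ?F" if "F \<in> S0 A b" "parametrized_by F q" for F
      by (rule lift_is_explicit[OF herm inv Xs[OF a] st[OF a] that[unfolded q]])
    ultimately show "\<exists>!F. F \<in> S0 A b \<and> parametrized_by F q" by blast
    show "\<forall>F\<in>S0 A b. parametrized_by F q \<longrightarrow> has_jet F (jet_embedding A b (jet1 A b q))"
      using eq explicit_lift_has_jet[OF herm Xs[OF a] st[OF a], of V] unfolding q by metis
  qed
  ultimately show ?thesis
    unfolding jet_map_local_diffeomorphism_at_def
    by (intro conjI exI[of _ "ball 0 \<delta> \<times> - {0}"] ballI) auto
qed


section \<open>Nilpotent \<open>X\<close>\<close>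

lemma matpow_nilpotent:
  fixes X :: "complex^'n^'n"
  assumes "X ** X = 0"
  shows "matpow X (Suc (Suc r)) = 0"
proof -
  have "matpow X (Suc (Suc r)) = (X ** X) ** matpow X r" by (simp add: matrix_mul_assoc)
  then show ?thesis by (simp add: assms matrix_mult_zero)
qed

lemma stein_nilpotent:
  fixes X :: "complex^'n^'n"
  assumes N: "X ** X = 0" and "stein X L = R"
  shows "L = R + conj_transpose X ** R ** X"
proof -
  let ?X' = "conj_transpose X"
  have N': "?X' ** ?X' = 0" using arg_cong[OF N, of conj_transpose] by (simp add: conj_transpose_mult)
  have L: "L = R + ?X' ** L ** X" using assms(2) by (auto simp: stein_def)
  have "?X' ** L ** X = ?X' ** (R + ?X' ** L ** X) ** X" by (rule arg_cong[OF L])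
  also have "\<dots> = ?X' ** R ** X + (?X' ** ?X') ** L ** (X ** X)" by (simp add: matrix_ring)
  finally have "?X' ** L ** X = ?X' ** R ** X" by (simp add: N matrix_mult_zero)
  with L show ?thesis by simp
qed

text \<open>
  When \<open>X\<^sup>2 = 0\<close> and \<open>P X = 0\<close> all series stop after two terms. The linearized equations are then solved
  explicitly for \<open>S Y\<close> and \<open>L\<close>, and with \<open>W = V - X V\<close> the derivative of the \<open>j\<close>-th middle component
  becomes twice \<open>Re ((X V)\<^sup>* A\<^sub>j (Y W - X Y V) - W\<^sup>* A\<^sub>j Y V)\<close>.
\<close>

lemma nilpotent_jet1_injective:
  fixes A :: "'d::finite \<Rightarrow> complex^'n^'n"
  assumes herm: "\<And>j. hermitian (A j)" and X: "X_solution A b a X" and Xm: "X_mat A b a = X"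
    and N: "X ** X = 0" and st: "\<And>j. stein X (K_mat A b a j) = A j"
    and PX: "pencil A a ** X = 0"
    and core: "\<And>t Y. shifted_pencil A b a ** Y = - (pencil A (cvec t) - pencil A (cvec t) ** X - pencil A (cvec t) ** X
          + conj_transpose X ** pencil A (cvec t) ** X) \<Longrightarrow>
       (\<And>j. Re (cinner (X *v V) (A j *v (Y *v (V - X *v V) - X *v (Y *v V))) - cinner (V - X *v V) (A j *v (Y *v V))) = 0)
       \<Longrightarrow> t = 0"
  shows "jet1_injective_at A b a V"
  unfolding jet1_injective_at_def Let_def Xm
proof (intro allI impI)
  fix t Y and L :: "'d \<Rightarrow> complex^'n^'n"
  let ?X' = "conj_transpose X" and ?K = "K_mat A b a" and ?P = "pencil A a" and ?H = "pencil A (cvec t)"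
    and ?S = "shifted_pencil A b a"
  define W where "W = V - X *v V"
  assume Y: "?H ** X ** X + ?P ** Y ** X + ?P ** X ** Y - ?H ** X - ?H ** X + ?S ** Y + ?H = 0"
    and L: "\<forall>j. L j - conj_transpose Y ** ?K j ** X - ?X' ** L j ** X - ?X' ** ?K j ** Y = 0"
    and q: "\<forall>j. Re (cinner (V - X *v V) (L j *v (V - X *v V) - ?K j *v (Y *v V)) - cinner (Y *v V) (?K j *v (V - X *v V))) = 0"
  have Xn: "onorm ((*v) X) < 1" using X by (simp add: X_solution_def)
  have N': "?X' ** ?X' = 0" using arg_cong[OF N, of conj_transpose] by (simp add: conj_transpose_mult)
  have K: "?K j = A j + ?X' ** A j ** X" for j by (rule stein_nilpotent[OF N st])
  have Kh: "conj_transpose (?K j) = ?K j" for j by (rule stein_hermitian[OF Xn st herm])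
  have XX: "X *v (X *v v) = 0" for v using N by (simp add: matrix_vector_mul_assoc)
  have X'X': "?X' *v (?X' *v v) = 0" for v using N' by (simp add: matrix_vector_mul_assoc)
  have S: "factor_mat A b a X = ?S" by (simp add: factor_mat_def PX)
  have P: "?P = - (?X' ** ?S)" using factorization(3)[OF herm X] unfolding S .
  have "stein X (?S ** Y) = - (?H - ?H ** X - ?H ** X)"
  proof -
    have "?P ** Y ** X + ?S ** Y + (?H - ?H ** X - ?H ** X) = 0"
      using Y by (simp add: PX matrix_mult_zero N algebra_simps flip: matrix_mul_assoc[of ?H])
    moreover have "?P ** Y ** X = - (?X' ** (?S ** Y) ** X)"
      unfolding P by (simp add: matrix_ring)
    ultimately show ?thesis by (simp add: stein_def algebra_simps eq_neg_iff_add_eq_0)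
  qed
  note Z0 = stein_nilpotent[OF N this]
  have "(?H ** X) ** X = 0" using N by (simp add: matrix_mult_zero flip: matrix_mul_assoc)
  then have "(?H - ?H ** X - ?H ** X) ** X = ?H ** X" by (simp only: matrix_diff_rdist diff_zero)
  then have "?X' ** - (?H - ?H ** X - ?H ** X) ** X = - (?X' ** ?H ** X)"
    by (simp only: matrix_mult_uminus flip: matrix_mul_assoc)
  with Z0 have Z: "?S ** Y = - (?H - ?H ** X - ?H ** X + ?X' ** ?H ** X)"
    by (simp only: minus_add_distrib)
  moreover have "Re (cinner (X *v V) (A j *v (Y *v (V - X *v V) - X *v (Y *v V))) - cinner (V - X *v V) (A j *v (Y *v V))) = 0" for j
  proof -
    define R where "R = conj_transpose Y ** ?K j ** X + ?X' ** ?K j ** Y"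
    have "stein X (L j) = R" using L[rule_format, of j] by (simp add: stein_def R_def algebra_simps)
    from stein_nilpotent[OF N this] have "L j = R + ?X' ** R ** X" .
    then have "cinner W (L j *v W) = cinner W (R *v W) + cinner (X *v W) (R *v (X *v W))"
      using cinner_adjoint[of W ?X'] by (simp add: matrix_vector_mult_add_rdistrib cinner_add matrix_vector_mul_assoc[symmetric])
    also have "cinner (X *v W) (R *v (X *v W)) = 0"
      using cinner_adjoint[of "X *v W" ?X']
      by (simp add: R_def matrix_vector_mult_add_rdistrib cinner_add matrix_vector_mul_assoc[symmetric] XX)
       (simp add: cinner_def)
    also have "cinner W (R *v W) = cinner (Y *v W) (?K j *v (X *v W)) + cinner (X *v W) (?K j *v (Y *v W))"
      using cinner_adjoint[of W ?X'] cinner_adjoint[of W "conj_transpose Y"]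
      by (simp add: R_def matrix_vector_mult_add_rdistrib cinner_add matrix_vector_mul_assoc[symmetric])
    finally have 1: "Re (cinner W (L j *v W)) = 2 * Re (cinner (X *v W) (?K j *v (Y *v W)))"
      using cinner_hermitian_swap[OF Kh, of "Y *v W" j "X *v W"] by simp
    have "Re (cinner W (L j *v W - ?K j *v (Y *v V)) - cinner (Y *v V) (?K j *v W)) = 0"
      using q unfolding W_def by blast
    then have 2: "Re (cinner (X *v W) (?K j *v (Y *v W))) - Re (cinner W (?K j *v (Y *v V))) = 0"
      using 1 cinner_hermitian_swap[OF Kh, of "Y *v V" j W] by (simp add: cinner_diff)
    have XW: "X *v W = X *v V" by (simp add: W_def matrix_vector_mult_diff_distrib XX)
    have "cinner (X *v V) (?K j *v (Y *v W)) = cinner (X *v V) (A j *v (Y *v W))"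
      using cinner_adjoint[of "X *v V" ?X']
      by (simp add: K matrix_vector_mult_add_rdistrib cinner_add matrix_vector_mul_assoc[symmetric] XX)
       (simp add: cinner_def)
    moreover have "cinner W (?K j *v (Y *v V)) = cinner W (A j *v (Y *v V)) + cinner (X *v V) (A j *v (X *v (Y *v V)))"
      using cinner_adjoint[of W ?X']
      by (simp add: K matrix_vector_mult_add_rdistrib cinner_add matrix_vector_mul_assoc[symmetric] XW)
    ultimately show ?thesis
      using 2 unfolding XW by (simp add: W_def[symmetric] matrix_vector_mult_diff_distrib[of "A j"] cinner_diff)
  qed
  ultimately show "t = 0" by (rule core)
qed

section \<open>The seven matrices\<close>

lemma UNIV_7: "(UNIV :: 7 set) = {1, 2, 3, 4, 5, 6, 7}"
  using exhaust_7 by auto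

lemma sum_7: "(\<Sum>j\<in>(UNIV :: 7 set). f j) = f 1 + f 2 + f 3 + f 4 + f 5 + f 6 + f 7"
  unfolding UNIV_7 by (simp add: ac_simps)

lemma pencil_A7_component:
  "pencil A7 c $ 1 $ 1 = c $ 1 + c $ 2" "pencil A7 c $ 1 $ 2 = c $ 4 - \<i> * c $ 7" "pencil A7 c $ 1 $ 3 = - \<i> * c $ 5"
  "pencil A7 c $ 2 $ 1 = c $ 4 + \<i> * c $ 7" "pencil A7 c $ 2 $ 2 = c $ 1 - c $ 2" "pencil A7 c $ 2 $ 3 = c $ 3 - \<i> * c $ 6"
  "pencil A7 c $ 3 $ 1 = \<i> * c $ 5" "pencil A7 c $ 3 $ 2 = c $ 3 + \<i> * c $ 6" "pencil A7 c $ 3 $ 3 = - c $ 1"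
  by (simp_all add: pencil_def sum_7 A7_def mult.commute)

text \<open>
  The real-linear map \<open>t \<mapsto> (\<Sum> t\<^sub>j A\<^sub>j) V = D t\<close> goes from dimension \<open>d\<close> to dimension \<open>2 n\<close>, so it has a kernel as
  soon as \<open>2 n < d\<close>, and this kernel is annihilated by \<open>Re (D\<^sup>* B\<inverse> D)\<close> for every \<open>B\<close>.
\<close>

lemma not_D_nondegenerate_dim:
  fixes A :: "'d::finite \<Rightarrow> complex^'n^'n"
  assumes "2 * CARD('n) < CARD('d)"
  shows "\<not> D_nondegenerate A"
proof
  assume "D_nondegenerate A"
  then obtain b V where inv: "invertible ((\<chi> j s. Re ((conj_transpose (D_matrix A V) **
                matrix_inv (pencil A (cvec b)) ** D_matrix A V) $ j $ s)) :: real^'d^'d)"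
    (is "invertible ?G") unfolding D_nondegenerate_def by blast
  let ?f = "\<lambda>t :: real^'d. pencil A (cvec t) *v V"
  have lin: "linear ?f"
    unfolding pencil_cvec_mult
    by (rule linearI) (simp_all add: scaleR_add_left sum.distrib scaleR_sum_right)
  have "\<not> inj ?f"
  proof
    assume "inj ?f"
    then have "dim (range ?f) = DIM(real^'d)"
      using eucl.dim_image_eq[of ?f UNIV] lin by (simp add: inj_on_subset)
    moreover have "dim (range ?f) \<le> DIM(complex^'n)" by (rule dim_subset_UNIV)
    ultimately show False using assms by simp
  qed
  then obtain t where t: "t \<noteq> 0" "?f t = 0" using lin by (auto simp: linear_injective_0)
  let ?M = "conj_transpose (D_matrix A V) ** matrix_inv (pencil A (cvec b))"
  have "(D_matrix A V *v cvec t) $ i = ?f t $ i" for i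
  proof -
    have "(D_matrix A V *v cvec t) $ i = (\<Sum>j\<in>UNIV. D_matrix A V $ i $ j * cvec t $ j)"
      by (rule matrix_vector_component)
    also have "\<dots> = (\<Sum>j\<in>UNIV. (t $ j) *\<^sub>R (A j *v V) $ i)"
      by (simp add: D_matrix_def cvec_def scaleR_conv_of_real mult.commute)
    finally show ?thesis by (simp only: pencil_cvec_mult sum_component vector_scaleR_component)
  qed
  then have D: "D_matrix A V *v cvec t = ?f t" by (simp only: vec_eq_iff) simp
  have "?G *v t = 0"
  proof -
    have "(?G *v t) $ j = Re (((?M ** D_matrix A V) *v cvec t) $ j)" for j
      by (simp add: matrix_vector_component cvec_def matrix_vector_mult_def)
    then show ?thesis
      by (simp add: vec_eq_iff matrix_vector_mul_assoc[symmetric] D t(2))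
  qed
  then show False
    using inv t(1) matrix_left_invertible_ker[of ?G] invertible_left_inverse by blast
qed

text \<open>
  The diagonal entries \<open>b\<^sub>1 + b\<^sub>2\<close>, \<open>b\<^sub>1 - b\<^sub>2\<close>, \<open>- b\<^sub>1\<close> of the pencil cannot all be positive.
\<close>

lemma not_strongly_pseudoconvex_A7: "\<not> strongly_pseudoconvex A7"
proof
  assume "strongly_pseudoconvex A7"
  then obtain b where pd: "\<And>z. z \<noteq> 0 \<Longrightarrow> 0 < Re (cinner z (pencil A7 (cvec b) *v z))"
    by (auto simp: strongly_pseudoconvex_def positive_definite_def)
  have "cinner (axis k 1) (M *v axis k 1) = M $ k $ k" for M :: "complex^3^3" and k
    by (simp add: cinner_def matrix_vector_component axis_def if_distrib[of cnj] if_distrib[of "\<lambda>c. _ * c"]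
        if_distrib[of "\<lambda>c. c * _"] cong: if_cong)
  then have "0 < Re (pencil A7 (cvec b) $ k $ k)" for k
    using pd[of "axis k 1"] by simp
  from this[of 1] this[of 2] this[of 3] show False
    by (simp add: pencil_A7_component cvec_def)
qed

text \<open>
  The parameters are chosen so that \<open>P = e E\<^sub>1\<^sub>2\<close> and \<open>X = - e E\<^sub>3\<^sub>1\<close>. With \<open>P\<^sup>* = e E\<^sub>2\<^sub>1\<close> of rank one,
  \<open>X = - S\<inverse> P\<^sup>*\<close> solves the Riccati equation and has square zero as soon as \<open>S\<inverse>\<close> has a vanishing
  \<open>(1, 2)\<close> entry; this holds for all \<open>e\<close> because the pencil at \<open>b\<close> has zero entries at \<open>(1, 3)\<close> and
  \<open>(3, 3)\<close>.
\<close>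

definition b7 :: "real^7" where
  "b7 = (\<chi> j. if j = 2 \<or> j = 3 then 1 else 0)"

definition a7 :: "real \<Rightarrow> complex^7" where
  "a7 e = (\<chi> j. if j = 4 then e / 2 else if j = 7 then \<i> * e / 2 else 0)"

definition V7 :: "complex^3" where
  "V7 = (\<chi> i. if i = 3 then 0 else 1)"

definition X7 :: "real \<Rightarrow> complex^3^3" where
  "X7 e = (\<chi> i k. if i = 3 \<and> k = 1 then - e else 0)"

lemma b7_component: "b7 $ 1 = 0" "b7 $ 2 = 1" "b7 $ 3 = 1" "b7 $ 4 = 0" "b7 $ 5 = 0" "b7 $ 6 = 0" "b7 $ 7 = 0"
  by (simp_all add: b7_def)

lemma a7_component: "a7 e $ 1 = 0" "a7 e $ 2 = 0" "a7 e $ 3 = 0" "a7 e $ 4 = e / 2" "a7 e $ 5 = 0" "a7 e $ 6 = 0" "a7 e $ 7 = \<i> * e / 2"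
  by (simp_all add: a7_def)

lemma V7_component: "V7 $ 1 = 1" "V7 $ 2 = 1" "V7 $ 3 = 0"
  by (simp_all add: V7_def)

lemma X7_mult: "(X7 e *v v) $ 1 = 0" "(X7 e *v v) $ 2 = 0" "(X7 e *v v) $ 3 = - e * v $ 1"
  by (simp_all add: matrix_vector_component X7_def sum_3)

lemma X7_nilpotent: "X7 e ** X7 e = 0"
  by (simp add: vec_eq_iff matrix_mult_component X7_def sum_3)

lemma pencil_a7_mult: "(pencil A7 (a7 e) *v v) $ 1 = e * v $ 2" "(pencil A7 (a7 e) *v v) $ 2 = 0" "(pencil A7 (a7 e) *v v) $ 3 = 0"
  by (simp_all add: matrix_vector_component sum_3 pencil_A7_component a7_component)

lemma pencil_cnj_a7_mult: "(pencil A7 (cnj_vec (a7 e)) *v v) $ 1 = 0" "(pencil A7 (cnj_vec (a7 e)) *v v) $ 2 = e * v $ 1"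
  "(pencil A7 (cnj_vec (a7 e)) *v v) $ 3 = 0"
  by (simp_all add: matrix_vector_component sum_3 pencil_A7_component a7_component cnj_vec_def)

lemma pencil_b7_mult: "(pencil A7 (cvec b7) *v v) $ 1 = v $ 1" "(pencil A7 (cvec b7) *v v) $ 2 = v $ 3 - v $ 2"
  "(pencil A7 (cvec b7) *v v) $ 3 = v $ 2"
  by (simp_all add: matrix_vector_component sum_3 pencil_A7_component b7_component cvec_def)

lemma shifted_a7_mult:
  "(shifted_pencil A7 b7 (a7 e) *v v) $ 1 = v $ 1 - e * v $ 2"
  "(shifted_pencil A7 b7 (a7 e) *v v) $ 2 = v $ 3 - v $ 2 - e * v $ 1"
  "(shifted_pencil A7 b7 (a7 e) *v v) $ 3 = v $ 2"
  by (simp_all add: shifted_pencil_eq matrix_vector_mult_diff_rdistrib pencil_a7_mult pencil_cnj_a7_mult pencil_b7_mult)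

lemma invertible_b7: "invertible (pencil A7 (cvec b7))"
proof -
  have "v = 0" if "pencil A7 (cvec b7) *v v = 0" for v
  proof -
    have "(pencil A7 (cvec b7) *v v) $ k = 0" for k using that by simp
    from this[of 1] this[of 2] this[of 3] show ?thesis
      by (simp add: pencil_b7_mult vec_eq_iff forall_3)
  qed
  then show ?thesis
    using matrix_left_invertible_ker[of "pencil A7 (cvec b7)"] invertible_left_inverse by blast
qed

lemma X7_solution:
  assumes "\<bar>e\<bar> < 1"
  shows "X_solution A7 b7 (a7 e) (X7 e)"
proof -
  have "norm (X7 e *v v) \<le> \<bar>e\<bar> * norm v" for v
  proof -
    have "X7 e *v v = (- e * v $ 1) *s axis 3 1"
      by (simp add: vec_eq_iff forall_3 X7_mult axis_def)
    then have "norm (X7 e *v v) = \<bar>e\<bar> * norm (v $ 1)" by (simp only: norm_vec_scale) (simp add: norm_mult)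
    also have "\<dots> \<le> \<bar>e\<bar> * norm v"
      by (intro mult_left_mono Finite_Cartesian_Product.norm_nth_le) simp
    finally show ?thesis .
  qed
  then have "onorm ((*v) (X7 e)) \<le> \<bar>e\<bar>" by (rule onorm_le)
  moreover have "riccati A7 b7 (a7 e) (X7 e) *v v = 0" for v
    unfolding riccati_def conj_transpose_pencil[OF hermitian_A7]
    by (simp add: matrix_vector_mult_add_rdistrib matrix_vector_mul_assoc[symmetric] vec_eq_iff forall_3
        pencil_a7_mult X7_mult shifted_a7_mult pencil_cnj_a7_mult)
  ultimately show ?thesis
    unfolding X_solution_riccati using assms by (simp add: matrix_eq)
qed

lemma pencil_a7_X7: "pencil A7 (a7 e) ** X7 e = 0"
proof -
  have "(pencil A7 (a7 e) ** X7 e) *v v = 0" for v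
    by (simp add: matrix_vector_mul_assoc[symmetric] vec_eq_iff forall_3 pencil_a7_mult X7_mult)
  then show ?thesis by (simp add: matrix_eq)
qed

lemma A7_mult:
  "A7 1 *v v = vector [v $ 1, v $ 2, - v $ 3]" "A7 2 *v v = vector [v $ 1, - v $ 2, 0]"
  "A7 3 *v v = vector [0, v $ 3, v $ 2]" "A7 4 *v v = vector [v $ 2, v $ 1, 0]"
  "A7 5 *v v = vector [- \<i> * v $ 3, 0, \<i> * v $ 1]" "A7 6 *v v = vector [0, - \<i> * v $ 3, \<i> * v $ 2]"
  "A7 7 *v v = vector [- \<i> * v $ 2, \<i> * v $ 1, 0]"
  by (simp_all add: vec_eq_iff forall_3 matrix_vector_component sum_3 A7_def)

lemma H7_mult:
  "(pencil A7 (cvec t) *v v) $ 1 = (t $ 1 + t $ 2) * v $ 1 + (t $ 4 - \<i> * t $ 7) * v $ 2 - \<i> * t $ 5 * v $ 3"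
  "(pencil A7 (cvec t) *v v) $ 2 = (t $ 4 + \<i> * t $ 7) * v $ 1 + (t $ 1 - t $ 2) * v $ 2 + (t $ 3 - \<i> * t $ 6) * v $ 3"
  "(pencil A7 (cvec t) *v v) $ 3 = \<i> * t $ 5 * v $ 1 + (t $ 3 + \<i> * t $ 6) * v $ 2 - t $ 1 * v $ 3"
  by (simp_all add: matrix_vector_component sum_3 pencil_A7_component cvec_def)

lemma shifted_a7_solve:
  assumes "shifted_pencil A7 b7 (a7 e) *v y = p"
  shows "y $ 1 = p $ 1 + e * p $ 3" "y $ 2 = p $ 3" "y $ 3 = e * p $ 1 + p $ 2 + (1 + e\<^sup>2) * p $ 3"
  by (simp_all add: shifted_a7_mult[of e y, unfolded assms] algebra_simps power2_eq_square)

lemma conj_transpose_X7_mult: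
  "(conj_transpose (X7 e) *v v) $ 1 = - e * v $ 3" "(conj_transpose (X7 e) *v v) $ 2 = 0" "(conj_transpose (X7 e) *v v) $ 3 = 0"
  by (simp_all add: matrix_vector_component conj_transpose_component X7_def sum_3)


text \<open>
  The conditions split into real and imaginary parts. The real ones (\<open>j = 1, 2, 3, 4\<close>) involve
  \<open>t\<^sub>1, \<dots>, t\<^sub>4\<close> and reduce to \<open>(1 - 4 e + e\<^sup>2) t\<^sub>1 = 0\<close>; the imaginary ones (\<open>j = 5, 6, 7\<close>) involve
  \<open>t\<^sub>5, t\<^sub>6, t\<^sub>7\<close> and reduce to \<open>e t\<^sub>6 = 0\<close>.
\<close>

lemma jacobian_system:
  assumes e: "0 < e" "e < 1/8"
    and Y: "shifted_pencil A7 b7 (a7 e) ** Y = - (pencil A7 (cvec t) - pencil A7 (cvec t) ** X7 e - pencil A7 (cvec t) ** X7 e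
          + conj_transpose (X7 e) ** pencil A7 (cvec t) ** X7 e)"
    and q: "\<And>j. Re (cinner (X7 e *v V7) (A7 j *v (Y *v (V7 - X7 e *v V7) - X7 e *v (Y *v V7)))
        - cinner (V7 - X7 e *v V7) (A7 j *v (Y *v V7))) = 0"
  shows "t = 0"
proof -
  have SY: "shifted_pencil A7 b7 (a7 e) *v (Y *v v) =
      - (pencil A7 (cvec t) *v v - pencil A7 (cvec t) *v (X7 e *v v) - pencil A7 (cvec t) *v (X7 e *v v)
          + conj_transpose (X7 e) *v (pencil A7 (cvec t) *v (X7 e *v v)))" for v
    unfolding matrix_vector_mul_assoc Y matrix_vector_uminus matrix_vector_mult_add_rdistrib
      matrix_vector_mult_diff_rdistrib matrix_mul_assoc ..
  define y where "y = Y *v V7"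
  define z where "z = Y *v (V7 - X7 e *v V7)"
  note simps = H7_mult X7_mult conj_transpose_X7_mult V7_component power2_eq_square
  have y: "Re (y $ 1) = - (t$1 + t$2 + t$4 - e\<^sup>2 * t$1) - e * (t$3 - 2 * e * t$1)"
      "Im (y $ 1) = t$7 + 2 * e * t$5 - e * (t$5 + t$6)"
      "Re (y $ 2) = - (t$3 - 2 * e * t$1)" "Im (y $ 2) = - (t$5 + t$6)"
      "Re (y $ 3) = - e * (t$1 + t$2 + t$4 - e\<^sup>2 * t$1) - (t$1 - t$2 + t$4 + 2 * e * t$3) - (1 + e\<^sup>2) * (t$3 - 2 * e * t$1)"
      "Im (y $ 3) = e * (t$7 + 2 * e * t$5) - (t$7 - 2 * e * t$6) - (1 + e\<^sup>2) * (t$5 + t$6)"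
    unfolding shifted_a7_solve[OF SY[of V7, folded y_def]] by (simp_all add: simps algebra_simps)
  have z: "Re (z $ 1) = Re (y $ 1) + e\<^sup>2 * t$1" "Im (z $ 1) = Im (y $ 1) + e * t$5"
      "Re (z $ 2) = Re (y $ 2) + e * t$1" "Im (z $ 2) = Im (y $ 2)"
      "Re (z $ 3) = Re (y $ 3) - e * t$3 + (1 + e\<^sup>2) * e * t$1"
    unfolding y shifted_a7_solve[OF SY[of "V7 - X7 e *v V7", folded z_def]] by (simp_all add: simps algebra_simps)
  have q': "Re (cinner (X7 e *v V7) (A7 j *v (z - X7 e *v y)) - cinner (V7 - X7 e *v V7) (A7 j *v y)) = 0" for j
    using q[of j] unfolding y_def z_def .
  note qs = cinner_def sum_3 A7_mult X7_mult V7_component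
  have q1: "e * (Re (z $ 3) + e * Re (y $ 1)) - Re (y $ 1) - Re (y $ 2) + e * Re (y $ 3) = 0"
    using q'[of 1] by (simp add: qs algebra_simps)
  have q2: "Re (y $ 1) = Re (y $ 2)" using q'[of 2] by (simp add: qs)
  have q3: "e * Re (z $ 2) + Re (y $ 3) + e * Re (y $ 2) = 0" using q'[of 3] by (simp add: qs algebra_simps)
  have q4: "Re (y $ 1) + Re (y $ 2) = 0" using q'[of 4] by (simp add: qs)
  have q5: "e * Im (z $ 1) - Im (y $ 3) + e * Im (y $ 1) = 0" using q'[of 5] by (simp add: qs algebra_simps)
  have q6: "e * Im (z $ 2) - Im (y $ 3) + e * Im (y $ 2) = 0" using q'[of 6] by (simp add: qs algebra_simps)
  have q7: "Im (y $ 1) = Im (y $ 2)" using q'[of 7] by (simp add: qs)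
  have y0: "Re (y $ 1) = 0" "Re (y $ 2) = 0" using q2 q4 by simp_all
  have t3: "t$3 = 2 * e * t$1" using y0(2) y(3) by simp
  have t124: "t$1 + t$2 + t$4 = e\<^sup>2 * t$1" using y0(1) y(1) t3 by simp
  have "e * (Re (z $ 3) + Re (y $ 3)) = 0" using q1 y0 by (simp add: algebra_simps)
  then have "Re (z $ 3) + Re (y $ 3) = 0" using e by simp
  moreover have y3: "Re (y $ 3) = - e\<^sup>2 * t$1" using q3 y0 z(3) by (simp add: power2_eq_square)
  ultimately have "e * ((1 - 4 * e + e\<^sup>2) * t$1) = 0"
    unfolding z(5) t3 y3 by (simp add: algebra_simps power2_eq_square)
  moreover have "1 - 4 * e + e\<^sup>2 > 0" using e zero_le_power2[of e] by linarith
  ultimately have t1: "t$1 = 0" using e by simp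
  have "t$1 - t$2 + t$4 = 0" using y(5) y3 t124 t3 t1 by simp
  then have t24: "t$2 = 0" "t$4 = 0" using t124 t1 by simp_all
  have "e * Im (z $ 1) = e * Im (z $ 2)" using q5 q6 unfolding q7 by linarith
  then have "Im (z $ 1) = Im (z $ 2)" using e by simp
  then have t5: "t$5 = 0" using z(2,4) q7 e by simp
  have t7: "t$7 = e * t$6 - t$6" using q7 y(2,4) t5 by simp
  have "2 * e * Im (y $ 2) = Im (y $ 3)" using q6 z(4) by simp
  then have "e * t$6 = 0"
    unfolding y(4,6) t5 t7 by (simp add: algebra_simps power2_eq_square)
  then have t6: "t$6 = 0" using e by simp
  show "t = 0"
    using t1 t24 t3 t5 t6 t7 by (simp add: vec_eq_iff forall_7)
qed

lemma shifted_a7_inv: "invertible (shifted_pencil A7 b7 (a7 e))"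
proof -
  have "v = 0" if "shifted_pencil A7 b7 (a7 e) *v v = 0" for v
    using shifted_a7_solve[OF that] by (simp add: vec_eq_iff forall_3)
  then show ?thesis
    using matrix_left_invertible_ker[of "shifted_pencil A7 b7 (a7 e)"] invertible_left_inverse by blast
qed

lemma hermitian_cinner: "hermitian M \<Longrightarrow> cinner x (M *v y) = cinner (M *v x) y"
  by (simp add: cinner_adjoint[of x] hermitian_def)

text \<open>
  As \<open>X\<^sup>2 = 0\<close>, the series has only the terms \<open>r = 0, 1\<close>. The first one alone is singular, since
  \<open>t \<mapsto> (\<Sum> t\<^sub>j A\<^sub>j) V\<close> has a kernel; the second one, of order \<open>e\<^sup>2\<close>, removes it. A vector \<open>t\<close> in the kernel of the sum
  satisfies a system of the same shape as that for the jet map.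
\<close>

lemma Da_nondegenerate_a7:
  assumes e: "0 < e" and Xm: "X_mat A7 b7 (a7 e) = X7 e"
  shows "Da_nondegenerate A7 b7 (a7 e)"
  unfolding Da_nondegenerate_def Xm
proof (rule exI[of _ V7])
  let ?X = "X7 e" and ?S = "shifted_pencil A7 b7 (a7 e)"
  let ?T = "\<lambda>j s r. cinner V7 ((matpow (conj_transpose ?X) r ** A7 j ** matrix_inv ?S ** A7 s ** matpow ?X r) *v V7)"
  let ?G = "(\<chi> j s. Re (\<Sum>r. ?T j s r)) :: real^7^7"
  have T: "?T j s r = cinner (A7 j *v (matpow ?X r *v V7)) (matrix_inv ?S *v (A7 s *v (matpow ?X r *v V7)))" for j s r
    using cinner_adjoint[of V7 "conj_transpose (matpow ?X r)"]
    by (simp add: matrix_vector_mul_assoc[symmetric] conj_transpose_matpow[symmetric] hermitian_cinner[OF hermitian_A7])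
  have sumT: "(\<Sum>r. ?T j s r) = ?T j s 0 + ?T j s 1" for j s
  proof -
    have "?T j s r = 0" if "r \<notin> {0, 1}" for r
    proof -
      have "r = Suc (Suc (r - 2))" using that by (cases r) auto
      then obtain r' where r: "r = Suc (Suc r')" by blast
      show ?thesis unfolding T r matpow_nilpotent[OF X7_nilpotent] by (simp add: cinner_def)
    qed
    then have "(\<Sum>r. ?T j s r) = (\<Sum>r\<in>{0, 1}. ?T j s r)" by (intro suminf_finite) auto
    then show ?thesis by simp
  qed
  have "t = 0" if Gt: "?G *v t = 0" for t
  proof -
    define x where "x = ?X *v V7"
    define y where "y = matrix_inv ?S *v (pencil A7 (cvec t) *v V7)"
    define z where "z = matrix_inv ?S *v (pencil A7 (cvec t) *v x)"
    have lin: "(\<Sum>s\<in>UNIV. Re (cinner u (matrix_inv ?S *v (A7 s *v v))) * t $ s) =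
        Re (cinner u (matrix_inv ?S *v (pencil A7 (cvec t) *v v)))" for u v
    proof -
      have "linear (\<lambda>w. Re (cinner u (matrix_inv ?S *v w)))"
        by (intro bounded_linear.linear bounded_linear_compose[OF bounded_linear_Re]
            bounded_linear_compose[OF bounded_bilinear.bounded_linear_right[OF bounded_bilinear_cinner]]
            matrix_vector_mul_bounded_linear)
      then show ?thesis
        unfolding pencil_cvec_mult
        using linear_sum[of "\<lambda>w. Re (cinner u (matrix_inv ?S *v w))" "\<lambda>s. (t $ s) *\<^sub>R (A7 s *v v)" UNIV]
        by (simp add: linear_scale cinner_scaleR mult.commute)
    qed
    have q: "Re (cinner (A7 j *v V7) y) + Re (cinner (A7 j *v x) z) = 0" for j
    proof -
      have "(?G *v t) $ j = (\<Sum>s\<in>UNIV. (Re (cinner (A7 j *v V7) (matrix_inv ?S *v (A7 s *v V7)))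
          + Re (cinner (A7 j *v x) (matrix_inv ?S *v (A7 s *v x)))) * t $ s)"
      proof -
        have "(?G *v t) $ j = (\<Sum>s\<in>UNIV. ?G $ j $ s * t $ s)" by (simp add: matrix_vector_mult_def)
        also have "\<dots> = (\<Sum>s\<in>UNIV. Re (?T j s 0 + ?T j s 1) * t $ s)"
          unfolding vec_lambda_beta sumT ..
        finally show ?thesis unfolding T by (simp add: x_def)
      qed
      also have "\<dots> = Re (cinner (A7 j *v V7) y) + Re (cinner (A7 j *v x) z)"
        unfolding y_def z_def by (simp add: distrib_right sum.distrib lin)
      finally show ?thesis using Gt by simp
    qed
    have S: "?S *v (matrix_inv ?S *v v) = v" for v
      using matrix_inv_inverse(1)[OF shifted_a7_inv] by (simp add: matrix_vector_mul_assoc)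
    note simps = H7_mult X7_mult V7_component power2_eq_square x_def
    have y: "Re (y $ 1) = t$1 + t$2 + t$4 + e * t$3" "Im (y $ 1) = - t$7 + e * (t$5 + t$6)"
      "Re (y $ 2) = t$3" "Im (y $ 2) = t$5 + t$6"
      "Re (y $ 3) = e * (t$1 + t$2 + t$4) + (t$1 - t$2 + t$4) + (1 + e\<^sup>2) * t$3"
      "Im (y $ 3) = - e * t$7 + t$7 + (1 + e\<^sup>2) * (t$5 + t$6)"
      unfolding shifted_a7_solve[OF S[of "pencil A7 (cvec t) *v V7", folded y_def]] by (simp_all add: simps algebra_simps)
    have z: "Im (z $ 1) = e * t$5" "Re (z $ 2) = e * t$1" "Im (z $ 2) = 0"
      "Re (z $ 3) = - e * (t$3 - (1 + e\<^sup>2) * t$1)"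
      unfolding shifted_a7_solve[OF S[of "pencil A7 (cvec t) *v x", folded z_def]] by (simp_all add: simps algebra_simps)
    note qs = cinner_def sum_3 A7_mult X7_mult V7_component x_def
    have q1: "Re (y $ 1) + Re (y $ 2) + e * Re (z $ 3) = 0" using q[of 1] by (simp add: qs)
    have q2: "Re (y $ 1) = Re (y $ 2)" using q[of 2] by (simp add: qs)
    have q3: "Re (y $ 3) - e * Re (z $ 2) = 0" using q[of 3] by (simp add: qs)
    have q4: "Re (y $ 1) + Re (y $ 2) = 0" using q[of 4] by (simp add: qs)
    have q5: "Im (y $ 3) + e * Im (z $ 1) = 0" using q[of 5] by (simp add: qs)
    have q6: "Im (y $ 3) + e * Im (z $ 2) = 0" using q[of 6] by (simp add: qs)
    have q7: "Im (y $ 1) = Im (y $ 2)" using q[of 7] by (simp add: qs)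
    have t3: "t$3 = 0" using q2 q4 y(3) by simp
    have t124: "t$1 + t$2 + t$4 = 0" using q2 q4 y(1) t3 by simp
    have "e * Re (z $ 3) = 0" using q1 q4 by simp
    then have "(1 + e\<^sup>2) * t$1 = 0" using e z(4) t3 by simp
    moreover have "1 + e\<^sup>2 \<noteq> 0" using zero_le_power2[of e] by linarith
    ultimately have t1: "t$1 = 0" by simp
    have "t$1 - t$2 + t$4 = 0" using q3 y(5) z(2) t124 t3 t1 by simp
    then have t24: "t$2 = 0" "t$4 = 0" using t124 t1 by simp_all
    have "e * Im (z $ 1) = 0" using q5 q6 z(3) by simp
    then have t5: "t$5 = 0" using z(1) e by simp
    have t7: "t$7 = e * t$6 - t$6" using q7 y(2,4) t5 by simp
    have "Im (y $ 3) = 0" using q6 z(3) by simp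
    then have "e * t$6 = 0" unfolding y(6) t5 t7 by (simp add: algebra_simps power2_eq_square)
    then have t6: "t$6 = 0" using e by simp
    show ?thesis using t1 t24 t3 t5 t6 t7 by (simp add: vec_eq_iff forall_7)
  qed
  then show "invertible ?G"
    using matrix_left_invertible_ker[of ?G] invertible_left_inverse by blast
qed

theorem theorem2p4:
  shows "\<not> strongly_pseudoconvex A7 \<and>
    \<not> D_nondegenerate A7 \<and>
    (\<exists>b :: real^7. invertible (pencil A7 (cvec b)) \<and>
      (\<forall>\<epsilon>>0. \<exists>(a :: complex^7) (V :: complex^3).
         a \<noteq> 0 \<and> norm a < \<epsilon> \<and> small_enough A7 b a \<and>
         Da_nondegenerate A7 b a \<and>
         jet_map_local_diffeomorphism_at A7 b (a, V)))"
proof (intro conjI exI[of _ b7] allI impI)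
  show "\<not> strongly_pseudoconvex A7" by (rule not_strongly_pseudoconvex_A7)
  show "\<not> D_nondegenerate A7" by (rule not_D_nondegenerate_dim) simp
  show "invertible (pencil A7 (cvec b7))" by (rule invertible_b7)
  fix \<epsilon> :: real assume \<epsilon>: "\<epsilon> > 0"
  obtain \<delta> where \<delta>: "\<delta> > 0"
    "\<And>a. norm a < \<delta> \<Longrightarrow> invertible (shifted_pencil A7 b7 a)"
    "\<And>a. norm a < \<delta> \<Longrightarrow> \<exists>!X. X_solution A7 b7 a X"
    "smooth_on (X_mat A7 b7) (ball 0 \<delta>)" "\<And>j. smooth_on (\<lambda>a. K_mat A7 b7 a j) (ball 0 \<delta>)"
    "\<And>a j. norm a < \<delta> \<Longrightarrow> stein (X_mat A7 b7 a) (K_mat A7 b7 a j) = A7 j"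
    using X_mat_K_mat_smooth[OF invertible_b7] by blast
  \<comment> \<open>Below \<open>1/8\<close> the factor \<open>1 - 4 e + e\<^sup>2\<close> of the Jacobian system is positive; the norm of \<open>a\<close> is at most \<open>e\<close>.\<close>
  define e where "e = min (1/16) (min \<epsilon> \<delta> / 2)"
  have e: "0 < e" "e < 1/8" "e < \<epsilon>" "e < \<delta>" using \<epsilon> \<delta>(1) by (auto simp: e_def)
  let ?a = "a7 e"
  have "norm ?a \<le> (\<Sum>j\<in>UNIV. norm (?a $ j))" by (simp add: norm_vec_def L2_set_le_sum)
  also have "\<dots> = e" using e(1) by (simp add: sum_7 a7_component norm_mult)
  finally have a: "norm ?a < \<epsilon>" "norm ?a < \<delta>" using e by simp_all
  have "?a $ 4 \<noteq> 0" using e(1) by (simp add: a7_component)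
  then have a0: "?a \<noteq> 0" by auto
  have Xs: "X_solution A7 b7 ?a (X7 e)" using e by (intro X7_solution) simp
  have Xm: "X_mat A7 b7 ?a = X7 e"
    unfolding X_mat_def using \<delta>(3)[OF a(2)] Xs by (rule the1_equality)
  have "V7 $ 1 \<noteq> 0" by (simp add: V7_component)
  then have V0: "V7 \<noteq> 0" by auto
  have inj: "jet1_injective_at A7 b7 ?a V7"
    by (rule nilpotent_jet1_injective[OF hermitian_A7 Xs Xm X7_nilpotent \<delta>(6)[OF a(2), unfolded Xm] pencil_a7_X7])
      (rule jacobian_system[OF e(1,2)])
  show "\<exists>(a :: complex^7) (V :: complex^3). a \<noteq> 0 \<and> norm a < \<epsilon> \<and> small_enough A7 b7 a \<and>
         Da_nondegenerate A7 b7 a \<and> jet_map_local_diffeomorphism_at A7 b7 (a, V)"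
  proof (intro exI conjI)
    show "?a \<noteq> 0" "norm ?a < \<epsilon>" by (rule a0 a)+
    show "small_enough A7 b7 ?a"
      unfolding small_enough_def using \<delta>(2,3) a(2) by blast
    show "Da_nondegenerate A7 b7 ?a" by (rule Da_nondegenerate_a7[OF e(1) Xm])
    show "jet_map_local_diffeomorphism_at A7 b7 (?a, V7)"
      by (rule jet_map_local_diffeomorphism_criterion[OF hermitian_A7 invertible_b7 \<delta>(3,4,5,6) a(2) V0 inj])
  qed
qed

end
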